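(* Let $R$ be a principal ideal domain and let $\mathbf{grA}$ denote the category of graded algebras over $R$. The functor $\mathrm{Cotor}^{(-)}(-;R):\mathbf{CA}^r\to\mathbf{grA}$ extends to a functor $$\mathrm{Cotor}^{(-)}(-;R):\mathbf{CASH}\to\mathbf{grA}.$$
   Context: Chain complexes are over $R$, with $R$-free underlying graded modules for all chain (co)algebras; the Koszul sign convention is used. $V_+=V_{>0}$; $s^{-1}$ is desuspension, $s^{-1}1:=0$. Chain coalgebras are coassociative, counital, coaugmented, non-negatively graded with degree $0$ part $R$. Chain Hopf algebras $H$ (chain algebras with coassociative counital comultiplication that is a chain algebra map) are simply connected: $H_0=R$, $H_1=0$. $\Omega C=(T(s^{-1}C_+),d_\Omega)$ with $d_\Omega(s^{-1}c)=-s^{-1}(dc)+\sum(-1)^{|c_i|}s^{-1}c_i\,s^{-1}c^i$, $\overline\Delta(c)=\sum c_i\otimes c^i$ the reduced comultiplication. A right $H$-comodule algebra is a chain algebra $B$ with a right $H$-coaction $\nu$, $\nu(b)=\sum b_i\otimes h^i$, that is a chain algebra map. $B\otimes_{t_\Omega}\Omega H$ is $B\otimes\Omega H$ with $D_\Omega(b\otimes w)=db\otimes w+(-1)^{|b|}b\otimes d_\Omega w-\sum(-1)^{|b_i|}b_i\otimes s^{-1}h^i\,w$; it is a chain algebra containing $B$ and $\Omega H$ as subalgebras with $(b\otimes1)(1\otimes w)=b\otimes w$ and $(1\otimes s^{-1}a)(b\otimes1)=\sum(-1)^{(|a|-1)|b_i|}b_i\otimes s^{-1}(ah^i)$, $a\in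 H_+$. $\mathrm{Cotor}^H(B,R)=\mathrm H_*(B\otimes_{t_\Omega}\Omega H)$ with the induced graded algebra structure. $\mathbf{CA}^r$: objects are pairs $(H;B)$, $H$ a chain Hopf algebra, $B$ a right $H$-comodule algebra; a morphism $(H;B)\to(H';B')$ is a pair $(f;g)$, $f:H\to H'$ a chain Hopf algebra morphism and $g:B\to B'$ a chain algebra map with $(g\otimes f)\nu=\nu'g$. The functor on $\mathbf{CA}^r$ sends $(H;B)$ to $\mathrm{Cotor}^H(B,R)$ and $(f;g)$ to $\mathrm H_*(g\otimes\Omega f)$. Pseudo Hopf algebra morphisms. For a chain algebra map $\theta:\Omega C\to\Omega C'$, write $\theta(s^{-1}c)=\sum_k\sum s^{-1}c_1\cdots s^{-1}c_k$ and let $\Delta^{(k)}(d)=\sum d_{(1)}\otimes\cdots\otimes d_{(k)}$ be the $k$-fold unreduced comultiplication. Define chain algebra maps $\theta\curlywedge D:\Omega(C\otimes D)\to\Omega(C'\otimes D)$ and $D\curlywedge\theta:\Omega(D\otimes C)\to\Omega(D\otimes C')$ by $s^{-1}(1\otimes d)\mapsto s^{-1}(1\otimes d)$, $s^{-1}(d\otimes1)\mapsto s^{-1}(d\otimes1)$ respectively and, for $c\in C_+$, $s^{-1}(c\otimes d)\mapsto\sum\pm s^{-1}(c_1\otimes d_{(1)})\cdots s^{-1}(c_k\otimes d_{(k)})$ and $s^{-1}(d\otimes c)\mapsto\sum\pm s^{-1}(d_{(1)}\otimes c_1)\cdots s^{-1}(d_{(k)}\otimes c_k)$, with the Koszul sign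 of interleaving the symbols $s^{-1}c_j$ and $d_{(j)}$. Put $\theta\curlywedge\theta=(C'\curlywedge\theta)\circ(\theta\curlywedge C)$. A pseudo Hopf algebra morphism from $H$ to $H'$ is a chain algebra map $\theta:\Omega H\to\Omega H'$ with $\theta\circ\Omega(\mu_H)=\Omega(\mu_{H'})\circ(\theta\curlywedge\theta)$, $\mu$ denoting multiplications. $\mathbf{CASH}$: same objects as $\mathbf{CA}^r$; a morphism $(H;B)\to(H';B')$ is a pair $(\theta;\gamma)$ where $\theta$ is a pseudo Hopf algebra morphism from $H$ to $H'$ and $\gamma:B\otimes_{t_\Omega}\Omega H\to B'\otimes_{t_\Omega}\Omega H'$ is a morphism of both chain algebras and right $\Omega H$-modules, the $\Omega H$-module structure on the target being via $\theta:\Omega H\to\Omega H'$; composition is componentwise. $\mathbf{CA}^r$ embeds in $\mathbf{CASH}$ by $(f;g)\mapsto(\Omega f;g\otimes\Omega f)$. *)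

theory Defs
  imports "HOL-Library.Poly_Mapping" "HOL-Library.FuncSet"
begin

text \<open>
  A free graded module is given by a set of homogeneous generators with a degree
  function.  Its elements are the finitely supported functions with support in that set; the
  tensor product and the tensor algebra of free modules are the free modules on pairs and on
  words of generators.  Morphisms are arbitrary linear maps: they need not respect the
  generators.  Degrees are integers; only coalgebras and Hopf algebras are required to be
  non-negatively graded.
\<close>

section \<open>Free graded modules\<close>

definition pid :: "'r::idom itself \<Rightarrow> bool" where
  "pid _ \<longleftrightarrow> (\<forall>I :: 'r set.
     0 \<in> I \<and> (\<forall>a\<in>I. \<forall>b\<in>I. a + b \<in> I) \<and> (\<forall>r. \<forall>a\<in>I. r * a \<in> I) \<longrightarrow>
     (\<exists>a. I = range (\<lambda>r. r * a)))"

definition ksgn :: "int \<Rightarrow> 'r::comm_ring_1" where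
  "ksgn n = (if even n then 1 else - 1)"

abbreviation gen :: "'x \<Rightarrow> ('x \<Rightarrow>\<^sub>0 'r::comm_ring_1)" where
  "gen x \<equiv> Poly_Mapping.single x 1"

definition smul :: "'r::comm_ring_1 \<Rightarrow> ('x \<Rightarrow>\<^sub>0 'r) \<Rightarrow> ('x \<Rightarrow>\<^sub>0 'r)" where
  "smul c v = Poly_Mapping.map ((*) c) v"

text \<open>Linear extension of a map defined on generators.\<close>

definition lext :: "('x \<Rightarrow> ('z \<Rightarrow>\<^sub>0 'r)) \<Rightarrow> ('x \<Rightarrow>\<^sub>0 'r::comm_ring_1) \<Rightarrow> ('z \<Rightarrow>\<^sub>0 'r)" where
  "lext f v = (\<Sum>x\<in>Poly_Mapping.keys v. smul (Poly_Mapping.lookup v x) (f x))"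

definition tens :: "('x \<Rightarrow>\<^sub>0 'r::comm_ring_1) \<Rightarrow> ('y \<Rightarrow>\<^sub>0 'r) \<Rightarrow> ('x \<times> 'y \<Rightarrow>\<^sub>0 'r)" where
  "tens u v = lext (\<lambda>x. lext (\<lambda>y. gen (x, y)) v) u"

text \<open>The tensor product of two linear maps of degree 0.\<close>

definition tmap :: "(('x \<Rightarrow>\<^sub>0 'r) \<Rightarrow> ('z \<Rightarrow>\<^sub>0 'r)) \<Rightarrow> (('y \<Rightarrow>\<^sub>0 'r) \<Rightarrow> ('w \<Rightarrow>\<^sub>0 'r)) \<Rightarrow>
    ('x \<times> 'y \<Rightarrow>\<^sub>0 'r::comm_ring_1) \<Rightarrow> ('z \<times> 'w \<Rightarrow>\<^sub>0 'r)" where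
  "tmap f g = lext (\<lambda>(x, y). tens (f (gen x)) (g (gen y)))"

definition assoc :: "(('x \<times> 'y) \<times> 'z \<Rightarrow>\<^sub>0 'r::comm_ring_1) \<Rightarrow> ('x \<times> ('y \<times> 'z) \<Rightarrow>\<^sub>0 'r)" where
  "assoc = lext (\<lambda>((x, y), z). gen (x, (y, z)))"

record 'x gbasis =
  gens :: "'x set"
  deg :: "'x \<Rightarrow> int"

definition fre :: "('x, 'b) gbasis_scheme \<Rightarrow> ('x \<Rightarrow>\<^sub>0 'r::comm_ring_1) set" where
  "fre M = {v. Poly_Mapping.keys v \<subseteq> gens M}"

definition piece :: "('x, 'b) gbasis_scheme \<Rightarrow> int \<Rightarrow> ('x \<Rightarrow>\<^sub>0 'r::comm_ring_1) set" where
  "piece M n = {v \<in> fre M. \<forall>x\<in>Poly_Mapping.keys v. deg M x = n}"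

definition posgens :: "('x, 'b) gbasis_scheme \<Rightarrow> 'x set" where
  "posgens M = {x \<in> gens M. 0 < deg M x}"

definition gtensor :: "('x, 'b) gbasis_scheme \<Rightarrow> ('y, 'c) gbasis_scheme \<Rightarrow> ('x \<times> 'y) gbasis" where
  "gtensor M N = \<lparr>gens = gens M \<times> gens N, deg = (\<lambda>(x, y). deg M x + deg N y)\<rparr>"

definition linear_map :: "('x, 'b) gbasis_scheme \<Rightarrow> ('y, 'c) gbasis_scheme \<Rightarrow>
    (('x \<Rightarrow>\<^sub>0 'r::comm_ring_1) \<Rightarrow> ('y \<Rightarrow>\<^sub>0 'r)) \<Rightarrow> bool" where
  "linear_map M N f \<longleftrightarrow>
     (\<forall>u\<in>fre M. f u \<in> fre N) \<and>
     (\<forall>u\<in>fre M. \<forall>v\<in>fre M. f (u + v) = f u + f v) \<and>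
     (\<forall>c. \<forall>u\<in>fre M. f (smul c u) = smul c (f u))"

definition graded_map :: "int \<Rightarrow> ('x, 'b) gbasis_scheme \<Rightarrow> ('y, 'c) gbasis_scheme \<Rightarrow>
    (('x \<Rightarrow>\<^sub>0 'r::comm_ring_1) \<Rightarrow> ('y \<Rightarrow>\<^sub>0 'r)) \<Rightarrow> bool" where
  "graded_map k M N f \<longleftrightarrow>
     linear_map M N f \<and> (\<forall>n. \<forall>u\<in>piece M n. f u \<in> piece N (n + k))"

section \<open>Chain complexes, algebras, coalgebras and Hopf algebras\<close>

record (overloaded) ('x, 'r) chain_cx = "'x gbasis" +
  dif :: "('x \<Rightarrow>\<^sub>0 'r) \<Rightarrow> ('x \<Rightarrow>\<^sub>0 'r)"

definition chain_complex :: "('x, 'r::comm_ring_1, 'b) chain_cx_scheme \<Rightarrow> bool" where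
  "chain_complex M \<longleftrightarrow> graded_map (- 1) M M (dif M) \<and> (\<forall>v\<in>fre M. dif M (dif M v) = 0)"

definition tensor_dif :: "('x, 'r::comm_ring_1, 'b) chain_cx_scheme \<Rightarrow>
    ('y, 'r, 'c) chain_cx_scheme \<Rightarrow> ('x \<times> 'y \<Rightarrow>\<^sub>0 'r) \<Rightarrow> ('x \<times> 'y \<Rightarrow>\<^sub>0 'r)" where
  "tensor_dif M N = lext (\<lambda>(x, y).
     tens (dif M (gen x)) (gen y) + smul (ksgn (deg M x)) (tens (gen x) (dif N (gen y))))"

definition tensor_cx :: "('x, 'r::comm_ring_1, 'b) chain_cx_scheme \<Rightarrow>
    ('y, 'r, 'c) chain_cx_scheme \<Rightarrow> ('x \<times> 'y, 'r) chain_cx" where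
  "tensor_cx M N =
     \<lparr>gens = gens (gtensor M N), deg = deg (gtensor M N), dif = tensor_dif M N\<rparr>"

definition chain_map :: "('x, 'r::comm_ring_1, 'b) chain_cx_scheme \<Rightarrow>
    ('y, 'r, 'c) chain_cx_scheme \<Rightarrow> (('x \<Rightarrow>\<^sub>0 'r) \<Rightarrow> ('y \<Rightarrow>\<^sub>0 'r)) \<Rightarrow> bool" where
  "chain_map M N f \<longleftrightarrow> graded_map 0 M N f \<and> (\<forall>v\<in>fre M. f (dif M v) = dif N (f v))"

record (overloaded) ('x, 'r) chain_alg = "('x, 'r) chain_cx" +
  mul :: "('x \<times> 'x \<Rightarrow>\<^sub>0 'r) \<Rightarrow> ('x \<Rightarrow>\<^sub>0 'r)"
  unt :: "'x \<Rightarrow>\<^sub>0 'r"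

definition chain_algebra :: "('x, 'r::comm_ring_1, 'b) chain_alg_scheme \<Rightarrow> bool" where
  "chain_algebra A \<longleftrightarrow>
     chain_complex A \<and> chain_map (tensor_cx A A) A (mul A) \<and>
     unt A \<in> piece A 0 \<and> dif A (unt A) = 0 \<and>
     (\<forall>a\<in>fre A. mul A (tens (unt A) a) = a \<and> mul A (tens a (unt A)) = a) \<and>
     (\<forall>a\<in>fre A. \<forall>b\<in>fre A. \<forall>c\<in>fre A.
        mul A (tens (mul A (tens a b)) c) = mul A (tens a (mul A (tens b c))))"

definition chain_algebra_map :: "('x, 'r::comm_ring_1, 'b) chain_alg_scheme \<Rightarrow>
    ('y, 'r, 'c) chain_alg_scheme \<Rightarrow> (('x \<Rightarrow>\<^sub>0 'r) \<Rightarrow> ('y \<Rightarrow>\<^sub>0 'r)) \<Rightarrow> bool" where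
  "chain_algebra_map A A' f \<longleftrightarrow>
     chain_map A A' f \<and> f (unt A) = unt A' \<and>
     (\<forall>a\<in>fre A. \<forall>b\<in>fre A. f (mul A (tens a b)) = mul A' (tens (f a) (f b)))"

definition tensor_alg :: "('x, 'r::comm_ring_1, 'b) chain_alg_scheme \<Rightarrow>
    ('y, 'r, 'c) chain_alg_scheme \<Rightarrow> ('x \<times> 'y, 'r) chain_alg" where
  "tensor_alg A B =
     \<lparr>gens = gens (gtensor A B), deg = deg (gtensor A B), dif = tensor_dif A B,
      mul = lext (\<lambda>((x, y), (x', y')). smul (ksgn (deg B y * deg A x'))
              (tens (mul A (gen (x, x'))) (mul B (gen (y, y'))))),
      unt = tens (unt A) (unt B)\<rparr>"

text \<open>\<open>coone\<close> is the image of 1 under the coaugmentation.\<close>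

record (overloaded) ('x, 'r) chain_coalg = "('x, 'r) chain_cx" +
  comul :: "('x \<Rightarrow>\<^sub>0 'r) \<Rightarrow> ('x \<times> 'x \<Rightarrow>\<^sub>0 'r)"
  counit :: "('x \<Rightarrow>\<^sub>0 'r) \<Rightarrow> 'r"
  coone :: "'x \<Rightarrow>\<^sub>0 'r"

definition chain_coalgebra :: "('x, 'r::comm_ring_1, 'b) chain_coalg_scheme \<Rightarrow> bool" where
  "chain_coalgebra C \<longleftrightarrow>
     chain_complex C \<and> chain_map C (tensor_cx C C) (comul C) \<and>
     (\<forall>u\<in>fre C. \<forall>v\<in>fre C. counit C (u + v) = counit C u + counit C v) \<and>
     (\<forall>c. \<forall>u\<in>fre C. counit C (smul c u) = c * counit C u) \<and>
     (\<forall>n. \<forall>u\<in>piece C n. n \<noteq> 0 \<longrightarrow> counit C u = 0) \<and>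
     (\<forall>u\<in>fre C. counit C (dif C u) = 0) \<and>
     (\<forall>u\<in>fre C. assoc (tmap (comul C) id (comul C u)) = tmap id (comul C) (comul C u)) \<and>
     (\<forall>u\<in>fre C. lext (\<lambda>(x, y). smul (counit C (gen x)) (gen y)) (comul C u) = u) \<and>
     (\<forall>u\<in>fre C. lext (\<lambda>(x, y). smul (counit C (gen y)) (gen x)) (comul C u) = u) \<and>
     coone C \<in> piece C 0 \<and> dif C (coone C) = 0 \<and> counit C (coone C) = 1 \<and>
     comul C (coone C) = tens (coone C) (coone C) \<and>
     (\<forall>x\<in>gens C. 0 \<le> deg C x) \<and>
     piece C 0 = range (\<lambda>r. smul r (coone C))"

definition tensor_coalg :: "('x, 'r::comm_ring_1, 'b) chain_coalg_scheme \<Rightarrow>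
    ('y, 'r, 'c) chain_coalg_scheme \<Rightarrow> ('x \<times> 'y, 'r) chain_coalg" where
  "tensor_coalg C D =
     \<lparr>gens = gens (gtensor C D), deg = deg (gtensor C D), dif = tensor_dif C D,
      comul = lext (\<lambda>(x, y).
        lext (\<lambda>(x1, x2). lext (\<lambda>(y1, y2).
            smul (ksgn (deg C x2 * deg D y1)) (gen ((x1, y1), (x2, y2))))
          (comul D (gen y))) (comul C (gen x))),
      counit = (\<lambda>v. \<Sum>(x, y)\<in>Poly_Mapping.keys v.
        Poly_Mapping.lookup v (x, y) * (counit C (gen x) * counit D (gen y))),
      coone = tens (coone C) (coone D)\<rparr>"

text \<open>The unit of a chain Hopf algebra is \<open>coone\<close>.\<close>

record (overloaded) ('x, 'r) chain_hopf = "('x, 'r) chain_coalg" +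
  hmul :: "('x \<times> 'x \<Rightarrow>\<^sub>0 'r) \<Rightarrow> ('x \<Rightarrow>\<^sub>0 'r)"

definition alg_of :: "('x, 'r) chain_hopf \<Rightarrow> ('x, 'r) chain_alg" where
  "alg_of H = \<lparr>gens = gens H, deg = deg H, dif = dif H, mul = hmul H, unt = coone H\<rparr>"

definition chain_hopf_algebra :: "('x, 'r::comm_ring_1) chain_hopf \<Rightarrow> bool" where
  "chain_hopf_algebra H \<longleftrightarrow>
     chain_algebra (alg_of H) \<and> chain_coalgebra H \<and>
     chain_algebra_map (alg_of H) (tensor_alg (alg_of H) (alg_of H)) (comul H) \<and>
     (\<forall>a\<in>fre H. \<forall>b\<in>fre H. counit H (hmul H (tens a b)) = counit H a * counit H b) \<and>
     piece H 1 = ({0} :: ('x \<Rightarrow>\<^sub>0 'r) set)"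

definition chain_hopf_map :: "('x, 'r::comm_ring_1) chain_hopf \<Rightarrow> ('x', 'r) chain_hopf \<Rightarrow>
    (('x \<Rightarrow>\<^sub>0 'r) \<Rightarrow> ('x' \<Rightarrow>\<^sub>0 'r)) \<Rightarrow> bool" where
  "chain_hopf_map H H' f \<longleftrightarrow>
     chain_algebra_map (alg_of H) (alg_of H') f \<and>
     (\<forall>u\<in>fre H. comul H' (f u) = tmap f f (comul H u)) \<and>
     (\<forall>u\<in>fre H. counit H' (f u) = counit H u)"

section \<open>The cobar construction\<close>

text \<open>
  The word \<open>[x\<^sub>1, \<dots>, x\<^sub>k]\<close> of generators of positive degree stands for
  \<open>s\<^sup>-\<^sup>1x\<^sub>1 \<cdots> s\<^sup>-\<^sup>1x\<^sub>k\<close>.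
\<close>

definition conc :: "('x list \<Rightarrow>\<^sub>0 'r::comm_ring_1) \<Rightarrow> ('x list \<Rightarrow>\<^sub>0 'r) \<Rightarrow> ('x list \<Rightarrow>\<^sub>0 'r)" where
  "conc u v = lext (\<lambda>p. lext (\<lambda>q. gen (p @ q)) v) u"

text \<open>Values on words of the algebra map with given values on the letters.\<close>

primrec wordmap :: "('x \<Rightarrow> ('z list \<Rightarrow>\<^sub>0 'r)) \<Rightarrow> 'x list \<Rightarrow> ('z list \<Rightarrow>\<^sub>0 'r::comm_ring_1)" where
  "wordmap \<phi> [] = gen []"
| "wordmap \<phi> (x # w) = conc (\<phi> x) (wordmap \<phi> w)"

definition desusp :: "('x, 'b) gbasis_scheme \<Rightarrow> ('x \<Rightarrow>\<^sub>0 'r::comm_ring_1) \<Rightarrow> ('x list \<Rightarrow>\<^sub>0 'r)" where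
  "desusp C = lext (\<lambda>x. if 0 < deg C x then gen [x] else 0)"

definition redcomul :: "('x, 'r::comm_ring_1, 'b) chain_coalg_scheme \<Rightarrow>
    ('x \<Rightarrow>\<^sub>0 'r) \<Rightarrow> ('x \<times> 'x \<Rightarrow>\<^sub>0 'r)" where
  "redcomul C c = comul C c - tens c (coone C) - tens (coone C) c"

definition cobar_dif_letter :: "('x, 'r::comm_ring_1, 'b) chain_coalg_scheme \<Rightarrow>
    'x \<Rightarrow> ('x list \<Rightarrow>\<^sub>0 'r)" where
  "cobar_dif_letter C x = - desusp C (dif C (gen x)) +
     lext (\<lambda>(y, z). smul (ksgn (deg C y)) (conc (desusp C (gen y)) (desusp C (gen z))))
       (redcomul C (gen x))"

primrec cobar_dif_word :: "('x, 'r::comm_ring_1, 'b) chain_coalg_scheme \<Rightarrow>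
    'x list \<Rightarrow> ('x list \<Rightarrow>\<^sub>0 'r)" where
  "cobar_dif_word C [] = 0"
| "cobar_dif_word C (x # w) = conc (cobar_dif_letter C x) (gen w) +
     smul (ksgn (deg C x - 1)) (conc (gen [x]) (cobar_dif_word C w))"

definition cobar :: "('x, 'r::comm_ring_1, 'b) chain_coalg_scheme \<Rightarrow> ('x list, 'r) chain_alg" where
  "cobar C =
     \<lparr>gens = lists (posgens C), deg = (\<lambda>w. \<Sum>x\<leftarrow>w. deg C x - 1),
      dif = lext (cobar_dif_word C),
      mul = lext (\<lambda>(p, q). gen (p @ q)),
      unt = gen []\<rparr>"

definition cobar_map :: "('x, 'r::comm_ring_1, 'b) chain_coalg_scheme \<Rightarrow>
    ('y, 'r, 'c) chain_coalg_scheme \<Rightarrow> (('x \<Rightarrow>\<^sub>0 'r) \<Rightarrow> ('y \<Rightarrow>\<^sub>0 'r)) \<Rightarrow>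
    ('x list \<Rightarrow>\<^sub>0 'r) \<Rightarrow> ('y list \<Rightarrow>\<^sub>0 'r)" where
  "cobar_map C C' f =
     (\<lambda>v\<in>fre (cobar C). lext (wordmap (\<lambda>x. desusp C' (f (gen x)))) v)"

section \<open>Pseudo Hopf algebra morphisms\<close>

text \<open>
  \<open>itcomul C k\<close> is the k-fold unreduced comultiplication, with values in words of length k
  standing for elementary tensors; the 0-fold one is the counit and the 1-fold one the identity.
\<close>

primrec itcomul :: "('x, 'r::comm_ring_1, 'b) chain_coalg_scheme \<Rightarrow> nat \<Rightarrow>
    'x \<Rightarrow> ('x list \<Rightarrow>\<^sub>0 'r)" where
  "itcomul C 0 x = Poly_Mapping.single [] (counit C (gen x))"
| "itcomul C (Suc k) x =
     lext (\<lambda>(y, z). conc (gen [y]) (itcomul C k z)) (comul C (gen x))"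

text \<open>
  Koszul sign of \<open>s\<^sup>-\<^sup>1c\<^sub>1 \<cdots> s\<^sup>-\<^sup>1c\<^sub>k d\<^sub>1 \<cdots> d\<^sub>k \<mapsto> s\<^sup>-\<^sup>1c\<^sub>1 d\<^sub>1 \<cdots> s\<^sup>-\<^sup>1c\<^sub>k d\<^sub>k\<close>:
  every \<open>d\<^sub>i\<close> moves past the \<open>s\<^sup>-\<^sup>1c\<^sub>j\<close> with \<open>i < j\<close>.
\<close>

definition lsign :: "('x, 'b) gbasis_scheme \<Rightarrow> ('y, 'c) gbasis_scheme \<Rightarrow>
    'x list \<Rightarrow> 'y list \<Rightarrow> 'r::comm_ring_1" where
  "lsign C D cs ds =
     ksgn (\<Sum>j<length cs. \<Sum>i<j. (deg C (cs ! j) - 1) * deg D (ds ! i))"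

text \<open>
  Koszul sign of \<open>d\<^sub>1 \<cdots> d\<^sub>k s\<^sup>-\<^sup>1c\<^sub>1 \<cdots> s\<^sup>-\<^sup>1c\<^sub>k \<mapsto> d\<^sub>1 s\<^sup>-\<^sup>1c\<^sub>1 \<cdots> d\<^sub>k s\<^sup>-\<^sup>1c\<^sub>k\<close>.
  The identification of \<open>s\<^sup>-\<^sup>1(d \<otimes> c)\<close> with \<open>(-1)\<^bsup>|d|\<^esup> d \<otimes> s\<^sup>-\<^sup>1c\<close>, applied to the argument
  and to all factors of the value, contributes the sign with exponent
  \<open>|d| + |d\<^sub>1| + \<cdots> + |d\<^sub>k|\<close>, which is even.
\<close>

definition rsign :: "('y, 'c) gbasis_scheme \<Rightarrow> ('x, 'b) gbasis_scheme \<Rightarrow>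
    'y list \<Rightarrow> 'x list \<Rightarrow> 'r::comm_ring_1" where
  "rsign D C ds cs =
     ksgn (\<Sum>j<length cs. \<Sum>i<j. deg D (ds ! j) * (deg C (cs ! i) - 1))"

text \<open>
  A generator \<open>x\<close> of degree 0 equals \<open>counit C (gen x)\<close> times the unit, which determines
  the maps below on it.
\<close>

definition curly_left :: "('x, 'r::comm_ring_1, 'b) chain_coalg_scheme \<Rightarrow>
    ('z, 'r, 'c) chain_coalg_scheme \<Rightarrow> ('y, 'r, 'd) chain_coalg_scheme \<Rightarrow>
    (('x list \<Rightarrow>\<^sub>0 'r) \<Rightarrow> ('z list \<Rightarrow>\<^sub>0 'r)) \<Rightarrow>
    (('x \<times> 'y) list \<Rightarrow>\<^sub>0 'r) \<Rightarrow> (('z \<times> 'y) list \<Rightarrow>\<^sub>0 'r)" where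
  "curly_left C C' D \<theta> = lext (wordmap (\<lambda>(x, y).
     if deg C x = 0
     then smul (counit C (gen x)) (desusp (tensor_coalg C' D) (tens (coone C') (gen y)))
     else lext (\<lambda>cs. lext (\<lambda>ds. smul (lsign C' D cs ds) (gen (zip cs ds)))
                 (itcomul D (length cs) y)) (\<theta> (gen [x]))))"

definition curly_right :: "('y, 'r::comm_ring_1, 'd) chain_coalg_scheme \<Rightarrow>
    ('x, 'r, 'b) chain_coalg_scheme \<Rightarrow> ('z, 'r, 'c) chain_coalg_scheme \<Rightarrow>
    (('x list \<Rightarrow>\<^sub>0 'r) \<Rightarrow> ('z list \<Rightarrow>\<^sub>0 'r)) \<Rightarrow>
    (('y \<times> 'x) list \<Rightarrow>\<^sub>0 'r) \<Rightarrow> (('y \<times> 'z) list \<Rightarrow>\<^sub>0 'r)" where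
  "curly_right D C C' \<theta> = lext (wordmap (\<lambda>(y, x).
     if deg C x = 0
     then smul (counit C (gen x)) (desusp (tensor_coalg D C') (tens (gen y) (coone C')))
     else lext (\<lambda>cs. lext (\<lambda>ds. smul (rsign D C' ds cs) (gen (zip ds cs)))
                 (itcomul D (length cs) y)) (\<theta> (gen [x]))))"

definition curly :: "('x, 'r::comm_ring_1, 'b) chain_coalg_scheme \<Rightarrow>
    ('z, 'r, 'c) chain_coalg_scheme \<Rightarrow> (('x list \<Rightarrow>\<^sub>0 'r) \<Rightarrow> ('z list \<Rightarrow>\<^sub>0 'r)) \<Rightarrow>
    (('x \<times> 'x) list \<Rightarrow>\<^sub>0 'r) \<Rightarrow> (('z \<times> 'z) list \<Rightarrow>\<^sub>0 'r)" where
  "curly C C' \<theta> = curly_right C' C C' \<theta> \<circ> curly_left C C' C \<theta>"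

definition pseudo_hopf_map :: "('x, 'r::comm_ring_1) chain_hopf \<Rightarrow> ('z, 'r) chain_hopf \<Rightarrow>
    (('x list \<Rightarrow>\<^sub>0 'r) \<Rightarrow> ('z list \<Rightarrow>\<^sub>0 'r)) \<Rightarrow> bool" where
  "pseudo_hopf_map H H' \<theta> \<longleftrightarrow>
     chain_algebra_map (cobar H) (cobar H') \<theta> \<and>
     (\<forall>v\<in>fre (cobar (tensor_coalg H H)).
        \<theta> (cobar_map (tensor_coalg H H) H (hmul H) v) =
        cobar_map (tensor_coalg H' H') H' (hmul H') (curly H H' \<theta> v))"

section \<open>Comodule algebras and the twisted tensor product\<close>

record (overloaded) ('x, 'y, 'r) comod_alg =
  hpf :: "('x, 'r) chain_hopf"
  alg :: "('y, 'r) chain_alg"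
  coact :: "('y \<Rightarrow>\<^sub>0 'r) \<Rightarrow> ('y \<times> 'x \<Rightarrow>\<^sub>0 'r)"

definition comodule_algebra :: "('x, 'y, 'r::comm_ring_1) comod_alg \<Rightarrow> bool" where
  "comodule_algebra P \<longleftrightarrow>
     chain_hopf_algebra (hpf P) \<and> chain_algebra (alg P) \<and>
     chain_algebra_map (alg P) (tensor_alg (alg P) (alg_of (hpf P))) (coact P) \<and>
     (\<forall>b\<in>fre (alg P). assoc (tmap (coact P) id (coact P b)) =
        tmap id (comul (hpf P)) (coact P b)) \<and>
     (\<forall>b\<in>fre (alg P).
        lext (\<lambda>(y, x). smul (counit (hpf P) (gen x)) (gen y)) (coact P b) = b)"

definition twisted_dif :: "('x, 'y, 'r::comm_ring_1) comod_alg \<Rightarrow>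
    ('y \<times> 'x list \<Rightarrow>\<^sub>0 'r) \<Rightarrow> ('y \<times> 'x list \<Rightarrow>\<^sub>0 'r)" where
  "twisted_dif P = lext (\<lambda>(b, w).
     tens (dif (alg P) (gen b)) (gen w) +
     smul (ksgn (deg (alg P) b)) (tens (gen b) (dif (cobar (hpf P)) (gen w))) -
     lext (\<lambda>(b', h). smul (ksgn (deg (alg P) b'))
         (tens (gen b') (conc (desusp (hpf P) (gen h)) (gen w))))
       (coact P (gen b)))"

text \<open>
  \<open>left_letter P a\<close> is left multiplication by \<open>1 \<otimes> s\<^sup>-\<^sup>1a\<close> and \<open>left_word P w b\<close> is the
  product \<open>(1 \<otimes> w) (b \<otimes> 1)\<close>; the product of \<open>b \<otimes> w\<close> and \<open>b' \<otimes> w'\<close> is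
  \<open>(b \<otimes> 1) ((1 \<otimes> w) (b' \<otimes> 1)) (1 \<otimes> w')\<close>.
\<close>

definition left_letter :: "('x, 'y, 'r::comm_ring_1) comod_alg \<Rightarrow> 'x \<Rightarrow>
    ('y \<times> 'x list \<Rightarrow>\<^sub>0 'r) \<Rightarrow> ('y \<times> 'x list \<Rightarrow>\<^sub>0 'r)" where
  "left_letter P a = lext (\<lambda>(b, w).
     lext (\<lambda>(b', h). smul (ksgn ((deg (hpf P) a - 1) * deg (alg P) b'))
         (tens (gen b') (conc (desusp (hpf P) (hmul (hpf P) (gen (a, h)))) (gen w))))
       (coact P (gen b)))"

primrec left_word :: "('x, 'y, 'r::comm_ring_1) comod_alg \<Rightarrow> 'x list \<Rightarrow> 'y \<Rightarrow>
    ('y \<times> 'x list \<Rightarrow>\<^sub>0 'r)" where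
  "left_word P [] b = gen (b, [])"
| "left_word P (a # w) b = left_letter P a (left_word P w b)"

definition right_act :: "('y \<times> 'x list \<Rightarrow>\<^sub>0 'r) \<Rightarrow> ('x list \<Rightarrow>\<^sub>0 'r::comm_ring_1) \<Rightarrow>
    ('y \<times> 'x list \<Rightarrow>\<^sub>0 'r)" where
  "right_act z v = lext (\<lambda>(b, w). tens (gen b) (conc (gen w) v)) z"

definition twisted_mul :: "('x, 'y, 'r::comm_ring_1) comod_alg \<Rightarrow>
    (('y \<times> 'x list) \<times> ('y \<times> 'x list) \<Rightarrow>\<^sub>0 'r) \<Rightarrow> ('y \<times> 'x list \<Rightarrow>\<^sub>0 'r)" where
  "twisted_mul P = lext (\<lambda>((b, w), (b', w')).
     right_act
       (lext (\<lambda>(b'', v). tens (mul (alg P) (gen (b, b''))) (gen v)) (left_word P w b'))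
       (gen w'))"

definition twisted :: "('x, 'y, 'r::comm_ring_1) comod_alg \<Rightarrow>
    ('y \<times> 'x list, 'r) chain_alg" where
  "twisted P =
     \<lparr>gens = gens (gtensor (alg P) (cobar (hpf P))),
      deg = deg (gtensor (alg P) (cobar (hpf P))),
      dif = twisted_dif P, mul = twisted_mul P,
      unt = tens (unt (alg P)) (gen [])\<rparr>"

section \<open>Categories and functors\<close>

text \<open>
  \<open>Comp C X Y Z g f\<close> is the composite of \<open>f \<in> Hom C X Y\<close> and \<open>g \<in> Hom C Y Z\<close>.
  A functor has to preserve the composite of every composable pair.  No closure of \<open>Hom\<close> under
  \<open>Comp\<close> is built into these notions: the operation \<open>curly\<close> satisfies no interchange law, and
  a composite of two pseudo Hopf algebra morphisms need not be one.
\<close>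

record ('o, 'm) cat_data =
  Obj :: "'o set"
  Hom :: "'o \<Rightarrow> 'o \<Rightarrow> 'm set"
  Ident :: "'o \<Rightarrow> 'm"
  Comp :: "'o \<Rightarrow> 'o \<Rightarrow> 'o \<Rightarrow> 'm \<Rightarrow> 'm \<Rightarrow> 'm"

definition is_functor :: "('o, 'm) cat_data \<Rightarrow> ('p, 'n) cat_data \<Rightarrow>
    ('o \<Rightarrow> 'p) \<Rightarrow> ('o \<Rightarrow> 'o \<Rightarrow> 'm \<Rightarrow> 'n) \<Rightarrow> bool" where
  "is_functor C D F\<^sub>o F\<^sub>m \<longleftrightarrow>
     (\<forall>X\<in>Obj C. F\<^sub>o X \<in> Obj D) \<and>
     (\<forall>X\<in>Obj C. \<forall>Y\<in>Obj C. \<forall>f\<in>Hom C X Y. F\<^sub>m X Y f \<in> Hom D (F\<^sub>o X) (F\<^sub>o Y)) \<and>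
     (\<forall>X\<in>Obj C. F\<^sub>m X X (Ident C X) = Ident D (F\<^sub>o X)) \<and>
     (\<forall>X\<in>Obj C. \<forall>Y\<in>Obj C. \<forall>Z\<in>Obj C. \<forall>f\<in>Hom C X Y. \<forall>g\<in>Hom C Y Z.
        F\<^sub>m X Z (Comp C X Y Z g f) =
        Comp D (F\<^sub>o X) (F\<^sub>o Y) (F\<^sub>o Z) (F\<^sub>m Y Z g) (F\<^sub>m X Y f))"

type_synonym ('x, 'y, 'r) ca_mor =
  "(('x \<Rightarrow>\<^sub>0 'r) \<Rightarrow> ('x \<Rightarrow>\<^sub>0 'r)) \<times> (('y \<Rightarrow>\<^sub>0 'r) \<Rightarrow> ('y \<Rightarrow>\<^sub>0 'r))"

type_synonym ('x, 'y, 'r) cash_mor =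
  "(('x list \<Rightarrow>\<^sub>0 'r) \<Rightarrow> ('x list \<Rightarrow>\<^sub>0 'r)) \<times>
   (('y \<times> 'x list \<Rightarrow>\<^sub>0 'r) \<Rightarrow> ('y \<times> 'x list \<Rightarrow>\<^sub>0 'r))"

text \<open>
  Linear maps that are morphisms of a category are normalised to be \<open>undefined\<close> outside
  their source module, so that equality of functions is equality of morphisms.
\<close>

definition CAr :: "(('x, 'y, 'r::comm_ring_1) comod_alg, ('x, 'y, 'r) ca_mor) cat_data" where
  "CAr =
     \<lparr>Obj = {P. comodule_algebra P},
      Hom = (\<lambda>P P'. {(f, g).
        f \<in> extensional (fre (hpf P)) \<and> g \<in> extensional (fre (alg P)) \<and>
        chain_hopf_map (hpf P) (hpf P') f \<and> chain_algebra_map (alg P) (alg P') g \<and>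
        (\<forall>b\<in>fre (alg P). tmap g f (coact P b) = coact P' (g b))}),
      Ident = (\<lambda>P. (restrict id (fre (hpf P)), restrict id (fre (alg P)))),
      Comp = (\<lambda>P P' P'' (f', g') (f, g).
        (compose (fre (hpf P)) f' f, compose (fre (alg P)) g' g))\<rparr>"

definition CASH :: "(('x, 'y, 'r::comm_ring_1) comod_alg, ('x, 'y, 'r) cash_mor) cat_data" where
  "CASH =
     \<lparr>Obj = {P. comodule_algebra P},
      Hom = (\<lambda>P P'. {(\<theta>, \<gamma>).
        \<theta> \<in> extensional (fre (cobar (hpf P))) \<and> \<gamma> \<in> extensional (fre (twisted P)) \<and>
        pseudo_hopf_map (hpf P) (hpf P') \<theta> \<and>
        chain_algebra_map (twisted P) (twisted P') \<gamma> \<and>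
        (\<forall>z\<in>fre (twisted P). \<forall>w\<in>fre (cobar (hpf P)).
           \<gamma> (right_act z w) = right_act (\<gamma> z) (\<theta> w))}),
      Ident = (\<lambda>P. (restrict id (fre (cobar (hpf P))), restrict id (fre (twisted P)))),
      Comp = (\<lambda>P P' P'' (\<theta>', \<gamma>') (\<theta>, \<gamma>).
        (compose (fre (cobar (hpf P))) \<theta>' \<theta>, compose (fre (twisted P)) \<gamma>' \<gamma>))\<rparr>"

definition twisted_map :: "('x, 'y, 'r::comm_ring_1) comod_alg \<Rightarrow> ('x, 'y, 'r) comod_alg \<Rightarrow>
    ('x, 'y, 'r) ca_mor \<Rightarrow> ('y \<times> 'x list \<Rightarrow>\<^sub>0 'r) \<Rightarrow> ('y \<times> 'x list \<Rightarrow>\<^sub>0 'r)" where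
  "twisted_map P P' = (\<lambda>(f, g).
     restrict (tmap g (cobar_map (hpf P) (hpf P') f)) (fre (twisted P)))"

definition embed :: "('x, 'y, 'r::comm_ring_1) comod_alg \<Rightarrow> ('x, 'y, 'r) comod_alg \<Rightarrow>
    ('x, 'y, 'r) ca_mor \<Rightarrow> ('x, 'y, 'r) cash_mor" where
  "embed P P' m = (cobar_map (hpf P) (hpf P') (fst m), twisted_map P P' m)"

section \<open>Graded algebras and homology\<close>

text \<open>A graded algebra is a family of modules with products of bidegree \<open>(m, n)\<close>.\<close>

record ('a, 'r) gr_alg =
  gcar :: "int \<Rightarrow> 'a set"
  gadd :: "int \<Rightarrow> 'a \<Rightarrow> 'a \<Rightarrow> 'a"
  gzero :: "int \<Rightarrow> 'a"
  gsmul :: "int \<Rightarrow> 'r \<Rightarrow> 'a \<Rightarrow> 'a"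
  gmul :: "int \<Rightarrow> int \<Rightarrow> 'a \<Rightarrow> 'a \<Rightarrow> 'a"
  gone :: "'a"

definition graded_module :: "('a, 'r::comm_ring_1) gr_alg \<Rightarrow> bool" where
  "graded_module A \<longleftrightarrow> (\<forall>n.
     gzero A n \<in> gcar A n \<and>
     (\<forall>a\<in>gcar A n. gadd A n (gzero A n) a = a \<and> (\<exists>b\<in>gcar A n. gadd A n a b = gzero A n)) \<and>
     (\<forall>a\<in>gcar A n. \<forall>b\<in>gcar A n. gadd A n a b \<in> gcar A n \<and> gadd A n a b = gadd A n b a) \<and>
     (\<forall>a\<in>gcar A n. \<forall>b\<in>gcar A n. \<forall>c\<in>gcar A n.
        gadd A n (gadd A n a b) c = gadd A n a (gadd A n b c)) \<and>
     (\<forall>r. \<forall>a\<in>gcar A n. gsmul A n r a \<in> gcar A n) \<and>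
     (\<forall>a\<in>gcar A n. gsmul A n 1 a = a) \<and>
     (\<forall>r s. \<forall>a\<in>gcar A n. gsmul A n (r * s) a = gsmul A n r (gsmul A n s a)) \<and>
     (\<forall>r s. \<forall>a\<in>gcar A n. gsmul A n (r + s) a = gadd A n (gsmul A n r a) (gsmul A n s a)) \<and>
     (\<forall>r. \<forall>a\<in>gcar A n. \<forall>b\<in>gcar A n.
        gsmul A n r (gadd A n a b) = gadd A n (gsmul A n r a) (gsmul A n r b)))"

definition graded_algebra :: "('a, 'r::comm_ring_1) gr_alg \<Rightarrow> bool" where
  "graded_algebra A \<longleftrightarrow>
     graded_module A \<and> gone A \<in> gcar A 0 \<and>
     (\<forall>m n. \<forall>a\<in>gcar A m. \<forall>b\<in>gcar A n. gmul A m n a b \<in> gcar A (m + n)) \<and>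
     (\<forall>m n. \<forall>a\<in>gcar A m. \<forall>a'\<in>gcar A m. \<forall>b\<in>gcar A n.
        gmul A m n (gadd A m a a') b = gadd A (m + n) (gmul A m n a b) (gmul A m n a' b)) \<and>
     (\<forall>m n. \<forall>a\<in>gcar A m. \<forall>b\<in>gcar A n. \<forall>b'\<in>gcar A n.
        gmul A m n a (gadd A n b b') = gadd A (m + n) (gmul A m n a b) (gmul A m n a b')) \<and>
     (\<forall>m n r. \<forall>a\<in>gcar A m. \<forall>b\<in>gcar A n.
        gmul A m n (gsmul A m r a) b = gsmul A (m + n) r (gmul A m n a b) \<and>
        gmul A m n a (gsmul A n r b) = gsmul A (m + n) r (gmul A m n a b)) \<and>
     (\<forall>n. \<forall>a\<in>gcar A n. gmul A 0 n (gone A) a = a \<and> gmul A n 0 a (gone A) = a) \<and>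
     (\<forall>l m n. \<forall>a\<in>gcar A l. \<forall>b\<in>gcar A m. \<forall>c\<in>gcar A n.
        gmul A (l + m) n (gmul A l m a b) c = gmul A l (m + n) a (gmul A m n b c))"

definition graded_algebra_map :: "('a, 'r::comm_ring_1) gr_alg \<Rightarrow> ('b, 'r) gr_alg \<Rightarrow>
    (int \<Rightarrow> 'a \<Rightarrow> 'b) \<Rightarrow> bool" where
  "graded_algebra_map A A' f \<longleftrightarrow>
     (\<forall>n. \<forall>a\<in>gcar A n. f n a \<in> gcar A' n) \<and>
     (\<forall>n. \<forall>a\<in>gcar A n. \<forall>b\<in>gcar A n. f n (gadd A n a b) = gadd A' n (f n a) (f n b)) \<and>
     (\<forall>n r. \<forall>a\<in>gcar A n. f n (gsmul A n r a) = gsmul A' n r (f n a)) \<and>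
     (\<forall>m n. \<forall>a\<in>gcar A m. \<forall>b\<in>gcar A n.
        f (m + n) (gmul A m n a b) = gmul A' m n (f m a) (f n b)) \<and>
     f 0 (gone A) = gone A'"

definition grA :: "(('a, 'r::comm_ring_1) gr_alg, int \<Rightarrow> 'a \<Rightarrow> 'a) cat_data" where
  "grA =
     \<lparr>Obj = {A. graded_algebra A},
      Hom = (\<lambda>A A'. {f. (\<forall>n. f n \<in> extensional (gcar A n)) \<and> graded_algebra_map A A' f}),
      Ident = (\<lambda>A n. restrict id (gcar A n)),
      Comp = (\<lambda>A A' A'' g f n. compose (gcar A n) (g n) (f n))\<rparr>"

definition cycles :: "('x, 'r::comm_ring_1, 'b) chain_cx_scheme \<Rightarrow> int \<Rightarrow> ('x \<Rightarrow>\<^sub>0 'r) set" where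
  "cycles M n = {z \<in> piece M n. dif M z = 0}"

definition boundaries :: "('x, 'r::comm_ring_1, 'b) chain_cx_scheme \<Rightarrow> int \<Rightarrow>
    ('x \<Rightarrow>\<^sub>0 'r) set" where
  "boundaries M n = dif M ` piece M (n + 1)"

definition hclass :: "('x, 'r::comm_ring_1, 'b) chain_cx_scheme \<Rightarrow> int \<Rightarrow> ('x \<Rightarrow>\<^sub>0 'r) \<Rightarrow>
    ('x \<Rightarrow>\<^sub>0 'r) set" where
  "hclass M n z = (\<lambda>b. z + b) ` boundaries M n"

text \<open>
  The operations on classes are unions over all representatives; each union is a single class
  when the operation is well defined.
\<close>

definition homology :: "('x, 'r::comm_ring_1, 'b) chain_alg_scheme \<Rightarrow>
    (('x \<Rightarrow>\<^sub>0 'r) set, 'r) gr_alg" where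
  "homology A =
     \<lparr>gcar = (\<lambda>n. hclass A n ` cycles A n),
      gadd = (\<lambda>n U V. \<Union>u\<in>U. \<Union>v\<in>V. hclass A n (u + v)),
      gzero = (\<lambda>n. hclass A n 0),
      gsmul = (\<lambda>n r U. \<Union>u\<in>U. hclass A n (smul r u)),
      gmul = (\<lambda>m n U V. \<Union>u\<in>U. \<Union>v\<in>V. hclass A (m + n) (mul A (tens u v))),
      gone = hclass A 0 (unt A)\<rparr>"

definition homology_map :: "('x, 'r::comm_ring_1, 'b) chain_alg_scheme \<Rightarrow>
    ('y, 'r, 'c) chain_alg_scheme \<Rightarrow> (('x \<Rightarrow>\<^sub>0 'r) \<Rightarrow> ('y \<Rightarrow>\<^sub>0 'r)) \<Rightarrow>
    int \<Rightarrow> ('x \<Rightarrow>\<^sub>0 'r) set \<Rightarrow> ('y \<Rightarrow>\<^sub>0 'r) set" where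
  "homology_map A A' f n = (\<lambda>U\<in>gcar (homology A) n. \<Union>u\<in>U. hclass A' n (f u))"

definition Cotor :: "('x, 'y, 'r::comm_ring_1) comod_alg \<Rightarrow>
    (('y \<times> 'x list \<Rightarrow>\<^sub>0 'r) set, 'r) gr_alg" where
  "Cotor P = homology (twisted P)"

definition Cotor_map :: "('x, 'y, 'r::comm_ring_1) comod_alg \<Rightarrow> ('x, 'y, 'r) comod_alg \<Rightarrow>
    ('x, 'y, 'r) ca_mor \<Rightarrow>
    int \<Rightarrow> ('y \<times> 'x list \<Rightarrow>\<^sub>0 'r) set \<Rightarrow> ('y \<times> 'x list \<Rightarrow>\<^sub>0 'r) set" where
  "Cotor_map P P' m = homology_map (twisted P) (twisted P') (twisted_map P P' m)"

end

theory Submission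
  imports Defs
begin

text \<open>
  Homology is functorial on chain algebras, and a morphism \<open>(\<theta>; \<gamma>)\<close> of \<open>CASH\<close> contains the chain
  algebra map \<open>\<gamma>\<close>; so the extension sends it to the map induced by \<open>\<gamma>\<close> in homology.  The work lies
  in the twisted tensor product.  Let \<open>L\<^sub>b\<close> and \<open>L\<^sub>a\<close> be left multiplication by \<open>b \<otimes> 1\<close> and
  \<open>1 \<otimes> s\<^sup>-\<^sup>1a\<close>, as operators on \<open>B \<otimes> \<Omega>H\<close>.  They satisfy \<open>L\<^sub>b L\<^sub>c = L\<^sub>b\<^sub>c\<close> and
  \<open>L\<^sub>a L\<^sub>b = \<Sum>\<plusminus> L\<^bsub>b\<^sub>i\<^esub> L\<^bsub>a h\<^sup>i\<^esub>\<close>, and their graded commutators with the differential are left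
  multiplication by the differentials of \<open>b \<otimes> 1\<close> and \<open>1 \<otimes> s\<^sup>-\<^sup>1a\<close>.  As every product is a value
  of a composite of such operators, associativity and the Leibniz rule follow by induction on words.
  The map \<open>g \<otimes> \<Omega>f\<close> intertwines the operators of source and target, hence is multiplicative; and
  \<open>\<Omega>f\<close> is a pseudo Hopf algebra morphism because \<open>curly\<close> of \<open>\<Omega>f\<close> is \<open>\<Omega>(f \<otimes> f)\<close>.
\<close>

section \<open>Calculus of finitely supported functions\<close>

text \<open>The delicate point is degree 0. There \<open>s^-1 1 = 0\<close>, whereas the formula for
  multiplication by \<open>s^-1 a\<close>, read at \<open>a = 1\<close>, would produce terms
  \<open>s^-1 h\<close>. Every commutation relation must therefore separate the tensor factors of
  degree 0. The counit axioms are recast for this: the terms of a coaction whose factor in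
  \<open>H\<close> has degree 0 add up to \<open>b \<otimes> 1\<close>
  (\<open>coact_counit\<close>), and \<open>comul_split\<close> isolates
  \<open>x \<otimes> 1\<close> and \<open>1 \<otimes> x\<close> in the comultiplication. Simple
  connectivity gives letters degree at least 2 (\<open>deg_ge_2\<close>), so that their
  differentials still consist of letters. Where only desuspensions occur, conversely, the unreduced
  comultiplication may replace the reduced one, which makes coassociativity directly applicable.
  Operators are preferred to the product because the latter is defined through the normal form
  \<open>b \<otimes> w\<close>: associativity amounts to moving words past elements of
  \<open>B\<close>, and the relations between operators record exactly this.\<close>

lemma lookup_smul [simp]: "Poly_Mapping.lookup (smul c v) x = c * Poly_Mapping.lookup v x"
  by (auto simp: smul_def map.rep_eq when_def)

lemma keys_smul: "Poly_Mapping.keys (smul c v) \<subseteq> Poly_Mapping.keys v"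
  by (auto simp: in_keys_iff)

lemma smul_smul [simp]: "smul a (smul b v) = smul (a * b) v"
  by (rule poly_mapping_eqI) (simp add: mult.assoc)

lemma smul_zero_left [simp]: "smul 0 v = 0"
  and smul_zero_right [simp]: "smul a 0 = 0"
  and smul_one [simp]: "smul 1 v = v"
  by (rule poly_mapping_eqI; simp)+

lemma smul_minus_one: "smul (- 1) v = - v"
  and smul_uminus_left: "smul (- a) v = - smul a v"
  and smul_uminus_right: "smul a (- v) = - smul a v"
  by (rule poly_mapping_eqI; simp)+

lemma smul_add: "smul a (u + v) = smul a u + smul a v"
  and smul_add_left: "smul (a + b) v = smul a v + smul b v"
  and smul_diff: "smul a (u - v) = smul a u - smul a v"
  by (rule poly_mapping_eqI; simp add: algebra_simps lookup_add lookup_minus)+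

lemma smul_sum: "smul a (sum f S) = (\<Sum>x\<in>S. smul a (f x))"
  by (induction S rule: infinite_finite_induct) (auto simp: smul_add)

text \<open>The support of a sum or of a multiple may shrink; a common finite index set makes the
  sums comparable.\<close>

lemma lext_superset:
  assumes "finite S" "Poly_Mapping.keys v \<subseteq> S"
  shows "lext f v = (\<Sum>x\<in>S. smul (Poly_Mapping.lookup v x) (f x))"
  unfolding lext_def using assms by (intro sum.mono_neutral_left) (auto simp: in_keys_iff)

lemma lext_add: "lext f (u + v) = lext f u + lext f v"
proof -
  let ?S = "Poly_Mapping.keys u \<union> Poly_Mapping.keys v"
  have "Poly_Mapping.keys (u + v) \<subseteq> ?S" by (rule keys_add)
  then show ?thesis
    by (simp add: lext_superset[of ?S] lookup_add smul_add_left sum.distrib)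
qed

lemma lext_smul: "lext f (smul a v) = smul a (lext f v)"
proof -
  have "lext f (smul a v) = (\<Sum>x\<in>Poly_Mapping.keys v. smul (Poly_Mapping.lookup (smul a v) x) (f x))"
    by (rule lext_superset) (auto simp: keys_smul)
  then show ?thesis by (simp add: lext_def smul_sum)
qed

lemma lext_zero [simp]: "lext f 0 = 0"
  by (simp add: lext_def)

lemma lext_uminus: "lext f (- v) = - lext f v"
  using lext_smul[of f "- 1" v] by (simp add: smul_minus_one)

lemma lext_diff: "lext f (u - v) = lext f u - lext f v"
  using lext_add[of f u "- v"] by (simp add: lext_uminus)

lemma lext_single: "lext f (Poly_Mapping.single x c) = smul c (f x)"
  by (cases "c = 0") (simp_all add: lext_def)

lemma lext_gen [simp]: "lext f (gen x) = f x"
  by (simp add: lext_single)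

lemma lext_sum: "lext f (sum g S) = (\<Sum>x\<in>S. lext f (g x))"
  by (induction S rule: infinite_finite_induct) (auto simp: lext_add)

lemma lext_lext: "lext f (lext g v) = lext (\<lambda>x. lext f (g x)) v"
  by (simp add: lext_def[of g] lext_def[of _ v] lext_sum lext_smul)

lemma lext_zero_fun [simp]: "lext (\<lambda>x. 0) v = 0"
  by (simp add: lext_def)

lemma lext_add_fun: "lext (\<lambda>x. f x + g x) v = lext f v + lext g v"
  by (simp add: lext_def smul_add sum.distrib)

lemma lext_diff_fun: "lext (\<lambda>x. f x - g x) v = lext f v - lext g v"
  by (simp add: lext_def smul_diff sum_subtractf)

lemma lext_uminus_fun: "lext (\<lambda>x. - f x) v = - lext f v"
  by (simp add: lext_def smul_uminus_right sum_negf)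

lemma lext_smul_fun: "lext (\<lambda>x. smul a (f x)) v = smul a (lext f v)"
  by (simp add: lext_def smul_sum mult.commute)

lemma lext_swap: "lext (\<lambda>x. lext (\<lambda>y. k x y) v) u = lext (\<lambda>y. lext (\<lambda>x. k x y) u) v"
  unfolding lext_def smul_sum by (subst sum.swap) (simp add: mult.commute)

text \<open>Under this rule the degrees of the generators occurring in \<open>v\<close> become
  available; most comparisons of signs below pass through it.\<close>

lemma lext_cong:
  assumes "\<And>x. x \<in> Poly_Mapping.keys v \<Longrightarrow> f x = g x"
  shows "lext f v = lext g v"
  unfolding lext_def using assms by (intro sum.cong) auto

lemma lext_gen_id [simp]: "lext gen v = v"
proof (rule poly_mapping_eqI)
  fix k
  have "Poly_Mapping.lookup (lext gen v) k
      = (\<Sum>x\<in>Poly_Mapping.keys v. Poly_Mapping.lookup v x * (1 when x = k))"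
    by (simp add: lext_def lookup_sum lookup_single)
  also have "\<dots> = (\<Sum>x\<in>Poly_Mapping.keys v. if x = k then Poly_Mapping.lookup v x else 0)"
    by (intro sum.cong) (auto simp: when_def)
  also have "\<dots> = Poly_Mapping.lookup v k" by (simp add: in_keys_iff)
  finally show "Poly_Mapping.lookup (lext gen v) k = Poly_Mapping.lookup v k" .
qed

lemma keys_lext: "Poly_Mapping.keys (lext f v) \<subseteq> (\<Union>x\<in>Poly_Mapping.keys v. Poly_Mapping.keys (f x))"
  unfolding lext_def by (rule order_trans[OF keys_sum]) (intro UN_mono subset_refl keys_smul)

lemmas linear_simps = lext_add lext_diff lext_uminus lext_smul lext_single lext_lext
  lext_add_fun lext_diff_fun lext_uminus_fun lext_smul_fun smul_add smul_diff smul_uminus_right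

lemma lext_conc: "lext f (conc u v) = lext (\<lambda>p. lext (\<lambda>q. f (p @ q)) v) u"
  by (simp add: conc_def linear_simps)

lemma lext_tens: "lext f (tens u v) = lext (\<lambda>x. lext (\<lambda>y. f (x, y)) v) u"
  by (simp add: tens_def linear_simps)

lemma ksgn_mult_ksgn [simp]: "ksgn a * ksgn b = (ksgn (a + b) :: 'r::comm_ring_1)"
  by (simp add: ksgn_def)

lemma ksgn_zero [simp]: "ksgn 0 = 1"
  by (simp add: ksgn_def)

lemma uminus_smul_ksgn: "- smul (ksgn a) v = smul (ksgn (a + 1)) v"
  by (simp add: ksgn_def smul_minus_one)

text \<open>Reduces a comparison of Koszul signs to the parity of their exponents, which arithmetic
  then settles.\<close>

lemma smul_ksgn_cong: "even a = even b \<Longrightarrow> u = v \<Longrightarrow> smul (ksgn a) u = smul (ksgn b) v"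
  by (simp add: ksgn_def)

section \<open>Free graded modules\<close>

lemma piece_iff: "v \<in> piece M n \<longleftrightarrow> (\<forall>x\<in>Poly_Mapping.keys v. x \<in> gens M \<and> deg M x = n)"
  by (auto simp: piece_def fre_def)

lemma fre_iff: "v \<in> fre M \<longleftrightarrow> (\<forall>x\<in>Poly_Mapping.keys v. x \<in> gens M)"
  by (auto simp: fre_def)

lemma piece_subset_fre: "v \<in> piece M n \<Longrightarrow> v \<in> fre M"
  by (simp add: piece_def)

lemma piece_zero [simp]: "0 \<in> piece M n"
  and piece_add: "u \<in> piece M n \<Longrightarrow> v \<in> piece M n \<Longrightarrow> u + v \<in> piece M n"
  and piece_diff: "u \<in> piece M n \<Longrightarrow> v \<in> piece M n \<Longrightarrow> u - v \<in> piece M n"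
  and piece_uminus: "v \<in> piece M n \<Longrightarrow> - v \<in> piece M n"
  and piece_smul: "v \<in> piece M n \<Longrightarrow> smul c v \<in> piece M n"
  and piece_gen: "x \<in> gens M \<Longrightarrow> deg M x = n \<Longrightarrow> gen x \<in> piece M n"
  unfolding piece_iff using keys_add[of u v] keys_diff[of u v] keys_smul[of c v]
  by (auto simp: in_keys_iff lookup_minus)

lemma piece_lext: "(\<And>x. x \<in> Poly_Mapping.keys v \<Longrightarrow> f x \<in> piece M n) \<Longrightarrow> lext f v \<in> piece M n"
  unfolding piece_iff using keys_lext[of f v] by blast

lemma fre_zero [simp]: "0 \<in> fre M"
  and fre_add: "u \<in> fre M \<Longrightarrow> v \<in> fre M \<Longrightarrow> u + v \<in> fre M"
  and fre_diff: "u \<in> fre M \<Longrightarrow> v \<in> fre M \<Longrightarrow> u - v \<in> fre M"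
  and fre_uminus: "v \<in> fre M \<Longrightarrow> - v \<in> fre M"
  and fre_smul: "v \<in> fre M \<Longrightarrow> smul c v \<in> fre M"
  and fre_gen: "gen x \<in> fre M \<longleftrightarrow> x \<in> gens M"
  unfolding fre_iff using keys_add[of u v] keys_diff[of u v] keys_smul[of c v]
  by (auto simp: in_keys_iff lookup_minus lookup_single)

lemma fre_lext: "(\<And>x. x \<in> Poly_Mapping.keys v \<Longrightarrow> f x \<in> fre M) \<Longrightarrow> lext f v \<in> fre M"
  unfolding fre_iff using keys_lext[of f v] by blast

lemma fre_sum: "(\<And>x. x \<in> S \<Longrightarrow> f x \<in> fre M) \<Longrightarrow> sum f S \<in> fre M"
  by (induction S rule: infinite_finite_induct) (auto intro: fre_add)

text \<open>
  The values on generators of a map on \<open>fre M\<close>, extended by 0 to all of the type.  All the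
  structure maps are replaced by these, so that the identities between them need no membership
  hypotheses and can be used under \<open>lext\<close>.
\<close>

definition onbasis :: "('x, 'b) gbasis_scheme \<Rightarrow> (('x \<Rightarrow>\<^sub>0 'r::comm_ring_1) \<Rightarrow> 'v::zero) \<Rightarrow> 'x \<Rightarrow> 'v"
    where
  "onbasis M f x = (if x \<in> gens M then f (gen x) else 0)"

lemma linear_map_zero: "linear_map M N f \<Longrightarrow> f 0 = 0"
  unfolding linear_map_def by (metis fre_zero smul_zero_left)

lemma linear_map_lext:
  assumes f: "linear_map M N f" and v: "v \<in> fre M"
  shows "f v = lext (onbasis M f) v"
proof -
  \<comment> \<open>\<open>f\<close> is additive on \<open>fre M\<close> only, so it is passed
    through a finite sum of members of \<open>fre M\<close>; this sum will be the expansion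
    \<open>lext gen v\<close>.\<close>
  have sum: "f (sum g S) = (\<Sum>x\<in>S. f (g x))" if "finite S" "\<And>x. x \<in> S
      \<Longrightarrow> g x \<in> fre M" for S and g :: "'a \<Rightarrow> _"
    using that
  proof (induction S)
    case empty
    then show ?case by (simp add: linear_map_zero[OF f])
  next
    case (insert a S)
    then show ?case using f fre_sum[of S g M] by (simp add: linear_map_def)
  qed
  have "f v = f (lext gen v)" by simp
  also have "\<dots> = lext (onbasis M f) v"
    unfolding lext_def
    using v f by (subst sum) (auto simp: fre_iff[of v] linear_map_def onbasis_def fre_smul fre_gen
        intro!: sum.cong)
  finally show ?thesis .
qed

lemma linear_mapI:
  fixes f :: "('x \<Rightarrow>\<^sub>0 'r::comm_ring_1) \<Rightarrow> ('y \<Rightarrow>\<^sub>0 'r)"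
  assumes "\<And>v. v \<in> fre M \<Longrightarrow> f v = lext F v" "\<And>x. x \<in> gens M \<Longrightarrow> F x \<in> fre N"
  shows "linear_map M N f"
  unfolding linear_map_def
proof (intro conjI ballI allI)
  fix u v :: "'x \<Rightarrow>\<^sub>0 'r" and c assume uv: "u \<in> fre M" "v \<in> fre M"
  show "f (u + v) = f u + f v" using uv by (simp add: assms(1) fre_add lext_add)
  show "f (smul c u) = smul c (f u)" using uv by (simp add: assms(1) fre_smul lext_smul)
  show "f u \<in> fre N" unfolding assms(1)[OF uv(1)]
    by (rule fre_lext) (use uv assms(2) in \<open>auto simp: fre_iff\<close>)
qed

lemma graded_mapI:
  fixes f :: "('x \<Rightarrow>\<^sub>0 'r::comm_ring_1) \<Rightarrow> ('y \<Rightarrow>\<^sub>0 'r)"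
  assumes "\<And>v. v \<in> fre M \<Longrightarrow> f v = lext F v" "\<And>x. x \<in> gens M \<Longrightarrow> F x \<in> piece N (deg M x + k)"
  shows "graded_map k M N f"
  unfolding graded_map_def
proof (intro conjI ballI allI)
  show "linear_map M N f" using assms by (intro linear_mapI) (auto intro: piece_subset_fre)
  fix n and u :: "'x \<Rightarrow>\<^sub>0 'r" assume u: "u \<in> piece M n"
  show "f u \<in> piece N (n + k)" unfolding assms(1)[OF piece_subset_fre[OF u]]
    by (rule piece_lext) (use u assms(2) in \<open>auto simp: piece_iff\<close>)
qed

lemma graded_map_onbasis:
  "graded_map k M N f \<Longrightarrow> onbasis M f x \<in> piece N (deg M x + k)"
  by (auto simp: graded_map_def onbasis_def piece_gen)

lemma graded_map_fre: "graded_map k M N f \<Longrightarrow> v \<in> fre M \<Longrightarrow> f v \<in> fre N"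
  by (auto simp: graded_map_def linear_map_def)

lemma graded_map_lext: "graded_map k M N f \<Longrightarrow> v \<in> fre M \<Longrightarrow> f v = lext (onbasis M f) v"
  using linear_map_lext by (auto simp: graded_map_def)

section \<open>Structure maps on generators\<close>

definition bdif :: "('x, 'r::comm_ring_1, 'b) chain_cx_scheme \<Rightarrow> 'x \<Rightarrow> ('x \<Rightarrow>\<^sub>0 'r)" where
  "bdif M = onbasis M (dif M)"

definition bmul :: "('x, 'r::comm_ring_1, 'b) chain_alg_scheme \<Rightarrow> 'x \<Rightarrow> 'x \<Rightarrow> ('x \<Rightarrow>\<^sub>0 'r)" where
  "bmul A x y = onbasis (gtensor A A) (mul A) (x, y)"

definition bcomul :: "('x, 'r::comm_ring_1, 'b) chain_coalg_scheme \<Rightarrow> 'x \<Rightarrow> ('x \<times> 'x \<Rightarrow>\<^sub>0 'r)" where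
  "bcomul C = onbasis C (comul C)"

definition bcoact :: "('x, 'y, 'r::comm_ring_1) comod_alg \<Rightarrow> 'y \<Rightarrow> ('y \<times> 'x \<Rightarrow>\<^sub>0 'r)" where
  "bcoact P = onbasis (alg P) (coact P)"

lemma gtensor_simps [simp]:
  "gens (gtensor M N) = gens M \<times> gens N"
  "deg (gtensor M N) p = deg M (fst p) + deg N (snd p)"
  by (simp_all add: gtensor_def split_beta)

lemma tensor_cx_simps [simp]:
  "gens (tensor_cx M N) = gens M \<times> gens N"
  "deg (tensor_cx M N) p = deg M (fst p) + deg N (snd p)"
  "dif (tensor_cx M N) = tensor_dif M N"
  by (simp_all add: tensor_cx_def)

lemma tensor_alg_simps [simp]:
  "gens (tensor_alg A B) = gens A \<times> gens B"
  "deg (tensor_alg A B) p = deg A (fst p) + deg B (snd p)"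
  "dif (tensor_alg A B) = tensor_dif A B"
  "unt (tensor_alg A B) = tens (unt A) (unt B)"
  by (simp_all add: tensor_alg_def)

lemma alg_of_simps [simp]:
  "gens (alg_of H) = gens H" "deg (alg_of H) = deg H" "dif (alg_of H) = dif H"
  "mul (alg_of H) = hmul H" "unt (alg_of H) = coone H"
  by (simp_all add: alg_of_def)

lemma fre_cong: "gens M = gens N \<Longrightarrow> fre M = fre N"
  and piece_cong: "gens M = gens N \<Longrightarrow> deg M = deg N \<Longrightarrow> piece M n = piece N n"
  by (auto simp: fre_def piece_def)

lemma bdif_alg_of [simp]: "bdif (alg_of H) = bdif H"
  and fre_alg_of [simp]: "fre (alg_of H) = fre H"
  and piece_alg_of [simp]: "piece (alg_of H) n = piece H n"
  by (auto simp: bdif_def onbasis_def fun_eq_iff fre_def piece_def)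

lemma tens_gen [simp]: "tens (gen x) (gen y) = gen (x, y)"
  by (simp add: tens_def)

lemma fre_tens: "u \<in> fre M \<Longrightarrow> v \<in> fre N \<Longrightarrow> gens T = gens M \<times> gens N \<Longrightarrow> tens u v \<in> fre T"
  unfolding tens_def by (intro fre_lext) (auto simp: fre_gen fre_iff)

lemma piece_tens:
  "u \<in> piece M m \<Longrightarrow> v \<in> piece N n \<Longrightarrow> m + n = k \<Longrightarrow> tens u v \<in> piece (gtensor M N) k"
  unfolding tens_def by (intro piece_lext piece_gen) (auto simp: piece_iff)

lemma chain_complexD:
  assumes "chain_complex M"
  shows bdif_piece: "bdif M x \<in> piece M (deg M x - 1)"
    and dif_lext: "v \<in> fre M \<Longrightarrow> dif M v = lext (bdif M) v"
    and dif_fre: "v \<in> fre M \<Longrightarrow> dif M v \<in> fre M"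
    and bdif_bdif: "lext (bdif M) (bdif M x) = 0"
proof -
  have g: "graded_map (- 1) M M (dif M)" and dd: "\<And>v. v \<in> fre M \<Longrightarrow> dif M (dif M v) = 0"
    using assms by (auto simp: chain_complex_def)
  show p: "bdif M x \<in> piece M (deg M x - 1)" for x
    using graded_map_onbasis[OF g] by (simp add: bdif_def)
  show "v \<in> fre M \<Longrightarrow> dif M v \<in> fre M" by (rule graded_map_fre[OF g])
  show l: "v \<in> fre M \<Longrightarrow> dif M v = lext (bdif M) v" for v
    using graded_map_lext[OF g] by (simp add: bdif_def)
  show "lext (bdif M) (bdif M x) = 0"
  proof (cases "x \<in> gens M")
    case True
    then have "bdif M x = dif M (gen x)" by (simp add: bdif_def onbasis_def)
    then show ?thesis using dd[of "gen x"] l[OF piece_subset_fre[OF p, of x]] True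
        by (simp add: fre_gen)
  qed (simp add: bdif_def onbasis_def)
qed

lemma lext_bmul_cong:
  assumes "u \<in> fre A" "v \<in> fre A" "linear_map (tensor_cx A A) A (mul A)"
  shows "mul A (tens u v) = lext (\<lambda>x. lext (\<lambda>y. bmul A x y) v) u"
proof -
  have "tens u v \<in> fre (tensor_cx A A)" using assms by (intro fre_tens) auto
  from linear_map_lext[OF assms(3) this] show ?thesis
    by (simp add: lext_tens bmul_def onbasis_def)
qed

lemma linear_map_mul:
  "chain_algebra A \<Longrightarrow> linear_map (tensor_cx A A) A (mul A)"
  by (simp add: chain_algebra_def chain_map_def graded_map_def)

text \<open>Outside the generators \<open>bmul\<close> and \<open>bdif\<close> vanish, so
  associativity and the Leibniz rule hold for all indices and can be rewritten under
  \<open>lext\<close>. The unit laws keep their membership hypothesis, since \<open>gen x\<close> on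
  the right does not vanish there.\<close>

lemma chain_algebraD:
  assumes "chain_algebra A"
  shows chain_algebra_complex: "chain_complex A"
    and bmul_piece: "bmul A x y \<in> piece A (deg A x + deg A y)"
    and mul_lext: "u \<in> fre A \<Longrightarrow> v \<in> fre A \<Longrightarrow> mul A (tens u v) = lext (\<lambda>x. lext (\<lambda>y. bmul A x y) v) u"
    and mul_fre: "u \<in> fre A \<Longrightarrow> v \<in> fre A \<Longrightarrow> mul A (tens u v) \<in> fre A"
    and bmul_assoc: "lext (\<lambda>u. bmul A u z) (bmul A x y) = lext (bmul A x) (bmul A y z)"
    and bmul_Leibniz: "lext (bdif A) (bmul A x y) = lext (\<lambda>u. bmul A u y) (bdif A x) +
        smul (ksgn (deg A x)) (lext (bmul A x) (bdif A y))"
    and bmul_unit_left: "x \<in> gens A \<Longrightarrow> lext (\<lambda>u. bmul A u x) (unt A) = gen x"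
    and bmul_unit_right: "x \<in> gens A \<Longrightarrow> lext (bmul A x) (unt A) = gen x"
    and unt_piece: "unt A \<in> piece A 0"
    and bdif_unt: "lext (bdif A) (unt A) = 0"
proof -
  note d = assms[unfolded chain_algebra_def chain_map_def]
  show c: "chain_complex A" using d by simp
  have g: "graded_map 0 (tensor_cx A A) A (mul A)" using d by simp
  then have l: "linear_map (tensor_cx A A) A (mul A)" by (simp add: graded_map_def)
  show p: "bmul A x y \<in> piece A (deg A x + deg A y)" for x y
    using graded_map_onbasis[OF g, of "(x, y)"] by (simp add: bmul_def onbasis_def)
  note bf = piece_subset_fre[OF p]
  show m: "u \<in> fre A \<Longrightarrow> v \<in> fre A \<Longrightarrow> mul A (tens u v) = lext (\<lambda>x. lext (\<lambda>y. bmul A x y) v) u" for u v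
    by (rule lext_bmul_cong[OF _ _ l])
  show "u \<in> fre A \<Longrightarrow> v \<in> fre A \<Longrightarrow> mul A (tens u v) \<in> fre A"
    by (rule graded_map_fre[OF g]) (simp add: fre_tens)
  show u: "unt A \<in> piece A 0" using d by simp
  note uf = piece_subset_fre[OF u]
  have z: "bmul A x y = 0" if "x \<notin> gens A \<or> y \<notin> gens A" for x y
    using that by (auto simp: bmul_def onbasis_def)
  have z1: "bmul A x = (\<lambda>u. 0)" if "x \<notin> gens A" for x
    using z that by (simp add: fun_eq_iff)
  have z': "bdif A x = 0" if "x \<notin> gens A" for x
    using that by (auto simp: bdif_def onbasis_def)
  have b: "bmul A x y = mul A (tens (gen x) (gen y))" if "x \<in> gens A" "y \<in> gens A" for x y
    using that by (simp add: bmul_def onbasis_def)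
  show "lext (\<lambda>u. bmul A u z) (bmul A x y) = lext (bmul A x) (bmul A y z)"
  proof (cases "x \<in> gens A \<and> y \<in> gens A \<and> z \<in> gens A")
    case True
    then have "mul A (tens (bmul A x y) (gen z)) = mul A (tens (gen x) (bmul A y z))"
      using d by (simp add: b fre_gen del: tens_gen)
    with True show ?thesis by (simp add: m bf fre_gen)
  qed (auto simp: z z1)
  show "lext (bdif A) (bmul A x y) = lext (\<lambda>u. bmul A u y) (bdif A x) +
        smul (ksgn (deg A x)) (lext (bmul A x) (bdif A y))"
  proof (cases "x \<in> gens A \<and> y \<in> gens A")
    case True
    have bd: "bdif A x = dif A (gen x)" if "x \<in> gens A" for x
      using that by (simp add: bdif_def onbasis_def)
    have df: "dif A (gen x) \<in> fre A" if "x \<in> gens A" for x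
      using that dif_fre[OF c] by (simp add: fre_gen)
    have "lext (bdif A) (bmul A x y) = dif A (mul A (gen (x, y)))"
      using True b[of x y] dif_lext[OF c bf[of x y]] by simp
    also have "\<dots> = mul A (tensor_dif A A (gen (x, y)))"
      using d True by (simp add: fre_gen)
    also have "\<dots> = lext (onbasis (tensor_cx A A) (mul A)) (tensor_dif A A (gen (x, y)))"
      using True df by (intro linear_map_lext[OF l])
        (auto simp: tensor_dif_def fre_gen intro!: fre_add fre_smul fre_tens)
    also have "\<dots> = lext (\<lambda>u. bmul A u y) (bdif A x) + smul (ksgn (deg A x)) (lext (bmul A x)
        (bdif A y))"
      using True by (simp add: tensor_dif_def linear_simps lext_tens bd)
        (simp add: bmul_def[abs_def] onbasis_def)
    finally show ?thesis .
  qed (auto simp: z z1 z')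
  show "lext (\<lambda>u. bmul A u x) (unt A) = gen x" if "x \<in> gens A"
    using m[OF uf, of "gen x"] that d by (simp add: fre_gen)
  show "lext (bmul A x) (unt A) = gen x" if "x \<in> gens A"
    using m[of "gen x", OF _ uf] that d by (simp add: fre_gen)
  show "lext (bdif A) (unt A) = 0"
    using dif_lext[OF c uf] d by simp
qed

lemma chain_mapD:
  assumes "chain_map M N f" "chain_complex M" "chain_complex N"
  shows chain_map_piece: "onbasis M f x \<in> piece N (deg M x)"
    and chain_map_lext: "v \<in> fre M \<Longrightarrow> f v = lext (onbasis M f) v"
    and chain_map_bdif: "lext (onbasis M f) (bdif M x) = lext (bdif N) (onbasis M f x)"
proof -
  have g: "graded_map 0 M N f" using assms by (simp add: chain_map_def)
  show p: "onbasis M f x \<in> piece N (deg M x)" for x using graded_map_onbasis[OF g] by simp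
  show l: "v \<in> fre M \<Longrightarrow> f v = lext (onbasis M f) v" for v using graded_map_lext[OF g] .
  show "lext (onbasis M f) (bdif M x) = lext (bdif N) (onbasis M f x)"
  proof (cases "x \<in> gens M")
    case True
    then have "f (dif M (gen x)) = dif N (f (gen x))"
      using assms by (simp add: chain_map_def fre_gen)
    moreover have "f (gen x) \<in> fre N" using True graded_map_fre[OF g] by (simp add: fre_gen)
    moreover have "dif M (gen x) \<in> fre M" using True dif_fre[OF assms(2)] by (simp add: fre_gen)
    ultimately show ?thesis using True dif_lext[OF assms(3)] l
      by (simp add: onbasis_def[of _ _ x] bdif_def onbasis_def)
  qed (simp add: bdif_def onbasis_def)
qed

lemma bmul_tensor_alg: "bmul (tensor_alg A B) p q = smul (ksgn (deg B (snd p) * deg A (fst q)))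
    (tens (bmul A (fst p) (fst q)) (bmul B (snd p) (snd q)))"
  by (cases p; cases q) (auto simp: bmul_def onbasis_def tensor_alg_def tens_def)

text \<open>The target enters only through the linearity of its product: one application is to the
  coaction, whose target is a tensor product algebra, and for that algebra linearity is what
  \<open>linear_map_tensor_mul\<close> supplies.\<close>

lemma chain_algebra_mapD:
  assumes "chain_algebra_map A A' f" "chain_algebra A"
    and l': "linear_map (tensor_cx A' A') A' (mul A')"
  shows chain_algebra_map_bmul: "lext (onbasis A f) (bmul A x y) =
      lext (\<lambda>u. lext (\<lambda>v. bmul A' u v) (onbasis A f y)) (onbasis A f x)"
    and chain_algebra_map_unt: "lext (onbasis A f) (unt A) = unt A'"
proof -
  have g: "graded_map 0 A A' f" using assms by (simp add: chain_algebra_map_def chain_map_def)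
  note l = graded_map_lext[OF g]
  show "lext (onbasis A f) (unt A) = unt A'"
    using l[OF piece_subset_fre[OF unt_piece[OF assms(2)]]] assms(1)
        by (simp add: chain_algebra_map_def)
  show "lext (onbasis A f) (bmul A x y) = lext (\<lambda>u. lext (\<lambda>v. bmul A' u v) (onbasis A f y))
      (onbasis A f x)"
  proof (cases "x \<in> gens A \<and> y \<in> gens A")
    case True
    then have f: "f (gen x) \<in> fre A'" "f (gen y) \<in> fre A'"
      using graded_map_fre[OF g] by (auto simp: fre_gen)
    have "lext (onbasis A f) (bmul A x y) = f (mul A (tens (gen x) (gen y)))"
      using l[OF piece_subset_fre[OF bmul_piece[OF assms(2)]], of x y] True
      by (simp add: bmul_def onbasis_def[of "gtensor A A"])
    also have "\<dots> = mul A' (tens (f (gen x)) (f (gen y)))"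
      using assms(1) True by (simp add: chain_algebra_map_def fre_gen del: tens_gen)
    finally show ?thesis using True lext_bmul_cong[OF f l'] by (simp add: onbasis_def)
  qed (auto simp: bmul_def onbasis_def)
qed

lemma linear_map_tensor_mul:
  assumes "chain_algebra A" "chain_algebra B"
  shows "linear_map (tensor_cx (tensor_alg A B) (tensor_alg A B)) (tensor_alg A B) (mul
      (tensor_alg A B))"
proof (rule linear_mapI)
  fix p assume "p \<in> gens (tensor_cx (tensor_alg A B) (tensor_alg A B))"
  then show "(case p of (a, b) \<Rightarrow> (case a of (x, y) \<Rightarrow> \<lambda>(x', y'). smul (ksgn (deg B y * deg A x'))
              (tens (mul A (gen (x, x'))) (mul B (gen (y, y'))))) b) \<in> fre (tensor_alg A B)"
    using mul_fre[OF assms(1), of "gen _" "gen _"] mul_fre[OF assms(2), of "gen _" "gen _"]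
    by (auto simp: fre_gen intro!: fre_smul fre_tens)
qed (simp add: tensor_alg_def)

section \<open>Comodule algebras\<close>

lemma lext_tmap: "lext k (tmap f g v) = lext (\<lambda>p. lext (\<lambda>x. lext (\<lambda>y. k (x, y)) (g (gen (snd p))))
    (f (gen (fst p)))) v"
  by (simp add: tmap_def split_beta linear_simps lext_tens)

lemma lext_assoc: "lext k (assoc v) = lext (\<lambda>p. k (fst (fst p), (snd (fst p), snd p))) v"
  by (simp add: assoc_def split_beta linear_simps)

locale comod_algebra =
  fixes P :: "('x, 'y, 'r::comm_ring_1) comod_alg"
  assumes comodule_algebra: "comodule_algebra P"
begin

abbreviation "H \<equiv> hpf P"
abbreviation "B \<equiv> alg P"
abbreviation "\<nu> \<equiv> bcoact P"
abbreviation "\<Delta> \<equiv> bcomul H"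
abbreviation "dB \<equiv> bdif B"
abbreviation "dH \<equiv> bdif H"
abbreviation "mB \<equiv> bmul B"
abbreviation "mH \<equiv> bmul (alg_of H)"
abbreviation "one \<equiv> coone H"

lemma chain_hopf: "chain_hopf_algebra H"
  and chain_algebra_B: "chain_algebra B"
  using comodule_algebra by (simp_all add: comodule_algebra_def)

lemma chain_coalgebra_H: "chain_coalgebra H"
  and chain_algebra_H: "chain_algebra (alg_of H)"
  using chain_hopf by (simp_all add: chain_hopf_algebra_def)

lemma chain_complex_B: "chain_complex B"
  and chain_complex_H: "chain_complex H"
  using chain_algebra_B chain_coalgebra_H by (simp_all add: chain_algebra_def chain_coalgebra_def)

lemmas coact_map = comodule_algebra[unfolded comodule_algebra_def, THEN conjunct2, THEN conjunct2,
    THEN conjunct1]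

lemma coact_graded: "graded_map 0 B (tensor_alg B (alg_of H)) (coact P)"
  using coact_map by (simp add: chain_algebra_map_def chain_map_def)

lemma deg_nonneg: "x \<in> gens H \<Longrightarrow> 0 \<le> deg H x"
  using chain_coalgebra_H by (simp add: chain_coalgebra_def)

lemma one_piece: "one \<in> piece H 0"
  using unt_piece[OF chain_algebra_H] by simp

lemma keys_one: "x \<in> Poly_Mapping.keys one \<Longrightarrow> x \<in> gens H \<and> deg H x = 0"
  using one_piece by (auto simp: piece_iff)

lemma keys_dB: "x \<in> Poly_Mapping.keys (dB b) \<Longrightarrow> x \<in> gens B \<and> deg B x = deg B b - 1"
  using bdif_piece[OF chain_complex_B, of b] by (auto simp: piece_iff)

lemma keys_dH: "x \<in> Poly_Mapping.keys (dH h) \<Longrightarrow> x \<in> gens H \<and> deg H x = deg H h - 1"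
  using bdif_piece[OF chain_complex_H, of h] by (auto simp: piece_iff)

lemma keys_mB: "x \<in> Poly_Mapping.keys (mB b c) \<Longrightarrow> x \<in> gens B \<and> deg B x = deg B b + deg B c"
  using bmul_piece[OF chain_algebra_B, of b c] by (auto simp: piece_iff)

lemma keys_mH: "x \<in> Poly_Mapping.keys (mH h k) \<Longrightarrow> x \<in> gens H \<and> deg H x = deg H h + deg H k"
  using bmul_piece[OF chain_algebra_H, of h k] by (auto simp: piece_iff)

lemma coact_lext: "v \<in> fre B \<Longrightarrow> coact P v = lext \<nu> v"
  using graded_map_lext[OF coact_graded] by (simp add: bcoact_def)

lemma bcoact_piece: "\<nu> b \<in> piece (gtensor B H) (deg B b)"
  using graded_map_onbasis[OF coact_graded, of b] by (simp add: bcoact_def piece_iff)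

lemma keys_coact:
  "p \<in> Poly_Mapping.keys (\<nu> b) \<Longrightarrow> fst p \<in> gens B \<and> snd p \<in> gens H \<and> deg B b
      = deg B (fst p) + deg H (snd p)"
  using bcoact_piece[of b] by (auto simp: piece_iff)

lemma coact_gen: "b \<in> gens B \<Longrightarrow> coact P (gen b) = \<nu> b"
  by (simp add: bcoact_def onbasis_def)

lemma coact_outside: "b \<notin> gens B \<Longrightarrow> \<nu> b = 0"
  by (simp add: bcoact_def onbasis_def)

text \<open>
  The axioms are stated in Sweedler form: each holds after evaluation by an arbitrary \<open>K\<close>, which
  stands for a multilinear map given on generators.
\<close>

lemma coact_dif:
  "lext (\<lambda>u. lext (\<lambda>p. K (fst p) (snd p)) (\<nu> u)) (dB b) =
   lext (\<lambda>p. lext (\<lambda>u. K u (snd p)) (dB (fst p)) +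
     smul (ksgn (deg B (fst p))) (lext (\<lambda>u. K (fst p) u) (dH (snd p)))) (\<nu> b)"
proof (cases "b \<in> gens B")
  case True
  have df: "dif B (gen b) = dB b" using True by (simp add: bdif_def onbasis_def)
  have "coact P (dif B (gen b)) = tensor_dif B (alg_of H) (coact P (gen b))"
    using coact_map True by (simp add: chain_algebra_map_def chain_map_def fre_gen)
  then have "lext \<nu> (dB b) = tensor_dif B (alg_of H) (\<nu> b)"
    using True by (simp add: df coact_lext[OF piece_subset_fre[OF bdif_piece[OF chain_complex_B]]]
        coact_gen)
  also have "\<dots> = lext (\<lambda>p. tens (dB (fst p)) (gen (snd p)) +
      smul (ksgn (deg B (fst p))) (tens (gen (fst p)) (dH (snd p)))) (\<nu> b)"
    unfolding tensor_dif_def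
    by (rule lext_cong) (auto dest!: keys_coact simp: bdif_def onbasis_def)
  finally have "lext (\<lambda>p. K (fst p) (snd p)) (lext \<nu> (dB b)) = lext (\<lambda>p. K (fst p) (snd p))
     (lext (\<lambda>p. tens (dB (fst p)) (gen (snd p)) +
      smul (ksgn (deg B (fst p))) (tens (gen (fst p)) (dH (snd p)))) (\<nu> b))" by simp
  then show ?thesis by (simp only: linear_simps lext_tens fst_conv snd_conv lext_gen smul_one)
qed (simp add: coact_outside bdif_def onbasis_def)

lemma coact_mul:
  "lext (\<lambda>u. lext (\<lambda>p. K (fst p) (snd p)) (\<nu> u)) (mB b c) =
   lext (\<lambda>p. lext (\<lambda>q. smul (ksgn (deg H (snd p) * deg B (fst q)))
     (lext (\<lambda>u. lext (\<lambda>v. K u v) (mH (snd p) (snd q))) (mB (fst p) (fst q)))) (\<nu> c)) (\<nu> b)"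
proof -
  have "lext \<nu> (mB b c) = lext (\<lambda>u. lext (\<lambda>v. bmul (tensor_alg B (alg_of H)) u v) (\<nu> c)) (\<nu> b)"
    using chain_algebra_map_bmul[OF coact_map chain_algebra_B linear_map_tensor_mul[OF
        chain_algebra_B chain_algebra_H]]
    by (simp add: bcoact_def)
  then have "lext (\<lambda>p. K (fst p) (snd p)) (lext \<nu> (mB b c)) = lext (\<lambda>p. K (fst p) (snd p))
     (lext (\<lambda>u. lext (\<lambda>v. bmul (tensor_alg B (alg_of H)) u v) (\<nu> c)) (\<nu> b))" by simp
  then show ?thesis
    by (simp only: linear_simps lext_tens fst_conv snd_conv bmul_tensor_alg alg_of_simps)
qed

lemma coact_unt: "lext \<nu> (unt B) = tens (unt B) one"
  using chain_algebra_map_unt[OF coact_map chain_algebra_B linear_map_tensor_mul[OF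
      chain_algebra_B chain_algebra_H]]
  by (simp add: bcoact_def)

section \<open>Comultiplication, coassociativity and counit\<close>

lemma comul_graded: "graded_map 0 H (tensor_cx H H) (comul H)"
  using chain_coalgebra_H by (simp add: chain_coalgebra_def chain_map_def)

lemma comul_lext: "v \<in> fre H \<Longrightarrow> comul H v = lext \<Delta> v"
  using graded_map_lext[OF comul_graded] by (simp add: bcomul_def)

lemma coact_coassoc:
  "lext (\<lambda>p. lext (\<lambda>q. K (fst q) (snd q) (snd p)) (\<nu> (fst p))) (\<nu> b) =
   lext (\<lambda>p. lext (\<lambda>q. K (fst p) (fst q) (snd q)) (\<Delta> (snd p))) (\<nu> b)"
proof (cases "b \<in> gens B")
  case True
  let ?K = "\<lambda>p. K (fst p) (fst (snd p)) (snd (snd p))"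
  have "assoc (tmap (coact P) id (\<nu> b)) = tmap id (comul H) (\<nu> b)"
    using comodule_algebra True by (simp add: comodule_algebra_def coact_gen[symmetric] fre_gen)
  then have "lext ?K (assoc (tmap (coact P) id (\<nu> b))) = lext ?K (tmap id (comul H) (\<nu> b))"
    by simp
  then have e: "lext (\<lambda>p. lext (\<lambda>q. K (fst q) (snd q) (snd p)) (coact P (gen (fst p)))) (\<nu> b) =
      lext (\<lambda>p. lext (\<lambda>q. K (fst p) (fst q) (snd q)) (comul H (gen (snd p)))) (\<nu> b)"
    by (simp add: lext_tmap lext_assoc)
  have "lext (\<lambda>p. lext (\<lambda>q. K (fst q) (snd q) (snd p)) (\<nu> (fst p))) (\<nu> b) =
        lext (\<lambda>p. lext (\<lambda>q. K (fst q) (snd q) (snd p)) (coact P (gen (fst p)))) (\<nu> b)"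
    by (intro lext_cong) (auto dest!: keys_coact simp: coact_gen)
  also note e
  also have "lext (\<lambda>p. lext (\<lambda>q. K (fst p) (fst q) (snd q)) (comul H (gen (snd p)))) (\<nu> b) =
        lext (\<lambda>p. lext (\<lambda>q. K (fst p) (fst q) (snd q)) (\<Delta> (snd p))) (\<nu> b)"
    by (intro lext_cong) (auto dest!: keys_coact simp: bcomul_def onbasis_def)
  finally show ?thesis .
qed (simp add: coact_outside)

lemma counit_one: "counit H one = 1"
  using chain_coalgebra_H by (simp add: chain_coalgebra_def)

lemma counit_deg: "x \<in> gens H \<Longrightarrow> deg H x \<noteq> 0 \<Longrightarrow> counit H (gen x) = 0"
  using chain_coalgebra_H piece_gen[of x H "deg H x"] unfolding chain_coalgebra_def by blast

lemma piece_0: "piece H 0 = range (\<lambda>r. smul r one)"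
  using chain_coalgebra_H unfolding chain_coalgebra_def by blast

text \<open>The degree 0 part is spanned by \<open>one\<close>, which need not itself be a
  generator; the counit reads off the coefficient because it is 1 on \<open>one\<close>.\<close>

lemma gen_deg_0:
  assumes "x \<in> gens H" "deg H x = 0"
  shows "gen x = smul (counit H (gen x)) one"
proof -
  have "(gen x :: 'x \<Rightarrow>\<^sub>0 'r) \<in> piece H 0" using assms by (simp add: piece_gen)
  then obtain r where r: "gen x = smul r one"
    unfolding piece_0 by blast
  have "counit H (smul r one) = r * counit H one"
    using chain_coalgebra_H piece_subset_fre[OF one_piece] unfolding chain_coalgebra_def by blast
  with r show ?thesis by (simp add: counit_one)
qed

lemma lext_deg_0:
  assumes "x \<in> gens H" "deg H x = 0"
  shows "k x = smul (counit H (gen x)) (lext k one)"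
proof -
  have "k x = lext k (gen x)" by simp
  also have "\<dots> = smul (counit H (gen x)) (lext k one)"
    by (subst gen_deg_0[OF assms]) (simp add: lext_smul)
  finally show ?thesis .
qed

text \<open>The counit is zero in nonzero degrees and reads off the coefficient of
  \<open>one\<close> in degree 0. Thus the counit axiom says that \<nu>(b) is
  \<open>b \<otimes> 1\<close> plus terms whose factor in \<open>H\<close> has positive
  degree.\<close>

lemma coact_counit:
  assumes "b \<in> gens B"
  shows "lext (\<lambda>p. if deg H (snd p) = 0 then K (fst p) (snd p) else 0) (\<nu> b) = lext (K b) one"
proof -
  have "lext (\<lambda>p. if deg H (snd p) = 0 then K (fst p) (snd p) else 0) (\<nu> b) =
    lext (\<lambda>p. smul (counit H (gen (snd p))) (lext (K (fst p)) one)) (\<nu> b)"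
    by (intro lext_cong) (auto dest!: keys_coact simp: counit_deg lext_deg_0[of _ "K _"])
  also have "\<dots> = lext (\<lambda>y. lext (K y) one) (lext (\<lambda>(y, x). smul (counit H (gen x)) (gen y)) (\<nu> b))"
    by (simp add: linear_simps split_beta)
  also have "lext (\<lambda>(y, x). smul (counit H (gen x)) (gen y)) (\<nu> b) = gen b"
    using comodule_algebra assms by (simp add: comodule_algebra_def coact_gen[symmetric] fre_gen)
  finally show ?thesis by simp
qed

text \<open>\<open>H\<close> coacts on itself by its comultiplication, so every fact about \<nu>
  yields one about \<Delta>.\<close>

lemma comod_algebra_regular: "comod_algebra \<lparr>hpf = H, alg = alg_of H, coact = comul H\<rparr>"
proof
  show "comodule_algebra \<lparr>hpf = H, alg = alg_of H, coact = comul H\<rparr>"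
    using chain_hopf chain_hopf[unfolded chain_hopf_algebra_def chain_coalgebra_def]
    by (simp add: comodule_algebra_def chain_algebra_H)
qed

lemma bcoact_regular [simp]: "bcoact \<lparr>hpf = H, alg = alg_of H, coact = comul H\<rparr> = \<Delta>"
  by (simp add: bcoact_def bcomul_def onbasis_def fun_eq_iff)

interpretation reg: comod_algebra "\<lparr>hpf = H, alg = alg_of H, coact = comul H\<rparr>"
  by (rule comod_algebra_regular)

lemmas keys_comul = reg.keys_coact[simplified]
lemmas comul_dif = reg.coact_dif[simplified]
lemmas comul_mul = reg.coact_mul[simplified]
lemmas comul_coassoc = reg.coact_coassoc[simplified]
lemmas comul_counit_right = reg.coact_counit[simplified]

lemma comul_counit_left:
  assumes "x \<in> gens H"
  shows "lext (\<lambda>p. if deg H (fst p) = 0 then K (fst p) (snd p) else 0) (\<Delta> x) = lext (\<lambda>y. K y x) one"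
proof -
  have "lext (\<lambda>p. if deg H (fst p) = 0 then K (fst p) (snd p) else 0) (\<Delta> x) =
    lext (\<lambda>p. smul (counit H (gen (fst p))) (lext (\<lambda>y. K y (snd p)) one)) (\<Delta> x)"
    by (intro lext_cong) (auto dest!: keys_comul simp: counit_deg lext_deg_0[of _ "\<lambda>y. K y _"])
  also have "\<dots> = lext (\<lambda>z. lext (\<lambda>y. K y z) one) (lext (\<lambda>(x, y). smul (counit H (gen x)) (gen y))
      (\<Delta> x))"
    by (simp add: linear_simps split_beta)
  also have "lext (\<lambda>(x, y). smul (counit H (gen x)) (gen y)) (\<Delta> x) = gen x"
    using chain_coalgebra_H assms by (simp add: chain_coalgebra_def bcomul_def onbasis_def fre_gen)
  finally show ?thesis by simp
qed

text \<open>Degrees add up to \<open>deg H x > 0\<close>, so no term has both factors in degree 0.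
  The counit laws evaluate the terms with exactly one such factor, and the rest is the reduced
  comultiplication.\<close>

lemma comul_split:
  assumes "x \<in> gens H" "0 < deg H x"
  shows "lext (\<lambda>p. K (fst p) (snd p)) (\<Delta> x) = lext (K x) one + lext (\<lambda>y. K y x) one +
    lext (\<lambda>p. if 0 < deg H (fst p) \<and> 0 < deg H (snd p) then K (fst p) (snd p) else 0) (\<Delta> x)"
proof -
  have "lext (\<lambda>p. K (fst p) (snd p)) (\<Delta> x) =
     lext (\<lambda>p. (if deg H (snd p) = 0 then K (fst p) (snd p) else 0) +
       (if deg H (fst p) = 0 then K (fst p) (snd p) else 0) +
       (if 0 < deg H (fst p) \<and> 0 < deg H (snd p) then K (fst p) (snd p) else 0)) (\<Delta> x)"
  proof (rule lext_cong)
    fix p assume "p \<in> Poly_Mapping.keys (\<Delta> x)"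
    then show "K (fst p) (snd p) = (if deg H (snd p) = 0 then K (fst p) (snd p) else 0) +
       (if deg H (fst p) = 0 then K (fst p) (snd p) else 0) +
       (if 0 < deg H (fst p) \<and> 0 < deg H (snd p) then K (fst p) (snd p) else 0)"
      using keys_comul[of p x] deg_nonneg[of "fst p"] deg_nonneg[of "snd p"] assms by auto
  qed
  then show ?thesis using assms by (simp add: lext_add_fun comul_counit_left comul_counit_right)
qed

end

section \<open>The cobar differential\<close>

lemma conc_gen [simp]: "conc (gen p) (gen q) = gen (p @ q)"
  by (simp add: conc_def)

lemma conc_lext_left: "conc (lext f v) w = lext (\<lambda>x. conc (f x) w) v"
  by (simp add: conc_def lext_lext)

lemma conc_lext_right: "conc w (lext f v) = lext (\<lambda>x. conc w (f x)) v"
  unfolding conc_def lext_lext by (rule lext_swap)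

lemma conc_add_left: "conc (u + v) w = conc u w + conc v w"
  and conc_add_right: "conc w (u + v) = conc w u + conc w v"
  and conc_uminus_left: "conc (- u) w = - conc u w"
  and conc_uminus_right: "conc w (- u) = - conc w u"
  and conc_diff_left: "conc (u - v) w = conc u w - conc v w"
  and conc_diff_right: "conc w (u - v) = conc w u - conc w v"
  and conc_smul_left: "conc (smul c u) w = smul c (conc u w)"
  and conc_smul_right: "conc w (smul c u) = smul c (conc w u)"
  and conc_zero_left [simp]: "conc 0 w = 0"
  and conc_zero_right [simp]: "conc w 0 = 0"
  by (simp_all add: conc_def linear_simps)

lemmas conc_linear = conc_add_left conc_add_right conc_uminus_left conc_uminus_right conc_diff_left
  conc_diff_right conc_smul_left conc_smul_right conc_lext_left conc_lext_right

lemma conc_assoc: "conc (conc u v) w = conc u (conc v w)"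
  by (simp add: conc_def linear_simps)

lemma conc_Nil [simp]: "conc (gen []) v = v" "conc v (gen []) = v"
  by (simp_all add: conc_def)

lemma wordmap_append: "wordmap \<alpha> (v @ w) = conc (wordmap \<alpha> v) (wordmap \<alpha> w)"
  by (induction v) (simp_all add: conc_assoc)

lemma lext_wordmap_conc:
  "lext (wordmap \<alpha>) (conc u v) = conc (lext (wordmap \<alpha>) u) (lext (wordmap \<alpha>) v)"
  by (simp add: lext_conc wordmap_append conc_lext_left conc_lext_right) (rule lext_swap)

lemma lext_wordmap_wordmap:
  "lext (wordmap \<alpha>) (wordmap \<beta> w) = wordmap (\<lambda>x. lext (wordmap \<alpha>) (\<beta> x)) w"
  by (induction w) (simp_all add: lext_wordmap_conc)

lemma wordmap_cong: "(\<And>x. x \<in> set w \<Longrightarrow> \<alpha> x = \<beta> x) \<Longrightarrow> wordmap \<alpha> w = wordmap \<beta> w"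
  by (induction w) auto

lemma wordmap_letters: "wordmap (\<lambda>x. gen [x]) w = gen w"
  by (induction w) auto

lemma wordmap_fre:
  assumes "\<And>x. x \<in> set w \<Longrightarrow> \<alpha> x \<in> fre M" and "gens M = lists S"
  shows "wordmap \<alpha> w \<in> fre M"
  using assms(1)
proof (induction w)
  case Nil
  then show ?case using assms(2) by (simp add: fre_gen)
next
  case (Cons x w)
  then have "\<alpha> x \<in> fre M" "wordmap \<alpha> w \<in> fre M" by auto
  then show ?case unfolding wordmap.simps conc_def
    by (intro fre_lext) (auto simp: fre_iff fre_gen assms(2))
qed

context comod_algebra
begin

text \<open>The universal twisting cochain from \<open>H\<close> to \<Omega>H, with the convention
  \<open>s^-1 1 = 0\<close> built in.\<close>

definition t :: "'x \<Rightarrow> ('x list \<Rightarrow>\<^sub>0 'r)" where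
  "t x = (if 0 < deg H x then gen [x] else 0)"

text \<open>The unreduced comultiplication gives the same value as the reduced one, since
  \<open>t\<close> kills the degree 0 factor in \<open>x \<otimes> 1\<close> and
  \<open>1 \<otimes> x\<close> (see \<open>cobar_dif_letter_eq\<close>). In this form
  coassociativity applies without correction terms.\<close>

definition cobar_letter :: "'x \<Rightarrow> ('x list \<Rightarrow>\<^sub>0 'r)" where
  "cobar_letter x = - lext t (dH x) +
     lext (\<lambda>p. smul (ksgn (deg H (fst p))) (conc (t (fst p)) (t (snd p)))) (\<Delta> x)"

primrec cobar_word :: "'x list \<Rightarrow> ('x list \<Rightarrow>\<^sub>0 'r)" where
  "cobar_word [] = 0"
| "cobar_word (x # w) = conc (cobar_letter x) (gen w) +
     smul (ksgn (deg H x - 1)) (conc (gen [x]) (cobar_word w))"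

definition wdeg :: "'x list \<Rightarrow> int" where
  "wdeg w = (\<Sum>x\<leftarrow>w. deg H x - 1)"

lemma wdeg_simps [simp]: "wdeg [] = 0" "wdeg (x # w) = deg H x - 1 + wdeg w" "wdeg (v @ w)
    = wdeg v + wdeg w"
  by (simp_all add: wdeg_def)

lemma lext_t: "lext f (t h) = (if 0 < deg H h then f [h] else 0)"
  by (simp add: t_def)

lemma cobar_simps [simp]:
  "gens (cobar H) = lists (posgens H)" "deg (cobar H) w = wdeg w"
  by (simp_all add: cobar_def wdeg_def)

lemma t_piece: "x \<in> gens H \<Longrightarrow> deg H x - 1 = n \<Longrightarrow> t x \<in> piece (cobar H) n"
  by (auto simp: t_def posgens_def intro!: piece_gen)

lemma conc_piece:
  "u \<in> piece (cobar H) m \<Longrightarrow> v \<in> piece (cobar H) n \<Longrightarrow> m + n = k \<Longrightarrow> conc u v \<in> piece (cobar H) k"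
  unfolding conc_def by (intro piece_lext piece_gen) (auto simp: piece_iff)

lemma cobar_letter_piece: "cobar_letter x \<in> piece (cobar H) (deg H x - 2)"
  unfolding cobar_letter_def
  by (intro piece_add piece_uminus piece_lext piece_smul conc_piece t_piece)
    (auto dest!: keys_dH keys_comul)

lemma cobar_word_piece: "w \<in> lists (posgens H) \<Longrightarrow> cobar_word w \<in> piece (cobar H) (wdeg w - 1)"
proof (induction w)
  case (Cons x w)
  have "gen w \<in> piece (cobar H) (wdeg w)" "gen [x] \<in> piece (cobar H) (deg H x - 1)"
    using Cons by (auto intro!: piece_gen)
  with Cons show ?case
    by (auto intro!: piece_add piece_smul intro: conc_piece[OF cobar_letter_piece] conc_piece)
qed simp

lemma cobar_word_append:
  "cobar_word (p @ q) = conc (cobar_word p) (gen q) + smul (ksgn (wdeg p)) (conc (gen p)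
      (cobar_word q))"
proof (induction p)
  case (Cons x p)
  have "conc (gen [x]) (conc (gen p) u) = conc (gen (x # p)) u" for u :: "'x list \<Rightarrow>\<^sub>0 'r"
    by (simp add: conc_assoc[symmetric])
  then show ?case by (simp add: Cons conc_linear conc_assoc smul_add add_ac)
qed simp

lemma keys_cobar_letter: "v \<in> Poly_Mapping.keys (cobar_letter x) \<Longrightarrow> v \<in> lists (posgens H) \<and> wdeg v
    = deg H x - 2"
  using cobar_letter_piece[of x] by (auto simp: piece_iff)

text \<open>In degree 0 both sides vanish: \<open>dH x\<close> would lie in degree -1, and no term
  of \<Delta>(x) has two factors of positive degree.\<close>

lemma cobar_word_t: "x \<in> gens H \<Longrightarrow> lext cobar_word (t x) = cobar_letter x"
proof (cases "0 < deg H x")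
  case False
  assume x: "x \<in> gens H"
  have 1: "lext t (dH x) = lext (\<lambda>x. 0) (dH x)"
    by (rule lext_cong) (use False in \<open>auto dest!: keys_dH deg_nonneg\<close>)
  have 2: "lext (\<lambda>p. smul (ksgn (deg H (fst p))) (conc (t (fst p)) (t (snd p)))) (\<Delta> x)
      = lext (\<lambda>x. 0) (\<Delta> x)"
    by (rule lext_cong) (use False in \<open>auto dest!: keys_comul simp: t_def\<close>)
  show ?thesis using False unfolding cobar_letter_def 1 2 by (simp add: t_def)
qed (simp add: t_def)

lemma cobar_word_t_conc:
  assumes "x \<in> gens H" "y \<in> gens H"
  shows "lext cobar_word (conc (t x) (t y)) =
    conc (cobar_letter x) (t y) + smul (ksgn (deg H x - 1)) (conc (t x) (cobar_letter y))"
proof (cases "0 < deg H x \<and> 0 < deg H y")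
  case True
  then show ?thesis by (simp add: t_def)
next
  case False
  then show ?thesis
    using cobar_word_t[OF assms(1)] cobar_word_t[OF assms(2)] by (auto simp: t_def)
qed

lemma lext_cobar_letter:
  "lext f (cobar_letter x) = - lext (\<lambda>y. lext f (t y)) (dH x) +
     lext (\<lambda>p. smul (ksgn (deg H (fst p))) (lext f (conc (t (fst p)) (t (snd p))))) (\<Delta> x)"
  by (simp add: cobar_letter_def linear_simps)

text \<open>Terms are sorted by word length. Those of length one vanish because the differential of
  \<open>H\<close> squares to zero, those of length two cancel because \<Delta> is a chain map, and
  those of length three by coassociativity.\<close>

lemma cobar_word_letter: "lext cobar_word (cobar_letter x) = 0"
proof -
  let ?s = "\<lambda>h. ksgn (deg H h) :: 'r"
  let ?c = "\<lambda>x y. conc (t x) (t y)"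
  have "lext (\<lambda>y. lext cobar_word (t y)) (dH x) = lext cobar_letter (dH x)"
    by (rule lext_cong) (use cobar_word_t keys_dH in blast)
  also have "\<dots> = lext (\<lambda>u. lext (\<lambda>p. smul (?s (fst p)) (?c (fst p) (snd p))) (\<Delta> u)) (dH x)"
    using bdif_bdif[OF chain_complex_H, of x, THEN arg_cong, of "lext t"]
    by (simp add: cobar_letter_def[abs_def] linear_simps)
  also have "\<dots> = lext (\<lambda>p. lext (\<lambda>u. smul (?s u) (?c u (snd p))) (dH (fst p)) +
     smul (?s (fst p)) (lext (\<lambda>u. smul (?s (fst p)) (?c (fst p) u)) (dH (snd p)))) (\<Delta> x)"
    by (rule comul_dif)
  also have "\<dots> = lext (\<lambda>p. - smul (?s (fst p)) (lext (\<lambda>u. ?c u (snd p)) (dH (fst p))) +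
     lext (\<lambda>u. ?c (fst p) u) (dH (snd p))) (\<Delta> x)"
  proof (rule lext_cong)
    fix p
    have "lext (\<lambda>u. smul (?s u) (?c u (snd p))) (dH (fst p)) =
      lext (\<lambda>u. smul (ksgn (deg H (fst p) + 1)) (?c u (snd p))) (dH (fst p))"
      by (rule lext_cong) (auto dest!: keys_dH intro!: smul_ksgn_cong)
    then show "lext (\<lambda>u. smul (?s u) (?c u (snd p))) (dH (fst p)) +
       smul (?s (fst p)) (lext (\<lambda>u. smul (?s (fst p)) (?c (fst p) u)) (dH (snd p))) =
      - smul (?s (fst p)) (lext (\<lambda>u. ?c u (snd p)) (dH (fst p))) + lext (\<lambda>u. ?c (fst p) u) (dH
          (snd p))"
      by (simp add: lext_smul_fun uminus_smul_ksgn) (simp add: ksgn_def)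
  qed
  finally have 1: "lext (\<lambda>y. lext cobar_word (t y)) (dH x) =
      lext (\<lambda>p. - smul (?s (fst p)) (lext (\<lambda>u. ?c u (snd p)) (dH (fst p))) +
      lext (\<lambda>u. ?c (fst p) u) (dH (snd p))) (\<Delta> x)" .
  \<comment> \<open>Splitting the left or the right factor leaves a sign that depends only on the
    middle letter \<open>y\<close>, with opposite signs in front; hence \<open>comul_coassoc\<close>
    cancels the two families.\<close>
  let ?K = "\<lambda>x y z. smul (?s y) (conc (t x) (conc (t y) (t z)))"
  have "lext (\<lambda>p. smul (?s (fst p)) (lext cobar_word (?c (fst p) (snd p)))) (\<Delta> x) =
    lext (\<lambda>p. - smul (?s (fst p)) (lext (\<lambda>u. ?c u (snd p)) (dH (fst p))) +
      lext (\<lambda>u. ?c (fst p) u) (dH (snd p)) +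
      lext (\<lambda>q. ?K (fst q) (snd q) (snd p)) (\<Delta> (fst p)) -
      lext (\<lambda>q. ?K (fst p) (fst q) (snd q)) (\<Delta> (snd p))) (\<Delta> x)"
  proof (rule lext_cong)
    fix p assume p: "p \<in> Poly_Mapping.keys (\<Delta> x)"
    then have m: "fst p \<in> gens H" "snd p \<in> gens H" using keys_comul by blast+
    have "smul (?s (fst p)) (lext (\<lambda>q. smul (?s (fst q)) (conc (t (fst q)) (conc (t (snd q)) (t
        (snd p))))) (\<Delta> (fst p))) =
        lext (\<lambda>q. ?K (fst q) (snd q) (snd p)) (\<Delta> (fst p))"
      unfolding lext_smul_fun[symmetric] smul_smul ksgn_mult_ksgn
      by (rule lext_cong) (auto dest!: keys_comul intro!: smul_ksgn_cong)
    then show "smul (?s (fst p)) (lext cobar_word (?c (fst p) (snd p))) =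
      - smul (?s (fst p)) (lext (\<lambda>u. ?c u (snd p)) (dH (fst p))) +
      lext (\<lambda>u. ?c (fst p) u) (dH (snd p)) +
      lext (\<lambda>q. ?K (fst q) (snd q) (snd p)) (\<Delta> (fst p)) -
      lext (\<lambda>q. ?K (fst p) (fst q) (snd q)) (\<Delta> (snd p))"
      using m
      by (simp add: cobar_word_t_conc cobar_letter_def conc_linear linear_simps conc_assoc)
        (simp add: ksgn_def smul_minus_one)
  qed
  also have "\<dots> = lext (\<lambda>p. - smul (?s (fst p)) (lext (\<lambda>u. ?c u (snd p)) (dH (fst p))) +
      lext (\<lambda>u. ?c (fst p) u) (dH (snd p))) (\<Delta> x)"
    by (simp only: lext_add_fun lext_diff_fun comul_coassoc[of ?K]) simp
  finally show ?thesis by (simp add: lext_cobar_letter 1)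
qed

text \<open>The two mixed terms, in which \<open>x\<close> and \<open>w\<close> are differentiated
  once each, have opposite signs: differentiating the letter first lowers its degree by one.\<close>

lemma cobar_word_cobar_word: "w \<in> lists (posgens H) \<Longrightarrow> lext cobar_word (cobar_word w) = 0"
proof (induction w)
  case (Cons x w)
  have 1: "lext cobar_word (conc (cobar_letter x) (gen w)) =
    conc (lext cobar_word (cobar_letter x)) (gen w) + smul (ksgn (deg H x)) (conc (cobar_letter x)
        (cobar_word w))"
  proof -
    have "lext cobar_word (conc (cobar_letter x) (gen w)) = lext (\<lambda>v. conc (cobar_word v) (gen w) +
       smul (ksgn (deg H x)) (conc (gen v) (cobar_word w))) (cobar_letter x)"
      unfolding lext_conc lext_gen cobar_word_append
      by (intro lext_cong arg_cong2[where f = "(+)"] refl smul_ksgn_cong)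
          (auto dest!: keys_cobar_letter)
    then show ?thesis by (simp add: lext_add_fun lext_smul_fun conc_lext_left[symmetric])
  qed
  have "lext cobar_word (conc (gen [x]) (cobar_word w)) = conc (cobar_letter x) (cobar_word w) +
     smul (ksgn (deg H x - 1)) (conc (gen [x]) (lext cobar_word (cobar_word w)))"
    by (simp add: lext_conc lext_add_fun lext_smul_fun conc_lext_right[symmetric])
  then show ?case using Cons 1
    by (simp add: linear_simps cobar_word_letter) (simp add: ksgn_def smul_minus_one)
qed simp

end

section \<open>Left multiplication operators on the twisted tensor product\<close>

context comod_algebra
begin

text \<open>Exponent of the Koszul sign for moving \<open>s^-1 a\<close> past
  \<open>b\<close>.\<close>

definition eps :: "'x \<Rightarrow> 'y \<Rightarrow> int" where
  "eps a b = (deg H a - 1) * deg B b"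

definition LB :: "'y \<Rightarrow> 'y \<times> 'x list \<Rightarrow> ('y \<times> 'x list \<Rightarrow>\<^sub>0 'r)" where
  "LB b z = lext (\<lambda>u. gen (u, snd z)) (mB b (fst z))"

text \<open>
  \<open>LH a\<close> is left multiplication by \<open>1 \<otimes> s\<^sup>-\<^sup>1a\<close>.  It vanishes in degree 0, as \<open>s\<^sup>-\<^sup>1a\<close> does; the
  formula defining it in positive degrees would not.
\<close>

definition LH :: "'x \<Rightarrow> 'y \<times> 'x list \<Rightarrow> ('y \<times> 'x list \<Rightarrow>\<^sub>0 'r)" where
  "LH a z = (if 0 < deg H a then
     lext (\<lambda>p. smul (ksgn (eps a (fst p)))
       (lext (\<lambda>h. gen (fst p, h # snd z)) (mH a (snd p)))) (\<nu> (fst z)) else 0)"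

text \<open>Built with \<open>t\<close>, so the summand \<open>b \<otimes> 1\<close> of the coaction
  contributes nothing.\<close>

definition Dtwist :: "'y \<times> 'x list \<Rightarrow> ('y \<times> 'x list \<Rightarrow>\<^sub>0 'r)" where
  "Dtwist z = lext (\<lambda>p. smul (ksgn (deg B (fst p)))
     (lext (\<lambda>v. gen (fst p, v @ snd z)) (t (snd p)))) (\<nu> (fst z))"

definition D :: "'y \<times> 'x list \<Rightarrow> ('y \<times> 'x list \<Rightarrow>\<^sub>0 'r)" where
  "D z = lext (\<lambda>u. gen (u, snd z)) (dB (fst z)) +
     smul (ksgn (deg B (fst z))) (lext (\<lambda>v. gen (fst z, v)) (cobar_word (snd z))) - Dtwist z"

primrec LW :: "'x list \<Rightarrow> 'y \<times> 'x list \<Rightarrow> ('y \<times> 'x list \<Rightarrow>\<^sub>0 'r)" where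
  "LW [] z = gen z"
| "LW (a # w) z = lext (LH a) (LW w z)"

lemma mB_assoc: "lext (\<lambda>u. lext k (mB u c)) (mB a b) = lext (\<lambda>u. lext k (mB a u)) (mB b c)"
  using bmul_assoc[OF chain_algebra_B, of c a b, THEN arg_cong, of "lext k"]
      by (simp add: lext_lext)

lemma mH_assoc: "lext (\<lambda>u. lext k (mH u c)) (mH a b) = lext (\<lambda>u. lext k (mH a u)) (mH b c)"
  using bmul_assoc[OF chain_algebra_H, of c a b, THEN arg_cong, of "lext k"]
      by (simp add: lext_lext)

lemma mB_Leibniz: "lext (\<lambda>u. lext k (dB u)) (mB a b) = lext (\<lambda>u. lext k (mB u b)) (dB a) +
    smul (ksgn (deg B a)) (lext (\<lambda>u. lext k (mB a u)) (dB b))"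
  using bmul_Leibniz[OF chain_algebra_B, of a b, THEN arg_cong, of "lext k"]
      by (simp add: linear_simps)

lemma mH_Leibniz: "lext (\<lambda>u. lext k (dH u)) (mH a b) = lext (\<lambda>u. lext k (mH u b)) (dH a) +
    smul (ksgn (deg H a)) (lext (\<lambda>u. lext k (mH a u)) (dH b))"
  using bmul_Leibniz[OF chain_algebra_H, of a b, THEN arg_cong, of "lext k"]
      by (simp add: linear_simps)

lemma mH_one_left: "x \<in> gens H \<Longrightarrow> lext (\<lambda>u. lext k (mH u x)) one = k x"
  using bmul_unit_left[OF chain_algebra_H, of x, THEN arg_cong, of "lext k"]
      by (simp add: linear_simps)

lemma mH_one_right: "x \<in> gens H \<Longrightarrow> lext (\<lambda>u. lext k (mH x u)) one = k x"
  using bmul_unit_right[OF chain_algebra_H, of x, THEN arg_cong, of "lext k"]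
      by (simp add: linear_simps)

section \<open>Relations between the operators and the differential\<close>

lemma LB_LB: "lext (LB b) (LB c z) = lext (\<lambda>u. LB u z) (mB b c)"
  using mB_assoc[of "\<lambda>u. gen (u, snd z)" "fst z" b c] by (simp add: LB_def[abs_def] linear_simps)

text \<open>Multiplicativity of the coaction expands \<nu>(b c), and associativity in
  \<open>H\<close> regroups \<open>a (h k)\<close> as \<open>(a h) k\<close>. As \<open>a\<close>
  has positive degree, so has every term of \<open>a h\<close>, and all the operators involved are
  given by their formula.\<close>

lemma LH_LB:
  assumes a: "0 < deg H a"
  shows "lext (LH a) (LB b z) = lext (\<lambda>p. smul (ksgn (eps a (fst p)))
    (lext (\<lambda>h. lext (LB (fst p)) (LH h z)) (mH a (snd p)))) (\<nu> b)"
proof -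
  let ?c = "fst z" and ?w = "snd z"
  let ?K = "\<lambda>x y. smul (ksgn (eps a x)) (lext (\<lambda>h. gen (x, h # ?w)) (mH a y))"
  have "lext (LH a) (LB b z) = lext (\<lambda>u. lext (\<lambda>p. ?K (fst p) (snd p)) (\<nu> u)) (mB b ?c)"
    using a by (simp add: LB_def LH_def linear_simps)
  also have "\<dots> = lext (\<lambda>p. lext (\<lambda>q. smul (ksgn (deg H (snd p) * deg B (fst q)))
     (lext (\<lambda>u. lext (\<lambda>v. ?K u v) (mH (snd p) (snd q))) (mB (fst p) (fst q)))) (\<nu> ?c)) (\<nu> b)"
    by (rule coact_mul)
  also have "\<dots> = lext (\<lambda>p. smul (ksgn (eps a (fst p)))
    (lext (\<lambda>h. lext (LB (fst p)) (LH h z)) (mH a (snd p)))) (\<nu> b)"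
  proof (rule lext_cong)
    fix p assume p: "p \<in> Poly_Mapping.keys (\<nu> b)"
    have "lext (\<lambda>h. lext (LB (fst p)) (LH h z)) (mH a (snd p)) =
      lext (\<lambda>h. lext (\<lambda>q. smul (ksgn ((deg H a + deg H (snd p) - 1) * deg B (fst q)))
         (lext (\<lambda>k. lext (\<lambda>u. gen (u, k # ?w)) (mB (fst p) (fst q))) (mH h (snd q)))) (\<nu> ?c))
             (mH a (snd p))"
    proof (rule lext_cong)
      fix h assume h: "h \<in> Poly_Mapping.keys (mH a (snd p))"
      then have "deg H h = deg H a + deg H (snd p)" "0 < deg H h"
        using keys_mH[OF h] a deg_nonneg[of "snd p"] keys_coact[OF p] by auto
      then show "lext (LB (fst p)) (LH h z) = lext (\<lambda>q. smul (ksgn ((deg H a + deg H (snd p)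
          - 1) * deg B (fst q)))
         (lext (\<lambda>k. lext (\<lambda>u. gen (u, k # ?w)) (mB (fst p) (fst q))) (mH h (snd q)))) (\<nu> ?c)"
        by (simp add: LH_def LB_def linear_simps eps_def)
    qed
    also have "\<dots> = lext (\<lambda>q. smul (ksgn ((deg H a + deg H (snd p) - 1) * deg B (fst q)))
         (lext (\<lambda>h. lext (\<lambda>k. lext (\<lambda>u. gen (u, k # ?w)) (mB (fst p) (fst q))) (mH h (snd q)))
             (mH a (snd p)))) (\<nu> ?c)"
      by (subst lext_swap) (simp only: lext_smul_fun)
    also have "\<dots> = lext (\<lambda>q. smul (ksgn ((deg H a + deg H (snd p) - 1) * deg B (fst q)))
         (lext (\<lambda>u. lext (\<lambda>v. lext (\<lambda>h. gen (u, h # ?w)) (mH a v)) (mH (snd p) (snd q))) (mB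
             (fst p) (fst q)))) (\<nu> ?c)"
      unfolding mH_assoc lext_swap[of _ "mB _ _"] ..
    finally have 1: "lext (\<lambda>h. lext (LB (fst p)) (LH h z)) (mH a (snd p)) = \<dots>" .
    show "lext (\<lambda>q. smul (ksgn (deg H (snd p) * deg B (fst q)))
        (lext (\<lambda>u. lext (\<lambda>v. ?K u v) (mH (snd p) (snd q))) (mB (fst p) (fst q)))) (\<nu> ?c) =
      smul (ksgn (eps a (fst p))) (lext (\<lambda>h. lext (LB (fst p)) (LH h z)) (mH a (snd p)))"
      unfolding 1 lext_smul_fun[symmetric] smul_smul ksgn_mult_ksgn
      by (intro lext_cong smul_ksgn_cong refl) (auto dest!: keys_mB simp: eps_def algebra_simps)
  qed
  finally show ?thesis .
qed

text \<open>The differential of \<open>B\<close> obeys the Leibniz rule, and the cobar part only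
  picks up the sign of \<open>b\<close>. The twisting term of a product is expanded with
  \<open>coact_mul\<close>: the summand \<open>b \<otimes> 1\<close> of \<nu>(b) returns the
  twisting term of \<open>z\<close>, the others give the twisting part of the differential of
  \<open>b \<otimes> 1\<close>.\<close>

lemma D_LB:
  assumes b: "b \<in> gens B"
  shows "lext D (LB b z) = lext (\<lambda>u. LB u z) (dB b) + smul (ksgn (deg B b)) (lext (LB b) (D z)) -
    lext (\<lambda>p. smul (ksgn (deg B (fst p))) (lext (LB (fst p)) (LH (snd p) z))) (\<nu> b)"
proof -
  let ?c = "fst z" and ?w = "snd z"
  let ?D1 = "\<lambda>z. lext (\<lambda>u. gen (u, snd z)) (dB (fst z)) :: ('y \<times> 'x list \<Rightarrow>\<^sub>0 'r)"
  let ?D2 = "\<lambda>z. smul (ksgn (deg B (fst z))) (lext (\<lambda>v. gen (fst z, v)) (cobar_word (snd z))) ::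
      ('y \<times> 'x list \<Rightarrow>\<^sub>0 'r)"
  let ?s = "ksgn (deg B b) :: 'r"
  have 1: "lext ?D1 (LB b z) = lext (\<lambda>u. LB u z) (dB b) + smul ?s (lext (LB b) (?D1 z))"
    by (simp add: LB_def linear_simps mB_Leibniz)
  have "lext ?D2 (LB b z) = lext (\<lambda>u. smul (ksgn (deg B b + deg B ?c)) (lext (\<lambda>v. gen (u, v))
      (cobar_word ?w))) (mB b ?c)"
    unfolding LB_def lext_lext by (intro lext_cong) (auto dest!: keys_mB)
  then have 2: "lext ?D2 (LB b z) = smul ?s (lext (LB b) (?D2 z))"
    by (simp add: LB_def linear_simps lext_swap[of _ "mB _ _"])
  let ?K = "\<lambda>x y. smul (ksgn (deg B x)) (lext (\<lambda>v. gen (x, v @ ?w)) (t y))"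
  let ?F = "\<lambda>x y. lext (\<lambda>q. smul (ksgn (deg H y * deg B (fst q)))
     (lext (\<lambda>u. lext (\<lambda>v. ?K u v) (mH y (snd q))) (mB x (fst q)))) (\<nu> ?c)"
  have "lext Dtwist (LB b z) = lext (\<lambda>u. lext (\<lambda>p. ?K (fst p) (snd p)) (\<nu> u)) (mB b ?c)"
    by (simp add: LB_def Dtwist_def linear_simps)
  also have "\<dots> = lext (\<lambda>p. ?F (fst p) (snd p)) (\<nu> b)"
    by (rule coact_mul)
  \<comment> \<open>The split is forced by degree 0: there \<open>?F\<close> contributes, while the
    operator \<open>LH\<close> in the claim is zero.\<close>
  also have "\<dots> = lext (\<lambda>p. (if deg H (snd p) = 0 then ?F (fst p) (snd p) else 0) +
      (if 0 < deg H (snd p) then ?F (fst p) (snd p) else 0)) (\<nu> b)"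
    by (rule lext_cong) (auto dest!: keys_coact deg_nonneg)
  also have "\<dots> = lext (?F b) one + lext (\<lambda>p. if 0 < deg H (snd p) then ?F (fst p) (snd p) else 0)
      (\<nu> b)"
    by (simp only: lext_add_fun coact_counit[OF b, of ?F])
  also have "lext (?F b) one = smul ?s (lext (LB b) (Dtwist z))"
  proof -
    have "lext (?F b) one = lext (\<lambda>y. lext (\<lambda>q. lext (\<lambda>v. lext (\<lambda>u. ?K u v) (mB b (fst q))) (mH y
        (snd q))) (\<nu> ?c)) one"
      by (intro lext_cong) (auto dest!: keys_one simp: lext_swap[of _ "mB _ _"])
    also have "\<dots> = lext (\<lambda>q. lext (\<lambda>y. lext (\<lambda>v. lext (\<lambda>u. ?K u v) (mB b (fst q))) (mH y
        (snd q))) one) (\<nu> ?c)"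
      by (rule lext_swap)
    also have "\<dots> = lext (\<lambda>q. lext (\<lambda>u. ?K u (snd q)) (mB b (fst q))) (\<nu> ?c)"
      by (intro lext_cong mH_one_left) (auto dest!: keys_coact)
    also have "\<dots> = lext (\<lambda>q. lext (\<lambda>u. smul (ksgn (deg B b + deg B (fst q))) (lext (\<lambda>v. gen
        (u, v @ ?w)) (t (snd q)))) (mB b (fst q))) (\<nu> ?c)"
      by (intro lext_cong) (auto dest!: keys_mB)
    also have "\<dots> = smul ?s (lext (LB b) (Dtwist z))"
      by (simp add: LB_def Dtwist_def lext_lext lext_smul lext_smul_fun[symmetric] lext_swap[of _
          "mB _ _"])
    finally show ?thesis .
  qed
  also have "lext (\<lambda>p. if 0 < deg H (snd p) then ?F (fst p) (snd p) else 0) (\<nu> b) =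
     lext (\<lambda>p. smul (ksgn (deg B (fst p))) (lext (LB (fst p)) (LH (snd p) z))) (\<nu> b)"
  proof (rule lext_cong)
    fix p assume p: "p \<in> Poly_Mapping.keys (\<nu> b)"
    show "(if 0 < deg H (snd p) then ?F (fst p) (snd p) else 0) =
       smul (ksgn (deg B (fst p))) (lext (LB (fst p)) (LH (snd p) z))"
    proof (cases "0 < deg H (snd p)")
      case True
      have "smul (ksgn (deg B (fst p))) (lext (LB (fst p)) (LH (snd p) z)) =
        lext (\<lambda>q. smul (ksgn (deg B (fst p) + eps (snd p) (fst q)))
          (lext (\<lambda>u. lext (\<lambda>v. gen (u, v # ?w)) (mH (snd p) (snd q))) (mB (fst p) (fst q)))) (\<nu> ?c)"
        using True by (simp add: LB_def LH_def lext_lext lext_smul lext_smul_fun[symmetric]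
            lext_swap[of _ "mB _ _"])
      also have "\<dots> = ?F (fst p) (snd p)"
      proof (rule lext_cong)
        fix q assume q: "q \<in> Poly_Mapping.keys (\<nu> ?c)"
        have "lext (\<lambda>u. lext (\<lambda>v. ?K u v) (mH (snd p) (snd q))) (mB (fst p) (fst q)) =
          lext (\<lambda>u. lext (\<lambda>v. smul (ksgn (deg B (fst p) + deg B (fst q))) (gen (u, v # ?w))) (mH
              (snd p) (snd q))) (mB (fst p) (fst q))"
        proof (intro lext_cong)
          fix u v assume u: "u \<in> Poly_Mapping.keys (mB (fst p) (fst q))"
              and v: "v \<in> Poly_Mapping.keys (mH (snd p) (snd q))"
          have "0 < deg H v" using keys_mH[OF v] True keys_coact[OF q] deg_nonneg[of "snd q"]
              by auto
          then show "?K u v = smul (ksgn (deg B (fst p) + deg B (fst q))) (gen (u, v # ?w))"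
            using keys_mB[OF u] by (simp add: lext_t)
        qed
        then show "smul (ksgn (deg B (fst p) + eps (snd p) (fst q)))
          (lext (\<lambda>u. lext (\<lambda>v. gen (u, v # ?w)) (mH (snd p) (snd q))) (mB (fst p) (fst q))) =
          smul (ksgn (deg H (snd p) * deg B (fst q))) (lext (\<lambda>u. lext (\<lambda>v. ?K u v) (mH (snd p)
              (snd q))) (mB (fst p) (fst q)))"
          by (simp add: lext_smul_fun) (intro smul_ksgn_cong refl, simp add: eps_def algebra_simps)
      qed
      finally show ?thesis using True by simp
    qed (simp add: LH_def)
  qed
  finally have 3: "lext Dtwist (LB b z) = smul ?s (lext (LB b) (Dtwist z)) +
     lext (\<lambda>p. smul (ksgn (deg B (fst p))) (lext (LB (fst p)) (LH (snd p) z))) (\<nu> b)" .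
  have "lext D v = lext ?D1 v + lext ?D2 v - lext Dtwist v" for v
    by (simp add: D_def[abs_def] linear_simps)
  moreover have "lext (LB b) (D z) = lext (LB b) (?D1 z) + lext (LB b) (?D2 z) - lext (LB b)
      (Dtwist z)"
    by (simp add: D_def linear_simps)
  ultimately show ?thesis by (simp only: 1 2 3 smul_add smul_diff) simp
qed

lemma lext_smul_cong:
  assumes "\<And>x. x \<in> Poly_Mapping.keys v \<Longrightarrow> smul c (f x) = g x"
  shows "smul c (lext f v) = lext g v"
  unfolding lext_smul_fun[symmetric] using assms by (rule lext_cong)

text \<open>This is where simple connectivity enters. It keeps every term of \<open>dH a\<close> in
  positive degree, so that no product of such a term with an element of \<open>H\<close> is lost
  under desuspension.\<close>

lemma deg_ge_2:
  assumes "a \<in> gens H" "0 < deg H a"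
  shows "2 \<le> deg H a"
proof (rule ccontr)
  assume "\<not> 2 \<le> deg H a"
  then have "(gen a :: 'x \<Rightarrow>\<^sub>0 'r) \<in> piece H 1" using assms by (intro piece_gen) auto
  then have "(gen a :: 'x \<Rightarrow>\<^sub>0 'r) = 0"
    using chain_hopf by (simp add: chain_hopf_algebra_def)
  then have "Poly_Mapping.lookup (gen a :: 'x \<Rightarrow>\<^sub>0 'r) a = 0" by simp
  then show False by simp
qed

lemma LH_nonpos: "\<not> 0 < deg H x \<Longrightarrow> LH x = (\<lambda>z. 0)"
  by (simp add: LH_def fun_eq_iff)

text \<open>\<open>LH\<close> vanishes in degree 0 exactly as \<open>t\<close> does, so the sum may
  run over the unreduced comultiplication.\<close>

lemma lext_LW_letter:
  "lext (\<lambda>v. LW v z) (cobar_letter a) = - lext (\<lambda>x. LH x z) (dH a) +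
     lext (\<lambda>p. smul (ksgn (deg H (fst p))) (lext (LH (fst p)) (LH (snd p) z))) (\<Delta> a)"
proof -
  have "lext (\<lambda>v. LW v z) (t x) = LH x z" for x
    by (simp add: t_def LH_nonpos)
  moreover have "lext (\<lambda>v. LW v z) (conc (t x) (t y)) = lext (LH x) (LH y z)" for x y
    by (auto simp: t_def LH_nonpos)
  ultimately show ?thesis by (simp add: lext_cobar_letter)
qed

text \<open>
  Besides the reduced comultiplication of \<open>a\<close>, the unreduced one has the terms \<open>1 \<otimes> a\<close> and
  \<open>a \<otimes> 1\<close>.  In the differential of \<open>s\<^sup>-\<^sup>1(a h)\<close>, the first yields what cancels the twisting term of
  \<open>D\<close> on \<open>LH a z\<close>, and the second yields \<open>LH a\<close> of the twisting term of \<open>D z\<close>.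
\<close>

lemma D_LH:
  assumes a: "a \<in> gens H" "0 < deg H a"
  shows "lext D (LH a z) = lext (\<lambda>v. LW v z) (cobar_letter a) + smul (ksgn (deg H a - 1)) (lext
      (LH a) (D z))"
proof -
  define b w where "b = fst z" and "w = snd z"
  let ?a = "deg H a"
  let ?s = "\<lambda>n. ksgn n :: 'r"
  let ?N = "\<lambda>x k. gen (x, k # w) :: ('y \<times> 'x list \<Rightarrow>\<^sub>0 'r)"
  let ?G = "\<lambda>x k. lext (\<lambda>v. gen (x, v @ w)) (t k) :: ('y \<times> 'x list \<Rightarrow>\<^sub>0 'r)"
  let ?GG = "\<lambda>x y z. lext (\<lambda>v. lext (\<lambda>v'. gen (x, v @ v' @ w)) (t z)) (t y) ::
      ('y \<times> 'x list \<Rightarrow>\<^sub>0 'r)"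
  let ?e = "\<lambda>f. lext (\<lambda>p. smul (?s (eps a (fst p))) (lext (\<lambda>h. f (fst p) h) (mH a (snd p)))) (\<nu> b)"
  \<comment> \<open>The five parts of the differential of \<open>x \<otimes> s^-1 h w\<close>: the
    differential of \<open>x\<close>, the linear and the quadratic part of the differential of
    \<open>s^-1 h\<close>, the differential of the tail \<open>w\<close>, and the twisting term.
    \<open>?e\<close> sums such a part over the terms of \<open>LH a z\<close>.\<close>
  let ?f1 = "\<lambda>x h. lext (\<lambda>u. gen (u, h # w)) (dB x) :: ('y \<times> 'x list \<Rightarrow>\<^sub>0 'r)"
  let ?f2 = "\<lambda>x h. smul (?s (deg B x)) (lext (?G x) (dH h))"
  let ?f3 = "\<lambda>x h. smul (?s (deg B x)) (lext (\<lambda>q. smul (?s (deg H (fst q))) (?GG x (fst q)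
      (snd q))) (\<Delta> h))"
  let ?f4 = "\<lambda>x h. smul (?s (deg B x + deg H h - 1)) (lext (\<lambda>v. gen (x, h # v)) (cobar_word w))"
  let ?f5 = "\<lambda>x h. Dtwist (x, h # w)"
  have D: "D (x, h # w) = ?f1 x h - ?f2 x h + ?f3 x h + ?f4 x h - ?f5 x h" for x h
    by (simp add: D_def linear_simps lext_cobar_letter lext_conc add_diff_eq)
  have LHz: "LH a z = ?e ?N" using a by (simp add: LH_def b_def w_def)
  have Y: "lext D (LH a z) = ?e ?f1 - ?e ?f2 + ?e ?f3 + ?e ?f4 - ?e ?f5"
    by (simp add: LHz lext_lext lext_smul D) (simp add: linear_simps)
  have pos: "0 < deg H h" if "h \<in> Poly_Mapping.keys (mH a x)" "x \<in> gens H" for h x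
    using keys_mH[OF that(1)] a deg_nonneg[OF that(2)] by simp
  note lext_smul_out = lext_smul_fun
  note lext_smul_in = lext_smul_fun[symmetric]
  \<comment> \<open>\<open>A1\<close>, \<open>A2\<close> and \<open>A3\<close> carry the
    differential on \<open>b_i\<close>, on \<open>a\<close> and on \<open>h^i\<close>. The Leibniz
    rule for \<open>a h^i\<close> splits \<open>?f2\<close> into \<open>A2\<close> and
    \<open>A3\<close>; since \<nu> is a chain map, \<open>A1\<close> and \<open>A3\<close> together
    are \<open>LH a\<close> of the differential of \<open>b\<close>; and \<open>A2\<close> is the
    linear part of the differential of \<open>s^-1 a\<close>.\<close>
  define A1 where "A1 = ?e ?f1"
  define A2 where "A2 = lext (\<lambda>p. smul (?s (eps a (fst p) + deg B (fst p)))
    (lext (\<lambda>x. lext (?N (fst p)) (mH x (snd p))) (dH a))) (\<nu> b)"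
  define A3 where "A3 = lext (\<lambda>p. smul (?s (eps a (fst p) + deg B (fst p) + ?a))
    (lext (\<lambda>y. lext (?N (fst p)) (mH a y)) (dH (snd p)))) (\<nu> b)"
  have Y2: "?e ?f2 = A2 + A3"
  proof -
    have "?e ?f2 = lext (\<lambda>p. smul (?s (eps a (fst p) + deg B (fst p)))
       (lext (\<lambda>h. lext (?G (fst p)) (dH h)) (mH a (snd p)))) (\<nu> b)"
      by (simp add: lext_smul_out)
    also have "\<dots> = lext (\<lambda>p. smul (?s (eps a (fst p) + deg B (fst p)))
      (lext (\<lambda>x. lext (?N (fst p)) (mH x (snd p))) (dH a)) + smul (?s (eps a (fst p) + deg B
          (fst p) + ?a))
      (lext (\<lambda>y. lext (?N (fst p)) (mH a y)) (dH (snd p)))) (\<nu> b)"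
    proof (rule lext_cong)
      fix p assume p: "p \<in> Poly_Mapping.keys (\<nu> b)"
      have "lext (\<lambda>x. lext (?G (fst p)) (mH x (snd p))) (dH a)
          = lext (\<lambda>x. lext (?N (fst p)) (mH x (snd p))) (dH a)"
      proof (intro lext_cong)
        fix x h assume x: "x \<in> Poly_Mapping.keys (dH a)" and h: "h \<in> Poly_Mapping.keys (mH x
            (snd p))"
        \<comment> \<open>\<open>x\<close> occurs in \<open>dH a\<close>, hence has degree
          \<open>deg H a - 1\<close>, which is positive by \<open>deg_ge_2\<close>.\<close>
        have "0 < deg H h"
          using keys_dH[OF x] keys_mH[OF h] deg_ge_2[OF a] deg_nonneg[of "snd p"] keys_coact[OF p]
              by simp
        then show "?G (fst p) h = ?N (fst p) h" by (simp add: lext_t)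
      qed
      moreover have "lext (\<lambda>y. lext (?G (fst p)) (mH a y)) (dH (snd p))
          = lext (\<lambda>y. lext (?N (fst p)) (mH a y)) (dH (snd p))"
        by (intro lext_cong) (use keys_dH pos in \<open>auto simp: lext_t\<close>)
      ultimately show "smul (?s (eps a (fst p) + deg B (fst p))) (lext (\<lambda>h. lext (?G (fst p))
          (dH h)) (mH a (snd p))) =
        smul (?s (eps a (fst p) + deg B (fst p)))
      (lext (\<lambda>x. lext (?N (fst p)) (mH x (snd p))) (dH a)) + smul (?s (eps a (fst p) + deg B
          (fst p) + ?a))
      (lext (\<lambda>y. lext (?N (fst p)) (mH a y)) (dH (snd p)))"
        by (simp add: mH_Leibniz smul_add)
    qed
    finally show ?thesis by (simp only: A2_def A3_def lext_add_fun)
  qed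
  have Z1: "smul (?s (?a - 1)) (lext (\<lambda>u. LH a (u, w)) (dB b)) = A1 - A3"
  proof -
    let ?K = "\<lambda>x y. smul (?s (eps a x)) (lext (?N x) (mH a y))"
    have "lext (\<lambda>u. LH a (u, w)) (dB b) = lext (\<lambda>u. lext (\<lambda>p. ?K (fst p) (snd p)) (\<nu> u)) (dB b)"
      using a by (simp add: LH_def)
    also have "\<dots> = lext (\<lambda>p. lext (\<lambda>u. ?K u (snd p)) (dB (fst p)) +
        smul (?s (deg B (fst p))) (lext (\<lambda>u. ?K (fst p) u) (dH (snd p)))) (\<nu> b)"
      by (rule coact_dif)
    also have "\<dots> = lext (\<lambda>p. smul (?s (eps a (fst p) + ?a - 1)) (lext (\<lambda>h. ?f1 (fst p) h) (mH a
        (snd p))) +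
        smul (?s (eps a (fst p) + deg B (fst p))) (lext (\<lambda>u. lext (?N (fst p)) (mH a u)) (dH
            (snd p)))) (\<nu> b)"
    proof (rule lext_cong)
      fix p
      have "lext (\<lambda>u. ?K u (snd p)) (dB (fst p))
          = lext (\<lambda>u. smul (?s (eps a (fst p) + ?a - 1)) (lext (?N u) (mH a (snd p)))) (dB (fst p))"
        by (intro lext_cong smul_ksgn_cong refl) (auto dest!: keys_dB simp: eps_def)
      also have "\<dots> = smul (?s (eps a (fst p) + ?a - 1)) (lext (\<lambda>h. ?f1 (fst p) h) (mH a (snd p)))"
        by (simp add: lext_smul_out lext_swap[of _ "dB _"])
      finally show "lext (\<lambda>u. ?K u (snd p)) (dB (fst p)) +
        smul (?s (deg B (fst p))) (lext (\<lambda>u. ?K (fst p) u) (dH (snd p))) =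
       smul (?s (eps a (fst p) + ?a - 1)) (lext (\<lambda>h. ?f1 (fst p) h) (mH a (snd p))) +
        smul (?s (eps a (fst p) + deg B (fst p))) (lext (\<lambda>u. lext (?N (fst p)) (mH a u)) (dH
            (snd p)))"
        by (simp add: lext_smul_out add.commute)
    qed
    also have "smul (?s (?a - 1)) \<dots> = A1 - A3"
      unfolding A1_def A3_def lext_diff_fun[symmetric] lext_smul_in[of "?s (?a - 1)"]
      by (intro lext_cong) (simp add: smul_add ksgn_def smul_minus_one)
    finally show ?thesis .
  qed
  have W2: "lext (\<lambda>x. LH x z) (dH a) = A2"
  proof -
    have "lext (\<lambda>x. LH x z) (dH a) = lext (\<lambda>x. lext (\<lambda>p. smul (?s (eps a (fst p) + deg B (fst p)))
       (lext (?N (fst p)) (mH x (snd p)))) (\<nu> b)) (dH a)"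
    proof (rule lext_cong)
      fix x assume x: "x \<in> Poly_Mapping.keys (dH a)"
      have x': "deg H x = ?a - 1" "0 < deg H x" using keys_dH[OF x] deg_ge_2[OF a] by auto
      then show "LH x z = lext (\<lambda>p. smul (?s (eps a (fst p) + deg B (fst p))) (lext (?N (fst p))
          (mH x (snd p)))) (\<nu> b)"
        unfolding LH_def if_P[OF x'(2)] b_def w_def
        by (intro lext_cong smul_ksgn_cong refl) (auto simp: eps_def)
    qed
    then show ?thesis by (simp add: A2_def lext_swap[of _ _ "dH _"] lext_smul_out)
  qed
  have Y4: "?e ?f4 = smul (?s (?a - 1)) (smul (?s (deg B b)) (lext (\<lambda>v. LH a (b, v))
      (cobar_word w)))"
  proof -
    \<comment> \<open>The degrees of \<open>b_i\<close> and \<open>a h^i\<close> add up to those of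
      \<open>a\<close> and \<open>b\<close>, so the sign is the same for all summands.\<close>
    have "?e ?f4 = ?e (\<lambda>x h. smul (?s (deg B b + ?a - 1 )) (lext (\<lambda>v. gen (x, h # v))
        (cobar_word w)))"
    proof (intro lext_cong arg_cong[where f = "smul _"])
      fix p h assume "p \<in> Poly_Mapping.keys (\<nu> b)" "h \<in> Poly_Mapping.keys (mH a (snd p))"
      then show "?f4 (fst p) h = smul (?s (deg B b + ?a - 1 )) (lext (\<lambda>v. gen (fst p, h # v))
          (cobar_word w))"
        by (intro smul_ksgn_cong refl) (auto dest!: keys_coact keys_mH)
    qed
    also have "\<dots> = smul (?s (?a - 1)) (smul (?s (deg B b)) (lext (\<lambda>v. LH a (b, v)) (cobar_word w)))"
      using a by (simp add: LH_def lext_swap[of _ "cobar_word _"] lext_smul_in algebra_simps)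
    finally show ?thesis .
  qed
  \<comment> \<open>The comultiplication of \<open>a h^i\<close> is the product of those of
    \<open>a\<close> and \<open>h^i\<close>; \<open>?Phi x y\<close> is the contribution of a
    summand \<open>x \<otimes> y\<close> of \<Delta>(a). The sign of \<open>b_i\<close> and the
    exponent \<open>eps\<close> combine to \<open>deg H a * deg B b_i\<close>.\<close>
  let ?Phi = "\<lambda>x y. lext (\<lambda>p. smul (?s (?a * deg B (fst p))) (lext (\<lambda>s. smul (?s (deg H y * deg H
      (fst s)))
    (lext (\<lambda>u. lext (\<lambda>v. smul (?s (deg H u)) (?GG (fst p) u v)) (mH y (snd s))) (mH x (fst s))))
        (\<Delta> (snd p)))) (\<nu> b)"
  have Y3: "?e ?f3 = lext (\<lambda>r. ?Phi (fst r) (snd r)) (\<Delta> a)"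
  proof -
    have "?e ?f3 = lext (\<lambda>p. smul (?s (eps a (fst p) + deg B (fst p))) (lext (\<lambda>h. lext (\<lambda>q. smul
        (?s (deg H (fst q))) (?GG (fst p) (fst q) (snd q))) (\<Delta> h)) (mH a (snd p)))) (\<nu> b)"
      by (simp add: lext_smul_out)
    also have "\<dots> = lext (\<lambda>p. smul (?s (eps a (fst p) + deg B (fst p)))
      (lext (\<lambda>r. lext (\<lambda>s. smul (?s (deg H (snd r) * deg H (fst s)))
        (lext (\<lambda>u. lext (\<lambda>v. smul (?s (deg H u)) (?GG (fst p) u v)) (mH (snd r) (snd s))) (mH
            (fst r) (fst s)))) (\<Delta> (snd p))) (\<Delta> a))) (\<nu> b)"
      by (intro lext_cong arg_cong[where f = "smul _"] comul_mul)
    also have "\<dots> = lext (\<lambda>p. lext (\<lambda>r. smul (?s (?a * deg B (fst p))) (lext (\<lambda>s. smul (?s (deg H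
        (snd r) * deg H (fst s)))
        (lext (\<lambda>u. lext (\<lambda>v. smul (?s (deg H u)) (?GG (fst p) u v)) (mH (snd r) (snd s))) (mH
            (fst r) (fst s)))) (\<Delta> (snd p)))) (\<Delta> a)) (\<nu> b)"
      unfolding lext_smul_out by (intro lext_cong smul_ksgn_cong refl)
          (simp add: eps_def algebra_simps)
    finally show ?thesis by (simp only: lext_swap[of _ "\<Delta> a"])
  qed
  \<comment> \<open>Here the comultiplication acts on \<open>h^i\<close>, whereas
    \<open>LH a\<close> after the twisting term coacts twice on \<open>b\<close>;
    \<open>coact_coassoc\<close> exchanges the two forms. The same exchange is used for
    \<open>C2\<close> and \<open>C3\<close>.\<close>
  have C1: "lext (?Phi a) one = - smul (?s (?a - 1)) (lext (LH a) (Dtwist z))"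
  proof -
    let ?K = "\<lambda>x y z. smul (?s (?a * deg B x + deg H y)) (lext (\<lambda>h. lext (\<lambda>v. gen (x, h # v @ w))
        (t z)) (mH a y))"
    have "lext (?Phi a) one = lext (\<lambda>p. smul (?s (?a * deg B (fst p))) (lext (\<lambda>s. lext (\<lambda>y. smul
        (?s (deg H y * deg H (fst s)))
      (lext (\<lambda>u. lext (\<lambda>v. smul (?s (deg H u)) (?GG (fst p) u v)) (mH y (snd s))) (mH a
          (fst s)))) one) (\<Delta> (snd p)))) (\<nu> b)"
      by (simp only: lext_swap[of _ _ one] lext_smul_out)
    also have "\<dots> = lext (\<lambda>p. lext (\<lambda>s. smul (?s ?a) (?K (fst p) (fst s) (snd s))) (\<Delta> (snd p)))
        (\<nu> b)"
    proof (intro lext_cong lext_smul_cong)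
      fix p :: "'y \<times> 'x" and s assume s: "s \<in> Poly_Mapping.keys (\<Delta> (snd p))"
      have "lext (\<lambda>y. smul (?s (deg H y * deg H (fst s)))
        (lext (\<lambda>u. lext (\<lambda>v. smul (?s (deg H u)) (?GG (fst p) u v)) (mH y (snd s))) (mH a
            (fst s)))) one =
        lext (\<lambda>y. lext (\<lambda>u. lext (\<lambda>v. smul (?s (deg H u)) (?GG (fst p) u v)) (mH y (snd s))) (mH a
            (fst s))) one"
        by (intro lext_cong) (auto dest!: keys_one)
      also have "\<dots> = lext (\<lambda>u. lext (\<lambda>y. lext (\<lambda>v. smul (?s (deg H u)) (?GG (fst p) u v)) (mH y
          (snd s))) one) (mH a (fst s))"
        by (rule lext_swap)
      also have "\<dots> = lext (\<lambda>u. smul (?s (deg H u)) (?GG (fst p) u (snd s))) (mH a (fst s))"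
        using keys_comul[OF s] by (intro lext_cong mH_one_left) simp
      also have "\<dots> = lext (\<lambda>u. smul (?s (?a + deg H (fst s))) (lext (\<lambda>v. gen (fst p, u # v @ w))
          (t (snd s)))) (mH a (fst s))"
      proof (rule lext_cong)
        fix u assume u: "u \<in> Poly_Mapping.keys (mH a (fst s))"
        then show "smul (?s (deg H u)) (?GG (fst p) u (snd s))
            = smul (?s (?a + deg H (fst s))) (lext (\<lambda>v. gen (fst p, u # v @ w)) (t (snd s)))"
          using keys_mH[OF u] pos[OF u] keys_comul[OF s] by (simp add: lext_t[of _ u])
      qed
      finally show "smul (?s (?a * deg B (fst p))) (lext (\<lambda>y. smul (?s (deg H y * deg H (fst s)))
        (lext (\<lambda>u. lext (\<lambda>v. smul (?s (deg H u)) (?GG (fst p) u v)) (mH y (snd s))) (mH a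
            (fst s)))) one) =
        smul (?s ?a) (?K (fst p) (fst s) (snd s))"
        by (simp add: lext_smul_out add_ac)
    qed
    also have "\<dots> = smul (?s ?a) (lext (\<lambda>p. lext (\<lambda>s. ?K (fst p) (fst s) (snd s)) (\<Delta> (snd p)))
        (\<nu> b))"
      by (simp only: lext_smul_out)
    also have "\<dots> = smul (?s ?a) (lext (\<lambda>p. lext (\<lambda>q. ?K (fst q) (snd q) (snd p)) (\<nu> (fst p)))
        (\<nu> b))"
      by (simp only: coact_coassoc[of ?K])
    also have "lext (\<lambda>p. lext (\<lambda>q. ?K (fst q) (snd q) (snd p)) (\<nu> (fst p))) (\<nu> b)
        = lext (LH a) (Dtwist z)"
    proof -
      have "lext (LH a) (Dtwist z) = lext (\<lambda>p. lext (\<lambda>q. smul (?s (deg B (fst p) + eps a (fst q)))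
        (lext (\<lambda>h. lext (\<lambda>v. gen (fst q, h # v @ w)) (t (snd p))) (mH a (snd q)))) (\<nu> (fst p)))
            (\<nu> b)"
        using a by (simp add: Dtwist_def LH_def b_def[symmetric] w_def[symmetric] lext_lext
            lext_smul lext_smul_in lext_swap[of _ "t _"])
      also have "\<dots> = lext (\<lambda>p. lext (\<lambda>q. ?K (fst q) (snd q) (snd p)) (\<nu> (fst p))) (\<nu> b)"
        by (intro lext_cong smul_ksgn_cong refl) (auto dest!: keys_coact simp: eps_def
            algebra_simps)
      finally show ?thesis ..
    qed
    finally show ?thesis by (simp add: uminus_smul_ksgn)
  qed
  have C2: "lext (\<lambda>y. ?Phi y a) one = ?e ?f5"
  proof -
    let ?K = "\<lambda>x y z. smul (?s (eps a x + (?a - 1) * deg H y + deg B x)) (lext (\<lambda>h. lext (\<lambda>v. gen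
        (x, v @ h # w)) (t y)) (mH a z))"
    have "lext (\<lambda>y. ?Phi y a) one = lext (\<lambda>p. smul (?s (?a * deg B (fst p))) (lext (\<lambda>s. smul (?s
        (?a * deg H (fst s))) (lext (\<lambda>y.
      (lext (\<lambda>u. lext (\<lambda>v. smul (?s (deg H u)) (?GG (fst p) u v)) (mH a (snd s))) (mH y
          (fst s)))) one)) (\<Delta> (snd p)))) (\<nu> b)"
      by (simp only: lext_swap[of _ _ one] lext_smul_out)
    also have "\<dots> = lext (\<lambda>p. lext (\<lambda>s. ?K (fst p) (fst s) (snd s)) (\<Delta> (snd p))) (\<nu> b)"
    proof (intro lext_cong lext_smul_cong)
      fix p :: "'y \<times> 'x" and s assume s: "s \<in> Poly_Mapping.keys (\<Delta> (snd p))"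
      have "lext (\<lambda>y. lext (\<lambda>u. lext (\<lambda>v. smul (?s (deg H u)) (?GG (fst p) u v)) (mH a (snd s)))
          (mH y (fst s))) one =
        lext (\<lambda>v. smul (?s (deg H (fst s))) (?GG (fst p) (fst s) v)) (mH a (snd s))"
        using keys_comul[OF s] by (intro mH_one_left) simp
      also have "\<dots> = lext (\<lambda>v. smul (?s (deg H (fst s))) (lext (\<lambda>v'. gen (fst p, v' @ v # w)) (t
          (fst s)))) (mH a (snd s))"
        using pos keys_comul[OF s] by (intro lext_cong arg_cong[where f
            = "smul _"]) (simp add: lext_t[of _ "_"])
      finally have 1: "lext (\<lambda>y. lext (\<lambda>u. lext (\<lambda>v. smul (?s (deg H u)) (?GG (fst p) u v)) (mH a
          (snd s))) (mH y (fst s))) one = \<dots>" .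
      show "smul (?s (?a * deg B (fst p))) (smul (?s (?a * deg H (fst s))) (lext (\<lambda>y.
        lext (\<lambda>u. lext (\<lambda>v. smul (?s (deg H u)) (?GG (fst p) u v)) (mH a (snd s))) (mH y
            (fst s))) one)) = ?K (fst p) (fst s) (snd s)"
        unfolding 1 unfolding lext_smul_out smul_smul ksgn_mult_ksgn
            by (intro smul_ksgn_cong refl) (simp add: eps_def algebra_simps)
    qed
    also have "\<dots> = lext (\<lambda>p. lext (\<lambda>q. ?K (fst q) (snd q) (snd p)) (\<nu> (fst p))) (\<nu> b)"
      by (simp only: coact_coassoc[of ?K])
    also have "\<dots> = lext (\<lambda>p. lext (\<lambda>q. smul (?s (eps a (fst p) + deg B (fst q)))
      (lext (\<lambda>h. lext (\<lambda>v. gen (fst q, v @ h # w)) (t (snd q))) (mH a (snd p)))) (\<nu> (fst p))) (\<nu> b)"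
      by (intro lext_cong smul_ksgn_cong refl) (auto dest!: keys_coact simp: eps_def algebra_simps)
    also have "\<dots> = ?e ?f5"
      by (simp add: Dtwist_def lext_smul_in lext_swap[of _ "mH _ _"])
    finally show ?thesis .
  qed
  \<comment> \<open>The reduced part of \<Delta>(a) yields the composites of two operators
    \<open>LH\<close>, that is, left multiplication by the quadratic part of the differential of
    \<open>s^-1 a\<close>.\<close>
  have C3: "lext (\<lambda>r. if 0 < deg H (fst r) \<and> 0 < deg H (snd r) then ?Phi (fst r) (snd r) else 0)
      (\<Delta> a) =
    lext (\<lambda>r. smul (?s (deg H (fst r))) (lext (LH (fst r)) (LH (snd r) z))) (\<Delta> a)"
  proof (rule lext_cong)
    fix r assume r: "r \<in> Poly_Mapping.keys (\<Delta> a)"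
    show "(if 0 < deg H (fst r) \<and> 0 < deg H (snd r) then ?Phi (fst r) (snd r) else 0) =
      smul (?s (deg H (fst r))) (lext (LH (fst r)) (LH (snd r) z))"
    proof (cases "0 < deg H (fst r) \<and> 0 < deg H (snd r)")
      case True
      let ?x = "fst r" and ?y = "snd r"
      let ?K = "\<lambda>x y z. smul (?s (deg H ?x + (deg H ?y - 1) * (deg B x + deg H y) + eps ?x x))
         (lext (\<lambda>u. lext (\<lambda>v. gen (x, u # v # w)) (mH ?y z)) (mH ?x y))"
      have "smul (?s (deg H ?x)) (lext (LH ?x) (LH ?y z)) =
        lext (\<lambda>p. lext (\<lambda>q. smul (?s (deg H ?x + eps ?y (fst p) + eps ?x (fst q)))
         (lext (\<lambda>u. lext (\<lambda>v. gen (fst q, u # v # w)) (mH ?y (snd p))) (mH ?x (snd q)))) (\<nu>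
             (fst p))) (\<nu> b)"
        using True by (simp add: LH_def b_def[symmetric] w_def[symmetric] lext_lext lext_smul
            lext_smul_in lext_swap[of _ "mH (snd r) _"] add_ac)
      also have "\<dots> = lext (\<lambda>p. lext (\<lambda>q. ?K (fst q) (snd q) (snd p)) (\<nu> (fst p))) (\<nu> b)"
        by (intro lext_cong smul_ksgn_cong refl) (auto dest!: keys_coact simp: eps_def
            algebra_simps)
      also have "\<dots> = lext (\<lambda>p. lext (\<lambda>s. ?K (fst p) (fst s) (snd s)) (\<Delta> (snd p))) (\<nu> b)"
        by (rule coact_coassoc)
      also have "\<dots> = ?Phi ?x ?y"
      proof (rule sym, intro lext_cong lext_smul_cong)
        fix p :: "'y \<times> 'x" and s assume s: "s \<in> Poly_Mapping.keys (\<Delta> (snd p))"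
        have "lext (\<lambda>u. lext (\<lambda>v. smul (?s (deg H u)) (?GG (fst p) u v)) (mH ?y (snd s))) (mH ?x
            (fst s)) =
          lext (\<lambda>u. lext (\<lambda>v. smul (?s (deg H ?x + deg H (fst s))) (gen (fst p, u # v # w)))
              (mH ?y (snd s))) (mH ?x (fst s))"
        proof (intro lext_cong)
          fix u v assume u: "u \<in> Poly_Mapping.keys (mH ?x (fst s))" and v: "v \<in> Poly_Mapping.keys
              (mH ?y (snd s))"
          have "0 < deg H u" "0 < deg H v"
            using keys_mH[OF u] keys_mH[OF v] True keys_comul[OF s] deg_nonneg[of "fst s"]
                deg_nonneg[of "snd s"] by auto
          then show "smul (?s (deg H u)) (?GG (fst p) u v)
              = smul (?s (deg H ?x + deg H (fst s))) (gen (fst p, u # v # w))"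
            using keys_mH[OF u] by (simp add: lext_t)
        qed
        then show "smul (?s (?a * deg B (fst p))) (smul (?s (deg H ?y * deg H (fst s)))
          (lext (\<lambda>u. lext (\<lambda>v. smul (?s (deg H u)) (?GG (fst p) u v)) (mH ?y (snd s))) (mH ?x
              (fst s)))) = ?K (fst p) (fst s) (snd s)"
          unfolding lext_smul_out by (simp only: smul_smul ksgn_mult_ksgn)
            (intro smul_ksgn_cong refl, use keys_comul[OF r] in \<open>simp add: eps_def algebra_simps\<close>)
      qed
      finally show ?thesis using True by simp
    qed (auto simp: LH_nonpos)
  qed
  have "lext (LH a) (D z) = lext (\<lambda>u. LH a (u, w)) (dB b) + smul (?s (deg B b)) (lext (\<lambda>v. LH a
      (b, v)) (cobar_word w)) - lext (LH a) (Dtwist z)"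
    by (simp add: D_def linear_simps b_def w_def)
  \<comment> \<open>\<open>C2\<close> cancels the twisting part \<open>?f5\<close>. The terms
    \<open>A1 - A3\<close>, \<open>?f4\<close> and \<open>C1\<close> make up \<open>LH a\<close> of
    \<open>D z\<close>, and \<open>- A2\<close> with \<open>C3\<close> is left multiplication by the
    differential of the letter.\<close>
  then show ?thesis
    unfolding Y lext_LW_letter Y2 Y3 comul_split[OF a, of ?Phi] C1 C2 C3 W2 Y4 A1_def[symmetric]
    by (simp only: smul_add smul_diff Z1) simp
qed

end

section \<open>The twisted tensor product as a chain algebra\<close>

context comod_algebra
begin

abbreviation "M \<equiv> gtensor B (cobar H)"

lemma t_keys: "v \<in> Poly_Mapping.keys (t h) \<Longrightarrow> v = [h] \<and> 0 < deg H h"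
  by (auto simp: t_def split: if_splits)

lemma D_piece:
  assumes "z \<in> gens M"
  shows "D z \<in> piece M (deg M z - 1)"
  unfolding D_def Dtwist_def
proof (intro piece_add piece_diff piece_smul piece_lext piece_gen)
  fix v assume "v \<in> Poly_Mapping.keys (cobar_word (snd z))"
  moreover have "snd z \<in> lists (posgens H)" using assms by (simp add: mem_Times_iff)
  ultimately have "v \<in> lists (posgens H) \<and> wdeg v = wdeg (snd z) - 1"
    using cobar_word_piece[of "snd z"] unfolding piece_iff by simp
  then show "(fst z, v) \<in> gens M" "deg M (fst z, v) = deg M z - 1" using assms by auto
next
  fix p v assume "p \<in> Poly_Mapping.keys (\<nu> (fst z))" "v \<in> Poly_Mapping.keys (t (snd p))"
  then show "(fst p, v @ snd z) \<in> gens M" "deg M (fst p, v @ snd z) = deg M z - 1"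
    using assms by (auto dest!: keys_coact t_keys simp: posgens_def)
qed (use assms in \<open>auto dest!: keys_dB\<close>)

lemma LB_piece: "z \<in> gens M \<Longrightarrow> LB b z \<in> piece M (deg B b + deg M z)"
  unfolding LB_def by (intro piece_lext piece_gen) (auto dest!: keys_mB)

lemma LH_piece:
  assumes "z \<in> gens M"
  shows "LH a z \<in> piece M (deg H a - 1 + deg M z)"
proof (cases "0 < deg H a")
  case True
  show ?thesis unfolding LH_def if_P[OF True]
  proof (intro piece_smul piece_lext piece_gen)
    fix p h assume p: "p \<in> Poly_Mapping.keys (\<nu> (fst z))" and h: "h \<in> Poly_Mapping.keys (mH a
        (snd p))"
    then show "(fst p, h # snd z) \<in> gens M" "deg M (fst p, h # snd z) = deg H a - 1 + deg M z"
      using True assms keys_coact[OF p] keys_mH[OF h] deg_nonneg[of "snd p"]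
          by (auto simp: posgens_def)
  qed
qed (simp add: LH_def)

lemma LW_piece: "z \<in> gens M \<Longrightarrow> LW w z \<in> piece M (wdeg w + deg M z)"
proof (induction w)
  case (Cons a w)
  have "LH a q \<in> piece M (wdeg (a # w) + deg M z)" if "q \<in> Poly_Mapping.keys (LW w z)" for q
    using Cons that LH_piece[of q a] by (auto simp: piece_iff[of "LW w z"] add_ac diff_add_eq)
  then show ?case by (auto intro: piece_lext)
qed (auto intro: piece_gen)

section \<open>The square of the twisted differential\<close>

lemma D_append: "D (b, w @ v) = lext (\<lambda>q. gen (fst q, snd q @ v)) (D (b, w)) +
    smul (ksgn (deg B b + wdeg w)) (lext (\<lambda>v'. gen (b, w @ v')) (cobar_word v))"
  by (simp add: D_def Dtwist_def linear_simps cobar_word_append lext_conc)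

text \<open>Compatibility of \<nu> with differentials cancels the linear terms. Applying the
  twisting term twice produces two letters from two coactions; coassociativity matches them with the
  quadratic part of the cobar differential.\<close>

lemma D_D_Nil: "lext D (D (b, [])) = 0"
proof -
  let ?s = "\<lambda>x. ksgn (deg B x) :: 'r"
  let ?T = "\<lambda>x y. lext (\<lambda>v. gen (x, v)) (t y) :: ('y \<times> 'x list \<Rightarrow>\<^sub>0 'r)"
  let ?K = "\<lambda>x y. smul (?s x) (?T x y)"
  \<comment> \<open>Twisting twice gives the signs of \<open>b_i\<close> and of its own factor in
    \<open>B\<close>, whose degrees differ by that of \<open>y\<close>; so only the parity of
    \<open>y\<close> survives, as in the cobar differential.\<close>
  let ?K3 = "\<lambda>x y z. smul (ksgn (deg H y)) (lext (\<lambda>v. lext (\<lambda>v'. gen (x, v @ v')) (t z)) (t y)) ::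
      ('y \<times> 'x list \<Rightarrow>\<^sub>0 'r)"
  have T: "D (u, []) = lext (\<lambda>u. gen (u, [])) (dB u) - lext (\<lambda>p. ?K (fst p) (snd p)) (\<nu> u)" for u
    by (simp add: D_def Dtwist_def)
  have "lext (\<lambda>u. D (u, [])) (dB b) = lext (\<lambda>u. gen (u, [])) (lext dB (dB b)) -
     lext (\<lambda>u. lext (\<lambda>p. ?K (fst p) (snd p)) (\<nu> u)) (dB b)"
    by (simp add: T linear_simps)
  also have "\<dots> = - lext (\<lambda>p. lext (\<lambda>u. ?K u (snd p)) (dB (fst p)) +
     smul (?s (fst p)) (lext (?K (fst p)) (dH (snd p)))) (\<nu> b)"
    by (simp only: bdif_bdif[OF chain_complex_B] coact_dif[of ?K]) simp
  also have "lext (\<lambda>p. lext (\<lambda>u. ?K u (snd p)) (dB (fst p)) +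
     smul (?s (fst p)) (lext (?K (fst p)) (dH (snd p)))) (\<nu> b) =
    lext (\<lambda>p. - smul (?s (fst p)) (lext (\<lambda>u. ?T u (snd p)) (dB (fst p))) + lext (?T (fst p)) (dH
        (snd p))) (\<nu> b)"
  proof (rule lext_cong)
    fix p
    have "lext (\<lambda>u. ?K u (snd p)) (dB (fst p))
        = lext (\<lambda>u. smul (ksgn (deg B (fst p) + 1)) (?T u (snd p))) (dB (fst p))"
      by (intro lext_cong smul_ksgn_cong refl) (auto dest!: keys_dB)
    then show "lext (\<lambda>u. ?K u (snd p)) (dB (fst p)) + smul (?s (fst p)) (lext (?K (fst p)) (dH
        (snd p))) =
       - smul (?s (fst p)) (lext (\<lambda>u. ?T u (snd p)) (dB (fst p))) + lext (?T (fst p)) (dH (snd p))"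
      by (simp add: lext_smul_fun uminus_smul_ksgn) (simp add: ksgn_def)
  qed
  finally have 1: "lext (\<lambda>u. D (u, [])) (dB b) = - \<dots>" .
  have "lext (\<lambda>p. smul (?s (fst p)) (lext (\<lambda>v. D (fst p, v)) (t (snd p)))) (\<nu> b) =
    lext (\<lambda>p. smul (?s (fst p)) (lext (\<lambda>u. ?T u (snd p)) (dB (fst p))) - lext (?T (fst p)) (dH
        (snd p)) +
      lext (\<lambda>q. ?K3 (fst p) (fst q) (snd q)) (\<Delta> (snd p)) - lext (\<lambda>q. ?K3 (fst q) (snd q) (snd p))
          (\<nu> (fst p))) (\<nu> b)"
  proof (rule lext_cong)
    fix p assume p: "p \<in> Poly_Mapping.keys (\<nu> b)"
    then have g: "snd p \<in> gens H" using keys_coact by blast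
    have "lext (\<lambda>v. lext (\<lambda>v'. gen (fst p, v')) (cobar_word v)) (t (snd p)) =
        lext (\<lambda>v'. gen (fst p, v')) (cobar_letter (snd p))"
      by (simp add: cobar_word_t[OF g, symmetric] lext_lext)
    also have "\<dots> = - lext (?T (fst p)) (dH (snd p)) + lext (\<lambda>q. ?K3 (fst p) (fst q) (snd q)) (\<Delta>
        (snd p))"
      by (simp add: lext_cobar_letter lext_conc)
    finally have 2: "lext (\<lambda>v. lext (\<lambda>v'. gen (fst p, v')) (cobar_word v)) (t (snd p)) = \<dots>" .
    have "smul (?s (fst p)) (lext (\<lambda>v. Dtwist (fst p, v)) (t (snd p))) =
      lext (\<lambda>q. smul (ksgn (deg B (fst p) + deg B (fst q))) (lext (\<lambda>v. lext (\<lambda>v'. gen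
          (fst q, v @ v')) (t (snd p))) (t (snd q)))) (\<nu> (fst p))"
      by (simp add: Dtwist_def lext_swap[of _ _ "t (snd p)"] lext_smul_fun[symmetric])
    also have "\<dots> = lext (\<lambda>q. ?K3 (fst q) (snd q) (snd p)) (\<nu> (fst p))"
      by (intro lext_cong smul_ksgn_cong refl) (auto dest!: keys_coact)
    finally have 3: "smul (?s (fst p)) (lext (\<lambda>v. Dtwist (fst p, v)) (t (snd p))) = \<dots>" .
    have 4: "lext (\<lambda>v. D (fst p, v)) (t (snd p)) = lext (\<lambda>u. ?T u (snd p)) (dB (fst p)) +
       smul (?s (fst p)) (lext (\<lambda>v. lext (\<lambda>v'. gen (fst p, v')) (cobar_word v)) (t (snd p))) -
       lext (\<lambda>v. Dtwist (fst p, v)) (t (snd p))"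
      by (simp add: D_def linear_simps lext_swap[of _ _ "t (snd p)"])
    show "smul (?s (fst p)) (lext (\<lambda>v. D (fst p, v)) (t (snd p))) =
     smul (?s (fst p)) (lext (\<lambda>u. ?T u (snd p)) (dB (fst p))) - lext (?T (fst p)) (dH (snd p)) +
      lext (\<lambda>q. ?K3 (fst p) (fst q) (snd q)) (\<Delta> (snd p)) - lext (\<lambda>q. ?K3 (fst q) (snd q) (snd p))
          (\<nu> (fst p))"
      unfolding 4 2 smul_diff smul_add 3 by (simp add: smul_uminus_right ksgn_def)
  qed
  also have "\<dots> = lext (\<lambda>p. smul (?s (fst p)) (lext (\<lambda>u. ?T u (snd p)) (dB (fst p))) - lext (?T
      (fst p)) (dH (snd p))) (\<nu> b)"
    by (simp only: lext_add_fun lext_diff_fun coact_coassoc[of ?K3]) simp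
  finally have 5: "lext (\<lambda>p. smul (?s (fst p)) (lext (\<lambda>v. D (fst p, v)) (t (snd p)))) (\<nu> b) = \<dots>" .
  have "lext D (D (b, [])) = lext (\<lambda>u. D (u, [])) (dB b) - lext (\<lambda>p. smul (?s (fst p)) (lext
      (\<lambda>v. D (fst p, v)) (t (snd p)))) (\<nu> b)"
    by (simp add: T linear_simps)
  then show ?thesis unfolding 1 5 by (simp add: lext_uminus_fun[symmetric] lext_diff_fun[symmetric])
qed

text \<open>By \<open>D_append\<close> the differential is a derivation for appending words on the
  right, which reduces the claim to \<open>b \<otimes> 1\<close> and to the cobar differential. The
  mixed terms cancel because the differential of \<open>b \<otimes> 1\<close> has degree one less
  than \<open>b\<close>.\<close>

lemma D_D:
  assumes "z \<in> gens M"
  shows "lext D (D z) = 0"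
proof -
  obtain b w where z: "z = (b, w)" and b: "b \<in> gens B" and w: "w \<in> lists (posgens H)"
    using assms by (cases z) auto
  let ?R = "\<lambda>v q. gen (fst q, snd q @ v) :: ('y \<times> 'x list \<Rightarrow>\<^sub>0 'r)"
  let ?s = "ksgn (deg B b) :: 'r"
  have D: "D (b, v) = lext (?R v) (D (b, [])) + smul ?s (lext (\<lambda>v'. gen (b, v'))
      (cobar_word v))" for v
    using D_append[of b "[]" v] by simp
  have "lext D (lext (?R w) (D (b, []))) = lext (\<lambda>q. lext (?R w) (D q) +
     smul (ksgn (deg B b - 1)) (lext (\<lambda>v. ?R v q) (cobar_word w))) (D (b, []))"
    unfolding lext_lext lext_gen
  proof (rule lext_cong)
    fix q assume "q \<in> Poly_Mapping.keys (D (b, []))"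
    then have "deg M q = deg B b - 1"
      using D_piece[of "(b, [])"] b by (auto simp: piece_iff)
    then show "D (fst q, snd q @ w) = lext (?R w) (D q) + smul (ksgn (deg B b - 1)) (lext
        (\<lambda>v. ?R v q) (cobar_word w))"
      using D_append[of "fst q" "snd q" w] by simp
  qed
  also have "\<dots> = lext (?R w) (lext D (D (b, []))) - smul ?s (lext (\<lambda>v. lext (?R v) (D (b, [])))
      (cobar_word w))"
    by (simp add: lext_add_fun lext_lext lext_smul_fun lext_swap[of _ "cobar_word w"]
        uminus_smul_ksgn)
      (simp add: ksgn_def)
  finally have 1: "lext D (lext (?R w) (D (b, [])))
      = - smul ?s (lext (\<lambda>v. lext (?R v) (D (b, []))) (cobar_word w))"
    by (simp add: D_D_Nil)
  have "lext D (lext (\<lambda>v'. gen (b, v')) (cobar_word w))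
      = lext (\<lambda>v. lext (?R v) (D (b, []))) (cobar_word w) +
     smul ?s (lext (\<lambda>v'. gen (b, v')) (lext cobar_word (cobar_word w)))"
    unfolding lext_lext lext_gen lext_smul_fun[symmetric] lext_add_fun[symmetric]
    by (rule lext_cong) (simp only: D[symmetric] lext_smul_fun)
  then show ?thesis unfolding z D[of w] by (simp add: lext_add lext_smul 1
      cobar_word_cobar_word[OF w])
qed

section \<open>Associativity and the Leibniz rule\<close>

lemma LW_Nil: "LW [] = gen"
  by (simp add: fun_eq_iff)

lemma LW_append: "LW (v @ w) z = lext (LW v) (LW w z)"
  by (induction v) (simp_all add: lext_lext)

text \<open>The product of \<open>y\<close> and \<open>z\<close>, with all of \<open>z\<close> as
  argument of the operators. The product \<open>twisted_mul\<close> instead moves the word of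
  \<open>y\<close> past the factor of \<open>z\<close> in \<open>B\<close> and then appends the word
  of \<open>z\<close>; \<open>twisted_mul_gen\<close> identifies the two.\<close>

definition Lmul :: "'y \<times> 'x list \<Rightarrow> 'y \<times> 'x list \<Rightarrow> ('y \<times> 'x list \<Rightarrow>\<^sub>0 'r)" where
  "Lmul y z = lext (LB (fst y)) (LW (snd y) z)"

lemma Lmul_piece: "z \<in> gens M \<Longrightarrow> Lmul y z \<in> piece M (deg M y + deg M z)"
  unfolding Lmul_def
proof (rule piece_lext)
  fix q assume z: "z \<in> gens M" and "q \<in> Poly_Mapping.keys (LW (snd y) z)"
  then have "q \<in> gens M \<and> deg M q = wdeg (snd y) + deg M z"
    using LW_piece[OF z, of "snd y"] by (auto simp: piece_iff)
  then show "LB (fst y) q \<in> piece M (deg M y + deg M z)"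
    using LB_piece[of q "fst y"] by (simp add: add.assoc)
qed

lemma Lmul_LB: "lext (\<lambda>u. Lmul u x) (LB b z) = lext (LB b) (Lmul z x)"
proof -
  have "lext (\<lambda>u. Lmul u x) (LB b z) = lext (\<lambda>q. lext (\<lambda>c. LB c q) (mB b (fst z))) (LW (snd z) x)"
    by (simp add: LB_def[of b] lext_lext Lmul_def) (rule lext_swap)
  then show ?thesis by (simp add: LB_LB[symmetric] Lmul_def lext_lext)
qed

text \<open>The terms of \<open>LH a z\<close> are already in normal form; multiplying
  \<open>x\<close> by them gives the right side of \<open>LH_LB\<close>, read from right to
  left.\<close>

lemma Lmul_LH:
  assumes a: "0 < deg H a"
  shows "lext (\<lambda>u. Lmul u x) (LH a z) = lext (LH a) (Lmul z x)"
proof -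
  have "lext (\<lambda>u. Lmul u x) (LH a z) = lext (\<lambda>p. smul (ksgn (eps a (fst p)))
     (lext (\<lambda>h. lext (\<lambda>q. lext (LB (fst p)) (LH h q)) (LW (snd z) x)) (mH a (snd p)))) (\<nu> (fst z))"
    using a by (simp add: LH_def[of a] lext_lext lext_smul Lmul_def)
  also have "\<dots> = lext (\<lambda>q. lext (LH a) (LB (fst z) q)) (LW (snd z) x)"
    by (simp only: LH_LB[OF a] lext_swap[of _ "LW _ _"] lext_smul_fun[symmetric])
  finally show ?thesis by (simp add: Lmul_def lext_lext)
qed

lemma Lmul_LW:
  "w \<in> lists (posgens H) \<Longrightarrow> lext (\<lambda>u. Lmul u x) (LW w z) = lext (LW w) (Lmul z x)"
proof (induction w)
  case (Cons a w)
  then have a: "0 < deg H a" by (simp add: posgens_def)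
  have "lext (\<lambda>u. Lmul u x) (LW (a # w) z) = lext (LH a) (lext (\<lambda>q. Lmul q x) (LW w z))"
    by (simp add: lext_lext Lmul_LH[OF a])
  with Cons show ?case by (simp add: lext_lext)
qed (simp add: LW_Nil)

text \<open>\<open>y\<close> acts as an operator of \<open>B\<close> after a word of letters, and
  each of these passes from \<open>z\<close> to the product of \<open>z\<close> and \<open>x\<close>
  by \<open>Lmul_LB\<close> and \<open>Lmul_LW\<close>.\<close>

lemma Lmul_assoc:
  assumes "y \<in> gens M"
  shows "lext (\<lambda>u. Lmul u x) (Lmul y z) = lext (Lmul y) (Lmul z x)"
proof -
  have "lext (\<lambda>u. Lmul u x) (Lmul y z) = lext (LB (fst y)) (lext (\<lambda>q. Lmul q x) (LW (snd y) z))"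
    by (simp add: Lmul_def[of y] lext_lext Lmul_LB)
  also have "lext (\<lambda>q. Lmul q x) (LW (snd y) z) = lext (LW (snd y)) (Lmul z x)"
    using assms by (intro Lmul_LW) auto
  finally show ?thesis by (simp add: Lmul_def[abs_def] lext_lext)
qed

lemma D_LW:
  "w \<in> lists (posgens H) \<Longrightarrow> lext D (LW w x) =
    lext (\<lambda>v. LW v x) (cobar_word w) + smul (ksgn (wdeg w)) (lext (LW w) (D x))"
proof (induction w)
  case (Cons a w)
  then have a: "a \<in> gens H" "0 < deg H a" by (simp_all add: posgens_def)
  let ?s = "ksgn (deg H a - 1) :: 'r"
  have "lext D (LW (a # w) x) = lext (\<lambda>q. lext (\<lambda>v. LW v q) (cobar_letter a)) (LW w x) + smul ?s
      (lext (LH a) (lext D (LW w x)))"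
    by (simp add: lext_lext D_LH[OF a] linear_simps)
  also have "lext (\<lambda>q. lext (\<lambda>v. LW v q) (cobar_letter a)) (LW w x)
      = lext (\<lambda>v. LW v x) (conc (cobar_letter a) (gen w))"
    by (simp add: lext_conc LW_append lext_swap[of _ "cobar_letter _"])
  also have "lext D (LW w x) = lext (\<lambda>v. LW v x) (cobar_word w) + smul (ksgn (wdeg w)) (lext
      (LW w) (D x))"
    using Cons by simp
  finally show ?case by (simp add: linear_simps lext_conc)
qed (simp add: LW_Nil)

text \<open>\<open>D_LB\<close> treats the factor of \<open>y\<close> in \<open>B\<close> and
  \<open>D_LW\<close> its word. The composites of \<open>LB\<close> and \<open>LH\<close> left over
  by \<open>D_LB\<close> are left multiplication by the twisting term of \<open>D y\<close>.\<close>

lemma D_Lmul: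
  assumes "y \<in> gens M"
  shows "lext D (Lmul y x) = lext (\<lambda>u. Lmul u x) (D y) + smul (ksgn (deg M y)) (lext (Lmul y)
      (D x))"
proof -
  obtain b w where y: "y = (b, w)" and b: "b \<in> gens B" and w: "w \<in> lists (posgens H)"
    using assms by (cases y) auto
  have "lext D (Lmul y x) = lext (\<lambda>u. lext (LB u) (LW w x)) (dB b) +
     smul (ksgn (deg B b)) (lext (LB b) (lext D (LW w x))) -
     lext (\<lambda>p. smul (ksgn (deg B (fst p))) (lext (LB (fst p)) (lext (LH (snd p)) (LW w x)))) (\<nu> b)"
    by (simp add: y Lmul_def lext_lext D_LB[OF b] lext_add_fun lext_diff_fun lext_smul_fun
        lext_swap[of _ "dB _"] lext_swap[of _ "\<nu> _"])
  also have "\<dots> = lext (\<lambda>u. Lmul u x) (D y) + smul (ksgn (deg M y)) (lext (Lmul y) (D x))"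
  proof -
    \<comment> \<open>Putting the desuspension of \<open>h\<close> in front of a word acts as
      \<open>LH h\<close>; in degree 0 both are zero.\<close>
    have "lext (\<lambda>v. lext (LB c) (LW (v @ w) x)) (t h) = lext (LB c) (lext (LH h) (LW w x))" for c h
      by (simp add: t_def LH_nonpos)
    then show ?thesis
      by (simp add: y D_LW[OF w] D_def[of "(b, w)"] Dtwist_def Lmul_def[abs_def] linear_simps)
  qed
  finally show ?thesis .
qed

section \<open>The unit\<close>

lemma mB_unit_left: "x \<in> gens B \<Longrightarrow> lext (\<lambda>u. lext k (mB u x)) (unt B) = k x"
  using bmul_unit_left[OF chain_algebra_B, of x, THEN arg_cong, of "lext k"]
      by (simp add: linear_simps)

lemma mB_unit_right: "x \<in> gens B \<Longrightarrow> lext (\<lambda>u. lext k (mB x u)) (unt B) = k x"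
  using bmul_unit_right[OF chain_algebra_B, of x, THEN arg_cong, of "lext k"]
      by (simp add: linear_simps)

lemma coact_unt_lext:
  "lext (\<lambda>u. lext (\<lambda>p. K (fst p) (snd p)) (\<nu> u)) (unt B) = lext (\<lambda>u. lext (K u) one) (unt B)"
  using coact_unt[THEN arg_cong, of "lext (\<lambda>p. K (fst p) (snd p))"]
      by (simp add: lext_lext lext_tens)

lemma keys_unt: "u \<in> Poly_Mapping.keys (unt B) \<Longrightarrow> u \<in> gens B \<and> deg B u = 0"
  using unt_piece[OF chain_algebra_B] by (auto simp: piece_iff)

text \<open>The coaction sends the unit to \<open>1 \<otimes> 1\<close>, and \<open>t\<close> kills
  the second factor.\<close>

lemma D_unt: "lext (\<lambda>u. D (u, [])) (unt B) = 0"
proof -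
  let ?K = "\<lambda>x y. smul (ksgn (deg B x)) (lext (\<lambda>v. gen (x, v)) (t y)) :: ('y \<times> 'x list \<Rightarrow>\<^sub>0 'r)"
  have "lext (\<lambda>u. D (u, [])) (unt B) = lext (\<lambda>u. gen (u, [])) (lext dB (unt B)) -
     lext (\<lambda>u. lext (\<lambda>p. ?K (fst p) (snd p)) (\<nu> u)) (unt B)"
    by (simp add: D_def Dtwist_def linear_simps)
  also have "\<dots> = - lext (\<lambda>u. lext (?K u) one) (unt B)"
    by (simp add: bdif_unt[OF chain_algebra_B] coact_unt_lext[of ?K])
  also have "lext (\<lambda>u. lext (?K u) one) (unt B) = lext (\<lambda>u. lext (\<lambda>y. 0) one) (unt B)"
    by (intro lext_cong) (auto dest!: keys_one simp: t_def)
  finally show ?thesis by simp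
qed

text \<open>Since \<nu>(1) is \<open>1 \<otimes> 1\<close>, moving a letter past the unit of
  \<open>B\<close> multiplies it by the unit of \<open>H\<close>; the sign is trivial because the
  unit has degree 0.\<close>

lemma LH_unt:
  assumes a: "a \<in> posgens H"
  shows "lext (\<lambda>u. LH a (u, w)) (unt B) = lext (\<lambda>u. gen (u, a # w)) (unt B)"
proof -
  let ?K = "\<lambda>x y. smul (ksgn (eps a x)) (lext (\<lambda>h. gen (x, h # w)) (mH a y)) ::
      ('y \<times> 'x list \<Rightarrow>\<^sub>0 'r)"
  have "lext (\<lambda>u. LH a (u, w)) (unt B) = lext (\<lambda>u. lext (\<lambda>p. ?K (fst p) (snd p)) (\<nu> u)) (unt B)"
    using a by (simp add: LH_def posgens_def)
  also have "\<dots> = lext (\<lambda>u. lext (?K u) one) (unt B)"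
    by (rule coact_unt_lext)
  also have "\<dots> = lext (\<lambda>u. gen (u, a # w)) (unt B)"
  proof (rule lext_cong)
    fix u assume "u \<in> Poly_Mapping.keys (unt B)"
    then have "lext (?K u) one = lext (\<lambda>y. lext (\<lambda>h. gen (u, h # w)) (mH a y)) one"
      using keys_unt[of u] by (simp add: eps_def)
    then show "lext (?K u) one = gen (u, a # w)"
      using a by (simp add: mH_one_right posgens_def)
  qed
  finally show ?thesis .
qed

lemma LW_unt:
  "w \<in> lists (posgens H) \<Longrightarrow> lext (\<lambda>u. LW w (u, [])) (unt B) = lext (\<lambda>u. gen (u, w)) (unt B)"
proof (induction w)
  case (Cons a w)
  have "lext (\<lambda>u. LW (a # w) (u, [])) (unt B) = lext (LH a) (lext (\<lambda>u. LW w (u, [])) (unt B))"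
    by (simp add: lext_lext)
  with Cons show ?case by (simp add: lext_lext LH_unt)
qed simp

lemma Lmul_unt_left: "z \<in> gens M \<Longrightarrow> lext (\<lambda>u. Lmul (u, []) z) (unt B) = gen z"
  by (auto simp: Lmul_def LB_def mB_unit_left)

lemma Lmul_unt_right:
  assumes "y \<in> gens M"
  shows "lext (\<lambda>u. Lmul y (u, [])) (unt B) = gen y"
proof -
  have "lext (\<lambda>u. Lmul y (u, [])) (unt B) = lext (LB (fst y)) (lext (\<lambda>u. LW (snd y) (u, []))
      (unt B))"
    by (simp add: Lmul_def lext_lext)
  also have "lext (\<lambda>u. LW (snd y) (u, [])) (unt B) = lext (\<lambda>u. gen (u, snd y)) (unt B)"
    using assms by (intro LW_unt) auto
  also have "lext (LB (fst y)) \<dots> = gen y"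
    using assms by (auto simp: lext_lext LB_def mB_unit_right)
  finally show ?thesis .
qed

section \<open>Agreement of the operators with the defining formulas\<close>

lemma twisted_simps [simp]:
  "gens (twisted P) = gens M" "deg (twisted P) = deg M" "dif (twisted P) = twisted_dif P"
  "mul (twisted P) = twisted_mul P" "unt (twisted P) = tens (unt B) (gen [])"
  by (simp_all add: twisted_def del: gtensor_simps)

lemma piece_twisted [simp]: "piece (twisted P) n = piece M n"
  and fre_twisted [simp]: "fre (twisted P) = fre M"
  by (auto simp: piece_def fre_def)

lemma desusp_eq: "desusp H = lext t"
  by (simp add: desusp_def t_def[abs_def])

lemma dif_gen: "x \<in> gens H \<Longrightarrow> dif H (gen x) = dH x"
  by (simp add: bdif_def onbasis_def)

lemma comul_gen: "x \<in> gens H \<Longrightarrow> comul H (gen x) = \<Delta> x"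
  by (simp add: bcomul_def onbasis_def)

lemma lext_one_eq_0: "(\<And>y. deg H y = 0 \<Longrightarrow> K y = 0) \<Longrightarrow> lext K one = 0"
  using lext_cong[of one K "\<lambda>x. 0"] keys_one by simp

text \<open>The two terms subtracted in \<open>redcomul\<close> have a factor of degree 0, which
  desuspension kills.\<close>

lemma cobar_dif_letter_eq:
  assumes "x \<in> gens H"
  shows "cobar_dif_letter H x = cobar_letter x"
  using assms
  by (simp add: cobar_dif_letter_def cobar_letter_def desusp_eq redcomul_def dif_gen comul_gen
      lext_diff lext_tens case_prod_unfold)
    (simp add: lext_one_eq_0 t_def)

lemma cobar_dif_word_eq: "w \<in> lists (posgens H) \<Longrightarrow> cobar_dif_word H w = cobar_word w"
  by (induction w) (auto simp: cobar_dif_letter_eq posgens_def)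

lemma dif_cobar: "v \<in> fre (cobar H) \<Longrightarrow> dif (cobar H) v = lext cobar_word v"
  unfolding cobar_def by (simp, rule lext_cong) (auto simp: fre_iff cobar_dif_word_eq)

lemma dif_twisted: "z \<in> fre M \<Longrightarrow> twisted_dif P z = lext D z"
  unfolding twisted_dif_def
proof (rule lext_cong)
  fix q assume "z \<in> fre M" "q \<in> Poly_Mapping.keys z"
  then have b: "fst q \<in> gens B" and w: "snd q \<in> lists (posgens H)"
    by (auto simp: fre_iff mem_Times_iff)
  have "gen (snd q) \<in> fre (cobar H)" using w by (simp add: fre_gen)
  then have "dif (cobar H) (gen (snd q)) = cobar_word (snd q)"
    using dif_cobar by fastforce
  moreover have "dif B (gen (fst q)) = dB (fst q)" using b by (simp add: bdif_def onbasis_def)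
  ultimately show "(\<lambda>(b, w). tens (dif B (gen b)) (gen w) + smul (ksgn (deg B b)) (tens (gen b)
      (dif (cobar H) (gen w))) -
     lext (\<lambda>(b', h). smul (ksgn (deg B b')) (tens (gen b') (conc (desusp H (gen h)) (gen w))))
         (coact P (gen b))) q = D q"
    using b by (simp add: case_prod_unfold D_def Dtwist_def coact_gen desusp_eq tens_def
        linear_simps lext_conc)
qed

text \<open>For a letter \<open>a\<close> every term of \<open>a h\<close> has positive degree, so
  the desuspension in \<open>left_letter\<close> drops nothing.\<close>

lemma left_letter_eq:
  assumes "a \<in> posgens H" "z \<in> fre M"
  shows "left_letter P a z = lext (LH a) z"
  unfolding left_letter_def
proof (rule lext_cong)
  fix q assume "q \<in> Poly_Mapping.keys z"
  then have b: "fst q \<in> gens B" using assms by (auto simp: fre_iff mem_Times_iff)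
  have a: "a \<in> gens H" "0 < deg H a" using assms by (auto simp: posgens_def)
  have "lext (\<lambda>p. smul (ksgn ((deg H a - 1) * deg B (fst p)))
         (tens (gen (fst p)) (conc (lext t (hmul H (gen (a, snd p)))) (gen (snd q))))) (\<nu> (fst q))
             = LH a q"
    unfolding LH_def if_P[OF a(2)]
  proof (intro lext_cong smul_ksgn_cong)
    fix p assume p: "p \<in> Poly_Mapping.keys (\<nu> (fst q))"
    have "hmul H (gen (a, snd p)) = mH a (snd p)"
      using keys_coact[OF p] a by (simp add: bmul_def onbasis_def)
    moreover have "lext t (mH a (snd p)) = lext (\<lambda>h. gen [h]) (mH a (snd p))"
    proof (rule lext_cong)
      fix h assume h: "h \<in> Poly_Mapping.keys (mH a (snd p))"
      show "t h = gen [h]"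
        using keys_mH[OF h] a deg_nonneg[of "snd p"] keys_coact[OF p] by (simp add: t_def)
    qed
    ultimately show "tens (gen (fst p)) (conc (lext t (hmul H (gen (a, snd p)))) (gen (snd q))) =
        lext (\<lambda>h. gen (fst p, h # snd q)) (mH a (snd p))"
      by (simp add: tens_def linear_simps lext_conc)
  qed (simp add: eps_def)
  then show "(\<lambda>(b, w). lext (\<lambda>(b', h). smul (ksgn ((deg H a - 1) * deg B b'))
         (tens (gen b') (conc (desusp H (hmul H (gen (a, h)))) (gen w)))) (coact P (gen b))) q
             = LH a q"
    using b by (simp add: case_prod_unfold coact_gen desusp_eq)
qed

lemma left_word_eq: "w \<in> lists (posgens H) \<Longrightarrow> b \<in> gens B \<Longrightarrow> left_word P w b = LW w (b, [])"
proof (induction w)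
  case (Cons a w)
  have "LW w (b, []) \<in> fre M"
    using LW_piece[of "(b, [])" w] Cons by (auto intro: piece_subset_fre)
  then show ?case using Cons by (simp add: left_letter_eq)
qed simp

lemma right_act_eq: "right_act z v = lext (\<lambda>q. lext (\<lambda>v'. gen (fst q, snd q @ v')) v) z"
  by (simp add: right_act_def case_prod_unfold tens_def linear_simps lext_conc)

lemma LB_append: "LB b (c, v @ w) = lext (\<lambda>q. gen (fst q, snd q @ w)) (LB b (c, v))"
  by (simp add: LB_def linear_simps)

lemma LH_append: "LH a (c, v @ w) = lext (\<lambda>q. gen (fst q, snd q @ w)) (LH a (c, v))"
  by (simp add: LH_def linear_simps)

text \<open>Left operators never touch the end of a word, so they commute with the right action.
  Hence it does not matter whether the word of the second factor is appended before or after the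
  multiplication.\<close>

lemma LW_append_right: "LW u (c, v @ w) = lext (\<lambda>q. gen (fst q, snd q @ w)) (LW u (c, v))"
proof (induction u)
  case (Cons a u)
  show ?case
    by (simp add: Cons lext_lext LH_append)
qed simp

lemma twisted_mul_gen:
  assumes "y \<in> gens M" "z \<in> gens M"
  shows "twisted_mul P (gen (y, z)) = Lmul y z"
proof -
  have y: "fst y \<in> gens B" "snd y \<in> lists (posgens H)" and z: "fst z \<in> gens B" "snd z \<in> lists
      (posgens H)"
    using assms by (simp_all add: mem_Times_iff)
  have "lext (\<lambda>q. tens (mul B (gen (fst y, fst q))) (gen (snd q))) (left_word P (snd y) (fst z)) =
     lext (LB (fst y)) (LW (snd y) (fst z, []))"
    unfolding left_word_eq[OF y(2) z(1)]
  proof (rule lext_cong)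
    fix q assume "q \<in> Poly_Mapping.keys (LW (snd y) (fst z, []))"
    then have "fst q \<in> gens B" using LW_piece[of "(fst z, [])" "snd y"] z
        by (auto simp: piece_iff mem_Times_iff)
    then show "tens (mul B (gen (fst y, fst q))) (gen (snd q)) = LB (fst y) q"
      using y by (simp add: LB_def bmul_def onbasis_def tens_def)
  qed
  moreover have "LB (fst y) (fst q, snd q @ snd z)
      = lext (\<lambda>q. gen (fst q, snd q @ snd z)) (LB (fst y) q)" for q
    using LB_append[of "fst y" "fst q" "snd q" "snd z"] by simp
  then have "Lmul y z = lext (\<lambda>q. gen (fst q, snd q @ snd z)) (lext (LB (fst y)) (LW (snd y)
      (fst z, [])))"
    using LW_append_right[of "snd y" "fst z" "[]" "snd z"]
    by (simp add: Lmul_def lext_lext)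
  ultimately show ?thesis
    by (simp add: twisted_mul_def case_prod_unfold right_act_eq)
qed

lemma twisted_mul_eq:
  assumes "v \<in> fre (gtensor (twisted P) (twisted P))"
  shows "twisted_mul P v = lext (\<lambda>p. Lmul (fst p) (snd p)) v"
proof -
  have "twisted_mul P v = lext (\<lambda>p. twisted_mul P (gen p)) v"
    unfolding twisted_mul_def lext_gen ..
  also have "\<dots> = lext (\<lambda>p. Lmul (fst p) (snd p)) v"
  proof (rule lext_cong)
    fix p assume "p \<in> Poly_Mapping.keys v"
    then have "fst p \<in> gens M" "snd p \<in> gens M"
      using assms by (auto simp: fre_iff simp del: gtensor_simps(1)) (simp_all add: mem_Times_iff)
    then show "twisted_mul P (gen p) = Lmul (fst p) (snd p)"
      using twisted_mul_gen[of "fst p" "snd p"] by simp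
  qed
  finally show ?thesis .
qed

lemma tens_fre: "u \<in> fre M \<Longrightarrow> v \<in> fre M \<Longrightarrow> tens u v \<in> fre (gtensor (twisted P) (twisted P))"
  by (erule fre_tens, assumption, simp)

lemma twisted_mul_tens:
  assumes "u \<in> fre M" "v \<in> fre M"
  shows "twisted_mul P (tens u v) = lext (\<lambda>y. lext (Lmul y) v) u"
  using tens_fre[OF assms] by (simp add: twisted_mul_eq lext_tens)

theorem chain_algebra_twisted: "chain_algebra (twisted P)"
proof -
  have D_fre: "lext D z \<in> fre M" if "z \<in> fre M" for z :: "'y \<times> 'x list \<Rightarrow>\<^sub>0 'r"
    using that D_piece piece_subset_fre unfolding fre_iff[of z] by (blast intro: fre_lext)
  have cx: "chain_complex (twisted P)"
    unfolding chain_complex_def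
  proof (intro conjI ballI)
    show "graded_map (- 1) (twisted P) (twisted P) (dif (twisted P))"
      by (rule graded_mapI[of _ _ D]) (simp_all add: dif_twisted D_piece del: gtensor_simps)
    fix z :: "'y \<times> 'x list \<Rightarrow>\<^sub>0 'r" assume z: "z \<in> fre (twisted P)"
    have "lext (\<lambda>q. lext D (D q)) z = lext (\<lambda>q. 0) z"
      by (rule lext_cong) (use z in \<open>simp add: D_D fre_iff\<close>)
    with z show "dif (twisted P) (dif (twisted P) z) = 0"
      by (simp add: dif_twisted D_fre lext_lext)
  qed
  have mul: "chain_map (tensor_cx (twisted P) (twisted P)) (twisted P) (mul (twisted P))"
    unfolding chain_map_def
  proof (intro conjI ballI)
    have f: "fre (tensor_cx (twisted P) (twisted P)) = fre (gtensor (twisted P) (twisted P))"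
      by (rule fre_cong) simp
    show "graded_map 0 (tensor_cx (twisted P) (twisted P)) (twisted P) (mul (twisted P))"
    proof (rule graded_mapI[of _ _ "\<lambda>p. Lmul (fst p) (snd p)"])
      fix p assume p: "p \<in> gens (tensor_cx (twisted P) (twisted P))"
      then have "snd p \<in> gens M" by (simp add: mem_Times_iff)
      from Lmul_piece[OF this, of "fst p"]
      show "Lmul (fst p) (snd p) \<in> piece (twisted P) (deg (tensor_cx (twisted P) (twisted P)) p
          + 0)"
        by (simp del: gtensor_simps)
    qed (simp add: f twisted_mul_eq)
    fix v :: "('y \<times> 'x list) \<times> ('y \<times> 'x list) \<Rightarrow>\<^sub>0 'r" assume v: "v \<in> fre (tensor_cx (twisted P)
        (twisted P))"
    have gM: "fst p \<in> gens M \<and> snd p \<in> gens M" if "p \<in> Poly_Mapping.keys v" for p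
      using that v unfolding fre_iff by (simp add: mem_Times_iff)
    have DM: "D q \<in> fre M" if "q \<in> gens M" for q
      using D_piece[OF that] by (rule piece_subset_fre)
    have td: "tensor_dif (twisted P) (twisted P) v = lext (\<lambda>p. tens (D (fst p)) (gen (snd p)) +
        smul (ksgn (deg M (fst p))) (tens (gen (fst p)) (D (snd p)))) v"
      unfolding tensor_dif_def
      by (rule lext_cong) (use gM in \<open>simp add: case_prod_unfold dif_twisted fre_gen del:
          gtensor_simps\<close>)
    have "tensor_dif (twisted P) (twisted P) v \<in> fre (gtensor (twisted P) (twisted P))"
      unfolding td
      by (intro fre_lext fre_add fre_smul tens_fre) (use gM DM
          in \<open>simp_all add: fre_gen del: gtensor_simps\<close>)
    then have "mul (twisted P) (dif (tensor_cx (twisted P) (twisted P)) v) =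
        lext (\<lambda>p. Lmul (fst p) (snd p)) (tensor_dif (twisted P) (twisted P) v)"
      by (simp add: twisted_mul_eq)
    also have "\<dots> = lext (\<lambda>p. lext (\<lambda>u. Lmul u (snd p)) (D (fst p)) + smul (ksgn (deg M (fst p)))
        (lext (Lmul (fst p)) (D (snd p)))) v"
      unfolding td by (simp add: linear_simps lext_tens del: gtensor_simps)
    also have "\<dots> = lext (\<lambda>p. lext D (Lmul (fst p) (snd p))) v"
      by (rule lext_cong) (use gM in \<open>simp add: D_Lmul del: gtensor_simps\<close>)
    also have "\<dots> = dif (twisted P) (mul (twisted P) v)"
    proof -
      have "lext (\<lambda>p. Lmul (fst p) (snd p)) v \<in> fre M"
        by (rule fre_lext, rule piece_subset_fre, rule Lmul_piece, drule gM, erule conjunct2)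
      moreover have "twisted_mul P v = lext (\<lambda>p. Lmul (fst p) (snd p)) v"
        using v unfolding f by (rule twisted_mul_eq)
      ultimately show ?thesis by (simp only: twisted_simps dif_twisted lext_lext)
    qed
    finally show "mul (twisted P) (dif (tensor_cx (twisted P) (twisted P)) v)
        = dif (twisted P) (mul (twisted P) v)" .
  qed
  have u: "unt (twisted P) = lext (\<lambda>u. gen (u, [])) (unt B)"
    by (simp add: tens_def)
  have uM: "unt (twisted P) \<in> piece M 0"
    unfolding u by (intro piece_lext piece_gen) (auto dest!: keys_unt)
  note uf = piece_subset_fre[OF uM]
  have Lmul_fre: "lext (\<lambda>y. lext (Lmul y) v) u \<in> fre M" if "v \<in> fre M" for u v :: "'y \<times> 'x list
      \<Rightarrow>\<^sub>0 'r"
    by (intro fre_lext, rule piece_subset_fre, rule Lmul_piece) (use that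
        in \<open>simp add: fre_iff del: gtensor_simps\<close>)
  show ?thesis
    unfolding chain_algebra_def
  proof (intro conjI ballI cx mul)
    show "unt (twisted P) \<in> piece (twisted P) 0" using uM by simp
    show "dif (twisted P) (unt (twisted P)) = 0"
      using uf D_unt unfolding u by (simp add: dif_twisted lext_lext)
  next
    fix a :: "'y \<times> 'x list \<Rightarrow>\<^sub>0 'r" assume a: "a \<in> fre (twisted P)"
    then have a': "a \<in> fre M" by simp
    have "mul (twisted P) (tens (unt (twisted P)) a) = lext (\<lambda>u. lext (Lmul (u, [])) a) (unt B)"
      using twisted_mul_tens[OF uf a'] unfolding u by (simp add: lext_lext)
    also have "\<dots> = lext (\<lambda>q. lext (\<lambda>u. Lmul (u, []) q) (unt B)) a" by (rule lext_swap)
    also have "\<dots> = lext gen a"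
      by (rule lext_cong) (use a' in \<open>simp add: Lmul_unt_left fre_iff\<close>)
    finally show "mul (twisted P) (tens (unt (twisted P)) a) = a" by simp
    have "mul (twisted P) (tens a (unt (twisted P)))
        = lext (\<lambda>q. lext (\<lambda>u. Lmul q (u, [])) (unt B)) a"
      using twisted_mul_tens[OF a' uf] unfolding u by (simp add: lext_lext)
    also have "\<dots> = lext gen a"
      by (rule lext_cong) (use a' in \<open>simp add: Lmul_unt_right fre_iff\<close>)
    finally show "mul (twisted P) (tens a (unt (twisted P))) = a" by simp
  next
    fix a b c :: "'y \<times> 'x list \<Rightarrow>\<^sub>0 'r" assume "a \<in> fre (twisted P)" "b \<in> fre (twisted P)" "c \<in> fre
        (twisted P)"
    then have m: "a \<in> fre M" "b \<in> fre M" "c \<in> fre M" by simp_all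
    have "mul (twisted P) (tens (mul (twisted P) (tens a b)) c) =
      lext (\<lambda>y. lext (\<lambda>z. lext (\<lambda>x. lext (\<lambda>u. Lmul u x) (Lmul y z)) c) b) a"
      using m by (simp add: twisted_mul_tens Lmul_fre lext_lext) (simp add: lext_swap[of _ c])
    also have "\<dots> = lext (\<lambda>y. lext (\<lambda>z. lext (\<lambda>x. lext (Lmul y) (Lmul z x)) c) b) a"
      by (intro lext_cong) (use m in \<open>simp add: Lmul_assoc fre_iff\<close>)
    also have "\<dots> = mul (twisted P) (tens a (mul (twisted P) (tens b c)))"
      using m by (simp add: twisted_mul_tens Lmul_fre lext_lext)
    finally show "mul (twisted P) (tens (mul (twisted P) (tens a b)) c) =
       mul (twisted P) (tens a (mul (twisted P) (tens b c)))" .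
  qed
qed

end

section \<open>Homology of chain algebras\<close>

lemma UN_const: "U \<noteq> {} \<Longrightarrow> (\<And>u. u \<in> U \<Longrightarrow> F u = c) \<Longrightarrow> (\<Union>u\<in>U. F u) = c"
  by auto

lemma tens_zero [simp]: "tens 0 v = 0" "tens v 0 = 0"
  by (simp_all add: tens_def)

lemma UN_UN_const:
  "U \<noteq> {} \<Longrightarrow> V \<noteq> {} \<Longrightarrow> (\<And>u v. u \<in> U \<Longrightarrow> v \<in> V \<Longrightarrow> F u v = c) \<Longrightarrow> (\<Union>u\<in>U. \<Union>v\<in>V. F u v) = c"
  by (intro UN_const)

lemma homology_simps:
  "gcar (homology A) n = hclass A n ` cycles A n"
  "gzero (homology A) n = hclass A n 0"
  "gone (homology A) = hclass A 0 (unt A)"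
  by (simp_all add: homology_def)

context
  fixes A :: "('x, 'r::comm_ring_1, 'b) chain_alg_scheme"
  assumes A: "chain_algebra A"
begin

lemma chain_complex_A: "chain_complex A"
  using A by (rule chain_algebra_complex)

lemma graded_dif: "graded_map (- 1) A A (dif A)"
  using chain_complex_A by (simp add: chain_complex_def)

lemma dif_linear:
  "u \<in> fre A \<Longrightarrow> v \<in> fre A \<Longrightarrow> dif A (u + v) = dif A u + dif A v"
  "u \<in> fre A \<Longrightarrow> v \<in> fre A \<Longrightarrow> dif A (u - v) = dif A u - dif A v"
  "u \<in> fre A \<Longrightarrow> dif A (smul c u) = smul c (dif A u)"
  by (simp_all add: dif_lext[OF chain_complex_A] fre_add fre_diff fre_smul linear_simps)

lemma dif_piece: "u \<in> piece A n \<Longrightarrow> dif A u \<in> piece A (n - 1)"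
  using graded_dif unfolding graded_map_def by force

lemma dif_dif: "u \<in> fre A \<Longrightarrow> dif A (dif A u) = 0"
  using chain_complex_A by (simp add: chain_complex_def)

lemma mul_linear:
  assumes "u \<in> fre A" "u' \<in> fre A" "v \<in> fre A"
  shows "mul A (tens (u + u') v) = mul A (tens u v) + mul A (tens u' v)"
    and "mul A (tens v (u + u')) = mul A (tens v u) + mul A (tens v u')"
  using assms by (simp_all add: mul_lext[OF A] fre_add linear_simps)

lemma mul_smul:
  assumes "u \<in> fre A" "v \<in> fre A"
  shows "mul A (tens (smul c u) v) = smul c (mul A (tens u v))"
    and "mul A (tens u (smul c v)) = smul c (mul A (tens u v))"
  using assms by (simp_all add: mul_lext[OF A] fre_smul linear_simps)

lemma mul_zero: "mul A 0 = 0"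
  using mul_lext[OF A, of 0 0] by simp

lemma mul_piece:
  assumes "u \<in> piece A m" "v \<in> piece A n"
  shows "mul A (tens u v) \<in> piece A (m + n)"
proof -
  have "bmul A x y \<in> piece A (m + n)" if "x \<in> Poly_Mapping.keys u" "y \<in> Poly_Mapping.keys v" for x y
    using bmul_piece[OF A, of x y] that assms by (auto simp: piece_iff)
  then show ?thesis
    using assms by (auto simp: mul_lext[OF A] piece_subset_fre intro!: piece_lext)
qed

text \<open>Homogeneity of \<open>u\<close> is what makes the sign uniform; \<open>v\<close> may be
  any element.\<close>

lemma mul_Leibniz:
  assumes u: "u \<in> piece A m" and v: "v \<in> fre A"
  shows "dif A (mul A (tens u v)) = mul A (tens (dif A u) v) + smul (ksgn m) (mul A (tens u
      (dif A v)))"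
proof -
  note uf = piece_subset_fre[OF u]
  note c = chain_complex_A
  have "dif A (mul A (tens u v)) = lext (\<lambda>x. lext (\<lambda>y. lext (bdif A) (bmul A x y)) v) u"
    using uf v by (simp add: dif_lext[OF c] mul_fre[OF A]) (simp add: mul_lext[OF A] lext_lext)
  also have "\<dots> = lext (\<lambda>x. lext (\<lambda>y. lext (\<lambda>u. bmul A u y) (bdif A x) + smul (ksgn m) (lext
      (bmul A x) (bdif A y))) v) u"
    by (intro lext_cong) (use u in \<open>auto simp: bmul_Leibniz[OF A] piece_iff\<close>)
  also have "\<dots> = mul A (tens (dif A u) v) + smul (ksgn m) (mul A (tens u (dif A v)))"
    using uf v by (simp add: mul_lext[OF A] dif_fre[OF c]) (simp add: dif_lext[OF c] linear_simps
        lext_swap[of _ v])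
  finally show ?thesis .
qed

section \<open>Cycles, boundaries and classes\<close>

lemma boundaryI: "x \<in> piece A (n + 1) \<Longrightarrow> b = dif A x \<Longrightarrow> b \<in> boundaries A n"
  by (auto simp: boundaries_def)

lemma boundaries_zero: "0 \<in> boundaries A n"
  by (rule boundaryI[of 0]) (simp_all add: dif_lext[OF chain_complex_A])

lemma boundaries_add: "b \<in> boundaries A n \<Longrightarrow> c \<in> boundaries A n \<Longrightarrow> b + c \<in> boundaries A n"
  unfolding boundaries_def
  by (auto simp: dif_linear[symmetric] piece_subset_fre intro!: imageI piece_add)

lemma boundaries_diff: "b \<in> boundaries A n \<Longrightarrow> c \<in> boundaries A n \<Longrightarrow> b - c \<in> boundaries A n"
  unfolding boundaries_def
  by (auto simp: dif_linear[symmetric] piece_subset_fre intro!: imageI piece_diff)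

lemma boundaries_smul: "b \<in> boundaries A n \<Longrightarrow> smul c b \<in> boundaries A n"
  unfolding boundaries_def
  by (auto simp: dif_linear[symmetric] piece_subset_fre intro!: imageI piece_smul)

lemma boundaries_subset_cycles: "b \<in> boundaries A n \<Longrightarrow> b \<in> cycles A n"
  unfolding boundaries_def cycles_def using dif_piece[of _ "n + 1"]
  by (auto simp: dif_dif piece_subset_fre)

lemma cycles_piece: "z \<in> cycles A n \<Longrightarrow> z \<in> piece A n"
  and cycles_fre: "z \<in> cycles A n \<Longrightarrow> z \<in> fre A"
  and cycles_dif: "z \<in> cycles A n \<Longrightarrow> dif A z = 0"
  by (auto simp: cycles_def piece_subset_fre)

lemma cycles_zero: "0 \<in> cycles A n"
  and cycles_add: "y \<in> cycles A n \<Longrightarrow> z \<in> cycles A n \<Longrightarrow> y + z \<in> cycles A n"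
  and cycles_diff: "y \<in> cycles A n \<Longrightarrow> z \<in> cycles A n \<Longrightarrow> y - z \<in> cycles A n"
  and cycles_smul: "z \<in> cycles A n \<Longrightarrow> smul c z \<in> cycles A n"
  and cycles_unt: "unt A \<in> cycles A 0"
  using boundaries_subset_cycles[OF boundaries_zero] A
  by (auto simp: cycles_def dif_linear piece_subset_fre piece_add piece_diff piece_smul
      chain_algebra_def)

lemma cycles_mul:
  assumes "y \<in> cycles A m" "z \<in> cycles A n"
  shows "mul A (tens y z) \<in> cycles A (m + n)"
  using assms mul_Leibniz[OF cycles_piece[OF assms(1)] cycles_fre[OF assms(2)]]
  by (simp add: cycles_def mul_piece mul_zero)

lemma hclass_eq_iff: "hclass A n y = hclass A n z \<longleftrightarrow> y - z \<in> boundaries A n"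
proof
  assume "hclass A n y = hclass A n z"
  moreover have "y \<in> hclass A n y" using boundaries_zero
      by (auto simp: hclass_def intro!: image_eqI[of _ _ 0])
  ultimately obtain b where "b \<in> boundaries A n" "y = z + b" by (auto simp: hclass_def)
  then show "y - z \<in> boundaries A n" by simp
next
  assume d: "y - z \<in> boundaries A n"
  show "hclass A n y = hclass A n z"
  proof (intro set_eqI iffI)
    fix x assume "x \<in> hclass A n y"
    then obtain b where "b \<in> boundaries A n" "x = y + b" by (auto simp: hclass_def)
    then show "x \<in> hclass A n z"
      using boundaries_add[OF d, of b] by (auto simp: hclass_def intro!: image_eqI[of _ _ "y - z
          + b"])
  next
    fix x assume "x \<in> hclass A n z"
    then obtain b where "b \<in> boundaries A n" "x = z + b" by (auto simp: hclass_def)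
    then show "x \<in> hclass A n y"
      using boundaries_diff[OF _ d, of b] by (auto simp: hclass_def intro!: image_eqI[of _ _ "b -
          (y - z)"])
  qed
qed

lemma hclass_self: "z \<in> hclass A n z"
  using boundaries_zero by (auto simp: hclass_def intro!: image_eqI[of _ _ 0])

lemma hclass_nonempty: "hclass A n z \<noteq> {}"
  using hclass_self by blast

lemma mem_hclass: "y \<in> hclass A n z \<Longrightarrow> y - z \<in> boundaries A n"
  by (auto simp: hclass_def)

lemma mem_hclass_cycles:
  assumes "y \<in> hclass A n z" "z \<in> cycles A n"
  shows "y \<in> cycles A n"
  using cycles_add[OF assms(2) boundaries_subset_cycles[OF mem_hclass[OF assms(1)]]] by simp

text \<open>If \<open>b\<close> is the differential of \<open>x\<close>, the Leibniz rule makes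
  \<open>b z\<close> the differential of \<open>x z\<close>, because \<open>z\<close> is a
  cycle.\<close>

lemma mul_boundary_left:
  assumes "b \<in> boundaries A m" "z \<in> cycles A n"
  shows "mul A (tens b z) \<in> boundaries A (m + n)"
proof -
  obtain x where x: "x \<in> piece A (m + 1)" "b = dif A x" using assms by (auto simp: boundaries_def)
  have "mul A (tens b z) = dif A (mul A (tens x z))"
    using mul_Leibniz[OF x(1) cycles_fre[OF assms(2)]] assms x by (simp add: cycles_dif mul_zero)
  then show ?thesis
    using mul_piece[OF x(1) cycles_piece[OF assms(2)]]
        by (intro boundaryI) (simp_all add: algebra_simps)
qed

lemma mul_boundary_right:
  assumes "b \<in> boundaries A n" "z \<in> cycles A m"
  shows "mul A (tens z b) \<in> boundaries A (m + n)"
proof -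
  obtain x where x: "x \<in> piece A (n + 1)" "b = dif A x" using assms by (auto simp: boundaries_def)
  note z = cycles_piece[OF assms(2)]
  have p: "mul A (tens z x) \<in> piece A (m + n + 1)"
    using mul_piece[OF z x(1)] by (simp add: add.assoc)
  have "dif A (mul A (tens z x)) = smul (ksgn m) (mul A (tens z b))"
    using mul_Leibniz[OF z piece_subset_fre[OF x(1)]] assms x by (simp add: cycles_dif mul_zero)
  \<comment> \<open>The Leibniz sign is its own inverse, so it can be moved onto the bounding
    element.\<close>
  then have "mul A (tens z b) = dif A (smul (ksgn m) (mul A (tens z x)))"
    using p by (simp add: dif_linear piece_subset_fre) (simp add: ksgn_def)
  then show ?thesis by (rule boundaryI[OF piece_smul[OF p]])
qed

text \<open>The union defining the operation runs over nonempty sets of representatives and is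
  constant on them, so it is a single class. The scalar and the product below follow the same
  pattern.\<close>

lemma homology_add:
  "gadd (homology A) n (hclass A n y) (hclass A n z) = hclass A n (y + z)"
proof -
  have "hclass A n (u + v) = hclass A n (y + z)" if "u \<in> hclass A n y" "v \<in> hclass A n z" for u v
    using boundaries_add[OF mem_hclass[OF that(1)] mem_hclass[OF that(2)]]
    by (simp add: hclass_eq_iff algebra_simps)
  then show ?thesis
    by (simp only: homology_def gr_alg.simps) (rule UN_UN_const[OF hclass_nonempty hclass_nonempty])
qed

lemma homology_smul: "gsmul (homology A) n r (hclass A n z) = hclass A n (smul r z)"
proof -
  have "hclass A n (smul r u) = hclass A n (smul r z)" if "u \<in> hclass A n z" for u
    using boundaries_smul[OF mem_hclass[OF that], of r] by (simp add: hclass_eq_iff smul_diff)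
  then show ?thesis
    by (simp only: homology_def gr_alg.simps) (rule UN_const[OF hclass_nonempty])
qed

lemma homology_mul:
  assumes y: "y \<in> cycles A m" and z: "z \<in> cycles A n"
  shows "gmul (homology A) m n (hclass A m y) (hclass A n z) = hclass A (m + n) (mul A (tens y z))"
proof -
  have "hclass A (m + n) (mul A (tens u v)) = hclass A (m + n) (mul A (tens y z))"
    if u: "u \<in> hclass A m y" and v: "v \<in> hclass A n z" for u v
  proof -
    note bu = mem_hclass[OF u] and bv = mem_hclass[OF v]
    note cv = mem_hclass_cycles[OF v z]
    have f: "y \<in> fre A" "u - y \<in> fre A" "v - z \<in> fre A" "z \<in> fre A" "v \<in> fre A"
      using y z cv bu bv by (auto intro: cycles_fre boundaries_subset_cycles)
    \<comment> \<open>The difference of \<open>u v\<close> and \<open>y z\<close> is written as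
      \<open>(u - y) v + y (v - z)\<close>: each summand is a boundary times a cycle, in one order
      or the other.\<close>
    have "mul A (tens u v) = mul A (tens y v) + mul A (tens (u - y) v)"
      using mul_linear(1)[of y "u - y" v] f by simp
    also have "mul A (tens y v) = mul A (tens y z) + mul A (tens y (v - z))"
      using mul_linear(2)[of z "v - z" y] f by simp
    finally show ?thesis
      using boundaries_add[OF mul_boundary_right[OF bv y] mul_boundary_left[OF bu cv]]
      by (simp add: hclass_eq_iff add.assoc)
  qed
  then show ?thesis
    by (simp only: homology_def gr_alg.simps) (rule UN_UN_const[OF hclass_nonempty hclass_nonempty])
qed

lemma graded_algebra_homology: "graded_algebra (homology A)"
proof -
  note [simp] = homology_add homology_smul homology_mul homology_simps
  have ex: "\<exists>b\<in>cycles A n. hclass A n (z + b) = hclass A n 0" if "z \<in> cycles A n" for n z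
    using cycles_smul[OF that, of "- 1"] by (intro bexI[of _ "smul (- 1) z"])
        (simp_all add: smul_minus_one)
  have 1: "graded_module (homology A)"
    unfolding graded_module_def
    by (auto simp: ex cycles_zero cycles_add cycles_smul add_ac smul_add smul_add_left intro!:
        imageI)
  note c = cycles_fre
  have u: "mul A (tens (unt A) z) = z" "mul A (tens z (unt A)) = z" if "z \<in> cycles A n" for n z
    using A c[OF that] by (auto simp: chain_algebra_def)
  have a: "mul A (tens (mul A (tens x y)) z) = mul A (tens x (mul A (tens y z)))"
    if "x \<in> cycles A l" "y \<in> cycles A m" "z \<in> cycles A n" for l m n x y z
    using A c[OF that(1)] c[OF that(2)] c[OF that(3)] by (auto simp: chain_algebra_def)
  show ?thesis
    unfolding graded_algebra_def
    by (simp add: 1 u a c cycles_unt cycles_mul cycles_add cycles_smul mul_linear mul_smul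
        add.assoc[symmetric])
qed

end

section \<open>Maps induced in homology\<close>

lemma chain_algebra_map_facts:
  assumes f: "chain_algebra_map A A' f" and A: "chain_algebra A" and A': "chain_algebra A'"
  shows "u \<in> fre A \<Longrightarrow> v \<in> fre A \<Longrightarrow> f (u + v) = f u + f v"
    and "u \<in> fre A \<Longrightarrow> f (smul c u) = smul c (f u)"
    and "z \<in> cycles A n \<Longrightarrow> f z \<in> cycles A' n"
    and "b \<in> boundaries A n \<Longrightarrow> f b \<in> boundaries A' n"
    and "y \<in> fre A \<Longrightarrow> z \<in> fre A \<Longrightarrow> f (mul A (tens y z)) = mul A' (tens (f y) (f z))"
    and "f (unt A) = unt A'"
proof -
  note d = f[unfolded chain_algebra_map_def chain_map_def graded_map_def linear_map_def]
  show l: "u \<in> fre A \<Longrightarrow> v \<in> fre A \<Longrightarrow> f (u + v) = f u + f v" "u \<in> fre A \<Longrightarrow> f (smul c u) = smul c (f u)"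
     "y \<in> fre A \<Longrightarrow> z \<in> fre A \<Longrightarrow> f (mul A (tens y z)) = mul A' (tens (f y) (f z))" "f (unt A)
         = unt A'" for u v c y z
    using d by auto
  have p: "v \<in> piece A k \<Longrightarrow> f v \<in> piece A' k" for v k using d by force
  have c: "v \<in> fre A \<Longrightarrow> f (dif A v) = dif A' (f v)" for v using d by blast
  have z: "f 0 = 0" using l(2)[of 0 0] by simp
  show "f z \<in> cycles A' n" if "z \<in> cycles A n"
    using that p[of z n] c[of z] z by (auto simp: cycles_def piece_subset_fre)
  show "f b \<in> boundaries A' n" if "b \<in> boundaries A n"
    using that p c by (force simp: boundaries_def piece_subset_fre)
qed

text \<open>Two representatives differ by a boundary and \<open>f\<close> maps boundaries to
  boundaries, so the union defining the map is a single class.\<close>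

lemma homology_map_hclass:
  assumes f: "chain_algebra_map A A' f" and A: "chain_algebra A" and A': "chain_algebra A'"
    and z: "z \<in> cycles A n"
  shows "homology_map A A' f n (hclass A n z) = hclass A' n (f z)"
proof -
  note F = chain_algebra_map_facts[OF f A A']
  have "hclass A' n (f u) = hclass A' n (f z)" if u: "u \<in> hclass A n z" for u
  proof -
    note b = mem_hclass[OF A u]
    have "f u = f (z + (u - z))" by simp
    also have "\<dots> = f z + f (u - z)"
      using cycles_fre[OF A z] cycles_fre[OF A boundaries_subset_cycles[OF A b]] by (rule F)
    finally have "f u - f z = f (u - z)" by simp
    then show ?thesis using F(4)[OF b] by (simp add: hclass_eq_iff[OF A'])
  qed
  then have "(\<Union>u\<in>hclass A n z. hclass A' n (f u)) = hclass A' n (f z)"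
    by (rule UN_const[OF hclass_nonempty[OF A]])
  then show ?thesis using z by (simp add: homology_map_def homology_simps)
qed

lemma graded_algebra_map_homology:
  assumes f: "chain_algebra_map A A' f" and A: "chain_algebra A" and A': "chain_algebra A'"
  shows "graded_algebra_map (homology A) (homology A') (homology_map A A' f)"
proof -
  note F = chain_algebra_map_facts[OF f A A']
  show ?thesis
    unfolding graded_algebra_map_def
    by (auto simp: homology_simps homology_map_hclass[OF f A A'] F cycles_fre[OF A] cycles_add[OF A]
      homology_add[OF A] homology_add[OF A'] homology_smul[OF A] homology_smul[OF A']
          cycles_smul[OF A]
      homology_mul[OF A] homology_mul[OF A'] cycles_mul[OF A] cycles_unt[OF A] intro!: imageI)
qed

lemma homology_map_extensional: "homology_map A A' f n \<in> extensional (gcar (homology A) n)"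
  by (simp add: homology_map_def)

lemma homology_map_id:
  assumes A: "chain_algebra A"
  shows "homology_map A A (restrict id (fre A)) n = restrict id (gcar (homology A) n)"
proof
  fix U
  have id: "chain_algebra_map A A (restrict id (fre A))"
    using A mul_fre[OF A] dif_fre[OF chain_algebra_complex[OF A]]
    by (auto simp: chain_algebra_map_def chain_map_def graded_map_def linear_map_def
        chain_algebra_def
        fre_add fre_smul piece_subset_fre)
  show "homology_map A A (restrict id (fre A)) n U = restrict id (gcar (homology A) n) U"
  proof (cases "U \<in> gcar (homology A) n")
    case True
    then obtain z where "z \<in> cycles A n" "U = hclass A n z" by (auto simp: homology_simps)
    with True show ?thesis by (simp add: homology_map_hclass[OF id A A] cycles_fre[OF A])
  qed (simp add: homology_map_def)
qed

lemma homology_map_compose: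
  assumes f: "chain_algebra_map A A' f" and g: "chain_algebra_map A' A'' g"
    and A: "chain_algebra A" and A': "chain_algebra A'" and A'': "chain_algebra A''"
  shows "homology_map A A'' (compose (fre A) g f) n =
    compose (gcar (homology A) n) (homology_map A' A'' g n) (homology_map A A' f n)"
proof
  fix U
  have fm: "f v \<in> fre A'" if "v \<in> fre A" for v
    using f that by (auto simp: chain_algebra_map_def chain_map_def graded_map_def linear_map_def)
  have gf: "chain_algebra_map A A'' (compose (fre A) g f)"
    using f g fm mul_fre[OF A] dif_fre[OF chain_algebra_complex[OF A]]
      piece_subset_fre[OF unt_piece[OF A]]
    by (auto simp: chain_algebra_map_def chain_map_def graded_map_def linear_map_def
        fre_add fre_smul piece_subset_fre compose_def)
  show "homology_map A A'' (compose (fre A) g f) n U =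
    compose (gcar (homology A) n) (homology_map A' A'' g n) (homology_map A A' f n) U"
  proof (cases "U \<in> gcar (homology A) n")
    case True
    then obtain z where z: "z \<in> cycles A n" "U = hclass A n z" by (auto simp: homology_simps)
    have "homology_map A A'' (compose (fre A) g f) n U = hclass A'' n (g (f z))"
      using z by (simp add: homology_map_hclass[OF gf A A''] cycles_fre[OF A] compose_eq)
    also have "\<dots> = homology_map A' A'' g n (homology_map A A' f n U)"
      using z chain_algebra_map_facts(3)[OF f A A' z(1)]
      by (simp add: homology_map_hclass[OF f A A'] homology_map_hclass[OF g A' A''])
    finally show ?thesis using True by (simp add: compose_def)
  qed (simp add: homology_map_def compose_def)
qed

section \<open>Naturality\<close>

locale comod_algebra_map =
  src: comod_algebra P + tgt: comod_algebra P'
  for P :: "('x, 'y, 'r::comm_ring_1) comod_alg" and P' :: "('z, 'w, 'r) comod_alg" +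
  fixes f :: "('x \<Rightarrow>\<^sub>0 'r) \<Rightarrow> ('z \<Rightarrow>\<^sub>0 'r)" and g :: "('y \<Rightarrow>\<^sub>0 'r) \<Rightarrow> ('w \<Rightarrow>\<^sub>0 'r)"
  assumes hopf_map: "chain_hopf_map src.H tgt.H f"
    and alg_map: "chain_algebra_map src.B tgt.B g"
    and coact_compat: "\<And>b. b \<in> fre src.B \<Longrightarrow> tmap g f (coact P b) = coact P' (g b)"
begin

abbreviation "bf \<equiv> onbasis src.H f"
abbreviation "bg \<equiv> onbasis src.B g"

lemma hopf_alg_map: "chain_algebra_map (alg_of src.H) (alg_of tgt.H) f"
  using hopf_map by (simp add: chain_hopf_map_def)

lemma onbasis_alg_of: "onbasis (alg_of src.H) f = bf"
  by (simp add: onbasis_def fun_eq_iff)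

lemma chain_map_f: "chain_map (alg_of src.H) (alg_of tgt.H) f"
  and chain_map_g: "chain_map src.B tgt.B g"
  using hopf_alg_map alg_map by (simp_all add: chain_algebra_map_def)

lemmas chain_map_f_facts = chain_mapD[OF chain_map_f chain_algebra_complex[OF src.chain_algebra_H]
    chain_algebra_complex[OF tgt.chain_algebra_H], simplified onbasis_alg_of, simplified]

lemmas chain_map_g_facts = chain_mapD[OF chain_map_g src.chain_complex_B tgt.chain_complex_B]

lemma bf_piece: "bf x \<in> piece tgt.H (deg src.H x)"
  and f_lext: "v \<in> fre src.H \<Longrightarrow> f v = lext bf v"
  and bf_dif: "lext bf (src.dH x) = lext tgt.dH (bf x)"
  by (fact chain_map_f_facts)+

lemma bg_piece: "bg x \<in> piece tgt.B (deg src.B x)"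
  and g_lext: "v \<in> fre src.B \<Longrightarrow> g v = lext bg v"
  and bg_dif: "lext bg (src.dB x) = lext tgt.dB (bg x)"
  by (fact chain_map_g_facts)+

lemma keys_bf: "u \<in> Poly_Mapping.keys (bf x) \<Longrightarrow> u \<in> gens tgt.H \<and> deg tgt.H u = deg src.H x"
  using bf_piece[of x] by (auto simp: piece_iff)

lemma keys_bg: "u \<in> Poly_Mapping.keys (bg x) \<Longrightarrow> u \<in> gens tgt.B \<and> deg tgt.B u = deg src.B x"
  using bg_piece[of x] by (auto simp: piece_iff)

lemma bf_mul: "lext bf (src.mH x y) = lext (\<lambda>u. lext (\<lambda>v. tgt.mH u v) (bf y)) (bf x)"
  using chain_algebra_map_bmul[OF hopf_alg_map src.chain_algebra_H linear_map_mul[OF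
      tgt.chain_algebra_H], of x y]
  by (simp add: onbasis_alg_of)

lemma bf_one: "lext bf src.one = tgt.one"
  using chain_algebra_map_unt[OF hopf_alg_map src.chain_algebra_H linear_map_mul[OF
      tgt.chain_algebra_H]]
  by (simp add: onbasis_alg_of)

lemma bg_mul: "lext bg (src.mB x y) = lext (\<lambda>u. lext (\<lambda>v. tgt.mB u v) (bg y)) (bg x)"
  by (rule chain_algebra_map_bmul[OF alg_map src.chain_algebra_B linear_map_mul[OF
      tgt.chain_algebra_B]])

lemma bg_unt: "lext bg (unt src.B) = unt tgt.B"
  by (rule chain_algebra_map_unt[OF alg_map src.chain_algebra_B linear_map_mul[OF
      tgt.chain_algebra_B]])

lemma bf_comul:
  "lext (\<lambda>u. lext (\<lambda>p. K (fst p) (snd p)) (tgt.\<Delta> u)) (bf x) =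
   lext (\<lambda>p. lext (\<lambda>u. lext (\<lambda>v. K u v) (bf (snd p))) (bf (fst p))) (src.\<Delta> x)"
proof (cases "x \<in> gens src.H")
  case True
  have "lext tgt.\<Delta> (bf x) = comul tgt.H (f (gen x))"
    using tgt.comul_lext[OF piece_subset_fre[OF bf_piece[of x]]] True by (simp add: onbasis_def)
  also have "\<dots> = tmap f f (src.\<Delta> x)"
    using hopf_map True by (simp add: chain_hopf_map_def fre_gen src.comul_gen)
  also have "\<dots> = lext (\<lambda>p. tens (bf (fst p)) (bf (snd p))) (src.\<Delta> x)"
    unfolding tmap_def by (rule lext_cong) (auto dest!: src.keys_comul simp: onbasis_def)
  finally have "lext (\<lambda>p. K (fst p) (snd p)) (lext tgt.\<Delta> (bf x)) = lext (\<lambda>p. K (fst p) (snd p)) \<dots>"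
    by simp
  then show ?thesis by (simp add: lext_lext lext_tens)
qed (simp add: onbasis_def bcomul_def)

lemma bg_coact:
  "lext (\<lambda>u. lext (\<lambda>p. K (fst p) (snd p)) (tgt.\<nu> u)) (bg b) =
   lext (\<lambda>p. lext (\<lambda>u. lext (\<lambda>v. K u v) (bf (snd p))) (bg (fst p))) (src.\<nu> b)"
proof (cases "b \<in> gens src.B")
  case True
  have "lext tgt.\<nu> (bg b) = coact P' (g (gen b))"
    using tgt.coact_lext[OF piece_subset_fre[OF bg_piece[of b]]] True by (simp add: onbasis_def)
  also have "\<dots> = tmap g f (src.\<nu> b)"
    using coact_compat[of "gen b"] True by (simp add: fre_gen src.coact_gen)
  also have "\<dots> = lext (\<lambda>p. tens (bg (fst p)) (bf (snd p))) (src.\<nu> b)"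
    unfolding tmap_def by (rule lext_cong) (auto dest!: src.keys_coact simp: onbasis_def)
  finally have "lext (\<lambda>p. K (fst p) (snd p)) (lext tgt.\<nu> (bg b)) = lext (\<lambda>p. K (fst p) (snd p)) \<dots>"
    by simp
  then show ?thesis by (simp add: lext_lext lext_tens)
qed (simp add: onbasis_def bcoact_def)

section \<open>The cobar construction on morphisms\<close>

definition \<phi> :: "'x list \<Rightarrow> ('z list \<Rightarrow>\<^sub>0 'r)" where
  "\<phi> = wordmap (\<lambda>x. lext tgt.t (bf x))"

lemma phi_simps [simp]: "\<phi> [] = gen []" "\<phi> (x # w) = conc (lext tgt.t (bf x)) (\<phi> w)"
  by (simp_all add: \<phi>_def)

lemma phi_append: "\<phi> (v @ w) = conc (\<phi> v) (\<phi> w)"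
  by (simp add: \<phi>_def wordmap_append)

lemma lext_phi_conc: "lext \<phi> (conc u v) = conc (lext \<phi> u) (lext \<phi> v)"
  by (simp add: \<phi>_def lext_wordmap_conc)

lemma t_bf: "\<not> 0 < deg src.H x \<Longrightarrow> lext tgt.t (bf x) = 0"
  using lext_cong[of "bf x" tgt.t "\<lambda>u. 0"] keys_bf[of _ x] by (auto simp: tgt.t_def)

text \<open>Naturality of the universal twisting cochain; as \<open>f\<close> preserves degrees, it
  persists in degree 0, where both sides vanish.\<close>

lemma phi_t: "lext \<phi> (src.t x) = lext tgt.t (bf x)"
  by (cases "0 < deg src.H x") (simp_all add: src.t_def t_bf)

lemma t_bf_piece: "lext tgt.t (bf x) \<in> piece (cobar tgt.H) (deg src.H x - 1)"
  by (intro piece_lext tgt.t_piece) (auto dest!: keys_bf)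

lemma phi_piece: "\<phi> w \<in> piece (cobar tgt.H) (src.wdeg w)"
proof (induction w)
  case (Cons x w)
  then show ?case by (auto intro: tgt.conc_piece[OF t_bf_piece])
qed (auto intro: piece_gen)

text \<open>\<open>f\<close> commutes with differentials and comultiplications, and it preserves
  degrees, so the sign of the quadratic part is unchanged.\<close>

lemma cobar_letter_phi: "lext \<phi> (src.cobar_letter x) = lext tgt.cobar_letter (bf x)"
proof -
  let ?c = "\<lambda>u v. conc (tgt.t u) (tgt.t v)"
  have "lext \<phi> (src.cobar_letter x) = - lext tgt.t (lext bf (src.dH x)) +
    lext (\<lambda>p. lext (\<lambda>u. lext (\<lambda>v. smul (ksgn (deg src.H (fst p))) (?c u v)) (bf (snd p))) (bf
        (fst p))) (src.\<Delta> x)"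
    by (simp add: src.lext_cobar_letter lext_phi_conc phi_t conc_lext_left conc_lext_right
        lext_smul_fun lext_lext
       del: lext_conc) (subst lext_swap, rule refl)
  also have "lext (\<lambda>p. lext (\<lambda>u. lext (\<lambda>v. smul (ksgn (deg src.H (fst p))) (?c u v)) (bf (snd p)))
      (bf (fst p))) (src.\<Delta> x) =
    lext (\<lambda>p. lext (\<lambda>u. lext (\<lambda>v. smul (ksgn (deg tgt.H u)) (?c u v)) (bf (snd p))) (bf (fst p)))
        (src.\<Delta> x)"
    by (intro lext_cong) (auto dest!: keys_bf)
  also have "\<dots> = lext (\<lambda>u. lext (\<lambda>p. smul (ksgn (deg tgt.H (fst p))) (?c (fst p) (snd p)))
      (tgt.\<Delta> u)) (bf x)"
    by (rule bf_comul[symmetric])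
  also have "- lext tgt.t (lext bf (src.dH x)) + \<dots> = lext tgt.cobar_letter (bf x)"
    by (simp add: bf_dif tgt.cobar_letter_def[abs_def] linear_simps)
  finally show ?thesis .
qed

lemma cobar_word_t_bf: "lext tgt.cobar_word (lext tgt.t (bf x)) = lext tgt.cobar_letter (bf x)"
  unfolding lext_lext by (rule lext_cong) (auto dest!: keys_bf simp: tgt.cobar_word_t)

lemma cobar_word_phi: "lext \<phi> (src.cobar_word w) = lext tgt.cobar_word (\<phi> w)"
proof (induction w)
  case (Cons x w)
  let ?u = "lext tgt.t (bf x)"
  have "lext tgt.cobar_word (conc ?u (\<phi> w)) =
    lext (\<lambda>p. lext (\<lambda>q. conc (tgt.cobar_word p) (gen q) + smul (ksgn (deg src.H x - 1)) (conc
        (gen p) (tgt.cobar_word q))) (\<phi> w)) ?u"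
    unfolding lext_conc
    by (intro lext_cong) (use t_bf_piece[of x] in \<open>simp add: tgt.cobar_word_append piece_iff\<close>)
  also have "\<dots> = conc (lext tgt.cobar_word ?u) (\<phi> w) + smul (ksgn (deg src.H x - 1)) (conc ?u
      (lext tgt.cobar_word (\<phi> w)))"
    by (simp add: lext_add_fun lext_smul_fun conc_lext_left[symmetric] conc_lext_right[symmetric])
  finally have 1: "lext tgt.cobar_word (conc ?u (\<phi> w)) = \<dots>" .
  have "lext \<phi> (src.cobar_word (x # w)) = conc (lext tgt.cobar_letter (bf x)) (\<phi> w) +
     smul (ksgn (deg src.H x - 1)) (conc ?u (lext tgt.cobar_word (\<phi> w)))"
    by (simp add: lext_add lext_smul lext_phi_conc cobar_letter_phi Cons)
  then show ?case by (simp add: 1 cobar_word_t_bf)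
qed simp

section \<open>The twisted tensor product on morphisms\<close>

definition G :: "'y \<times> 'x list \<Rightarrow> ('w \<times> 'z list \<Rightarrow>\<^sub>0 'r)" where
  "G z = tens (bg (fst z)) (\<phi> (snd z))"

lemma lext_G: "lext k (G z) = lext (\<lambda>u. lext (\<lambda>v. k (u, v)) (\<phi> (snd z))) (bg (fst z))"
  by (simp add: G_def lext_tens)

lemma G_piece:
  "G z \<in> piece tgt.M (deg src.M z)"
  unfolding G_def by (rule piece_tens[OF bg_piece phi_piece]) simp

lemma G_LB: "lext G (src.LB b z) = lext (\<lambda>c. lext (tgt.LB c) (G z)) (bg b)"
proof -
  have "lext G (src.LB b z) = lext (\<lambda>u. tens (gen u) (\<phi> (snd z))) (lext bg (src.mB b (fst z)))"
    by (simp add: src.LB_def lext_lext G_def tens_def)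
  then show ?thesis
    by (simp add: bg_mul lext_G tgt.LB_def lext_lext tens_def lext_swap[of _ "\<phi> _"])
qed

text \<open>\<open>LH a\<close> consists of a coaction followed by multiplication by
  \<open>a\<close> in \<open>H\<close>: the first is natural by \<open>bg_coact\<close>, the second
  by \<open>bf_mul\<close>. In degree 0 both operators vanish.\<close>

lemma G_LH: "lext G (src.LH a z) = lext (\<lambda>c. lext (tgt.LH c) (G z)) (bf a)"
proof (cases "0 < deg src.H a")
  case False
  have "lext (\<lambda>c. lext (tgt.LH c) (G z)) (bf a) = lext (\<lambda>c. 0) (bf a)"
    using False by (intro lext_cong) (auto dest!: keys_bf simp: tgt.LH_nonpos)
  then show ?thesis using False by (simp add: src.LH_nonpos)
next
  case True
  let ?b = "fst z" and ?w = "snd z"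
  let ?g = "\<lambda>u k. lext (\<lambda>v. gen (u, k # v)) (\<phi> ?w) :: ('w \<times> 'z list \<Rightarrow>\<^sub>0 'r)"
  let ?K = "\<lambda>c u d. smul (ksgn (tgt.eps c u)) (lext (?g u) (tgt.mH c d))"
  have "lext G (src.LH a z) = lext (\<lambda>p. smul (ksgn (src.eps a (fst p)))
     (lext (\<lambda>h. G (fst p, h # ?w)) (src.mH a (snd p)))) (src.\<nu> ?b)"
    using True by (simp add: src.LH_def lext_lext lext_smul)
  also have "\<dots> = lext (\<lambda>p. smul (ksgn (src.eps a (fst p))) (lext (\<lambda>u. lext (\<lambda>c. lext (\<lambda>d. lext
      (?g u) (tgt.mH c d)) (bf (snd p))) (bf a)) (bg (fst p)))) (src.\<nu> ?b)"
  proof (intro lext_cong arg_cong[where f = "smul _"])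
    fix p assume p: "p \<in> Poly_Mapping.keys (src.\<nu> ?b)"
    have "lext (\<lambda>h. G (fst p, h # ?w)) (src.mH a (snd p))
        = lext (\<lambda>h. lext (\<lambda>u. lext (?g u) (bf h)) (bg (fst p))) (src.mH a (snd p))"
    proof (rule lext_cong)
      fix h assume h: "h \<in> Poly_Mapping.keys (src.mH a (snd p))"
      have "0 < deg src.H h"
        using src.keys_mH[OF h] src.keys_coact[OF p] src.deg_nonneg[of "snd p"] True by simp
      then have "lext tgt.t (bf h) = lext (\<lambda>k. gen [k]) (bf h)"
        by (intro lext_cong) (auto dest!: keys_bf simp: tgt.t_def)
      then show "G (fst p, h # ?w) = lext (\<lambda>u. lext (?g u) (bf h)) (bg (fst p))"
        by (simp add: G_def tens_def lext_conc lext_lext)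
    qed
    also have "\<dots> = lext (\<lambda>u. lext (?g u) (lext bf (src.mH a (snd p)))) (bg (fst p))"
      unfolding lext_lext by (rule lext_swap)
    finally show "lext (\<lambda>h. G (fst p, h # ?w)) (src.mH a (snd p)) =
       lext (\<lambda>u. lext (\<lambda>c. lext (\<lambda>d. lext (?g u) (tgt.mH c d)) (bf (snd p))) (bf a)) (bg (fst p))"
      by (simp add: bf_mul lext_lext)
  qed
  also have "\<dots> = lext (\<lambda>p. lext (\<lambda>u. lext (\<lambda>c. lext (\<lambda>d. ?K c u d) (bf (snd p))) (bf a)) (bg
      (fst p))) (src.\<nu> ?b)"
    unfolding lext_smul_fun[symmetric]
    by (intro lext_cong) (auto dest!: keys_bf keys_bg simp: tgt.eps_def src.eps_def)
  \<comment> \<open>The sum over the terms \<open>c\<close> of \<open>bf a\<close> is moved outside,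
    so that \<open>bg_coact\<close> can be applied with \<open>c\<close> fixed.\<close>
  also have "\<dots> = lext (\<lambda>c. lext (\<lambda>p. lext (\<lambda>u. lext (\<lambda>d. ?K c u d) (bf (snd p))) (bg (fst p)))
      (src.\<nu> ?b)) (bf a)"
    by (simp only: lext_swap[of _ "bf a"])
  also have "\<dots> = lext (\<lambda>c. lext (\<lambda>u. lext (\<lambda>q. ?K c (fst q) (snd q)) (tgt.\<nu> u)) (bg ?b)) (bf a)"
    by (simp only: bg_coact[of "?K _"])
  also have "\<dots> = lext (\<lambda>c. lext (tgt.LH c) (G z)) (bf a)"
  proof (rule lext_cong)
    fix c assume "c \<in> Poly_Mapping.keys (bf a)"
    then have c: "0 < deg tgt.H c" using keys_bf[of c a] True by simp
    show "lext (\<lambda>u. lext (\<lambda>q. ?K c (fst q) (snd q)) (tgt.\<nu> u)) (bg ?b) = lext (tgt.LH c) (G z)"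
      using c by (simp add: lext_G tgt.LH_def lext_smul_fun[symmetric] lext_swap[of _ _ "\<phi> _"])
  qed
  finally show ?thesis .
qed

lemma G_LW: "lext G (src.LW w z) = lext (\<lambda>v. lext (tgt.LW v) (G z)) (\<phi> w)"
proof (induction w)
  case (Cons a w)
  have "tgt.LW (c # u) = (\<lambda>x. lext (tgt.LH c) (tgt.LW u x))" for c u
    by (simp add: fun_eq_iff)
  then have t: "lext (\<lambda>v. lext (tgt.LW (v @ u)) x) (tgt.t c)
      = lext (tgt.LH c) (lext (tgt.LW u) x)" for u x c
    by (simp add: tgt.t_def tgt.LH_nonpos lext_lext)
  have "lext G (src.LW (a # w) z) = lext (\<lambda>q. lext (\<lambda>c. lext (tgt.LH c) (G q)) (bf a)) (src.LW w z)"
    by (simp add: lext_lext G_LH)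
  also have "\<dots> = lext (\<lambda>c. lext (tgt.LH c) (lext G (src.LW w z))) (bf a)"
    unfolding lext_lext by (rule lext_swap)
  also have "\<dots> = lext (\<lambda>v. lext (tgt.LW v) (G z)) (\<phi> (a # w))"
  proof -
    have "lext (\<lambda>v. lext (tgt.LW v) (G z)) (\<phi> (a # w)) =
      lext (\<lambda>c. lext (\<lambda>v. lext (\<lambda>u. lext (tgt.LW (v @ u)) (G z)) (\<phi> w)) (tgt.t c)) (bf a)"
      by (simp add: lext_conc lext_lext)
    also have "\<dots> = lext (\<lambda>c. lext (\<lambda>u. lext (\<lambda>v. lext (tgt.LW (v @ u)) (G z)) (tgt.t c)) (\<phi> w))
        (bf a)"
      by (intro lext_cong lext_swap)
    finally show ?thesis by (simp add: t Cons lext_lext)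
  qed
  finally show ?case .
qed (simp add: tgt.LW_Nil)

lemma G_Lmul: "lext G (src.Lmul y z) = lext (\<lambda>x. lext (tgt.Lmul x) (G z)) (G y)"
proof -
  have "lext G (src.Lmul y z) = lext (\<lambda>c. lext (tgt.LB c) (lext G (src.LW (snd y) z))) (bg (fst y))"
    by (simp add: src.Lmul_def lext_lext G_LB) (rule lext_swap)
  then show ?thesis
    by (simp add: G_LW lext_G[of _ y] tgt.Lmul_def[abs_def] lext_lext)
qed

text \<open>The three parts of the differential are natural separately: by \<open>bg_dif\<close> on
  \<open>B\<close>, by \<open>cobar_word_phi\<close> on words, and by \<open>bg_coact\<close> with
  \<open>phi_t\<close> for the twisting term.\<close>

lemma G_D: "lext G (src.D z) = lext tgt.D (G z)"
proof -
  let ?b = "fst z" and ?w = "snd z"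
  have 1: "lext G (lext (\<lambda>u. gen (u, ?w)) (src.dB ?b))
      = lext (\<lambda>y. lext (\<lambda>u. gen (u, snd y)) (tgt.dB (fst y))) (G z)"
  proof -
    have "lext G (lext (\<lambda>u. gen (u, ?w)) (src.dB ?b))
        = lext (\<lambda>u. tens (gen u) (\<phi> ?w)) (lext bg (src.dB ?b))"
      by (simp add: lext_lext G_def tens_def)
    then show ?thesis
      by (simp add: bg_dif lext_G lext_lext tens_def lext_swap[of _ "\<phi> _"])
  qed
  have 2: "lext G (smul (ksgn (deg src.B ?b)) (lext (\<lambda>v. gen (?b, v)) (src.cobar_word ?w))) =
     lext (\<lambda>y. smul (ksgn (deg tgt.B (fst y))) (lext (\<lambda>v. gen (fst y, v)) (tgt.cobar_word
         (snd y)))) (G z)"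
  proof -
    have "lext G (smul (ksgn (deg src.B ?b)) (lext (\<lambda>v. gen (?b, v)) (src.cobar_word ?w))) =
       smul (ksgn (deg src.B ?b)) (lext (\<lambda>u. lext (\<lambda>v. gen (u, v)) (lext \<phi> (src.cobar_word ?w)))
           (bg ?b))"
      by (simp add: lext_smul lext_lext G_def tens_def lext_swap[of _ "src.cobar_word _"])
    also have "\<dots> = lext (\<lambda>u. smul (ksgn (deg tgt.B u)) (lext (\<lambda>v. gen (u, v)) (lext \<phi>
        (src.cobar_word ?w)))) (bg ?b)"
      unfolding lext_smul_fun[symmetric, of "ksgn (deg src.B ?b)"]
          by (intro lext_cong) (auto dest!: keys_bg simp: lext_smul_fun)
    finally show ?thesis by (simp add: cobar_word_phi lext_G lext_lext lext_smul_fun)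
  qed
  have 3: "lext G (src.Dtwist z) = lext tgt.Dtwist (G z)"
  proof -
    let ?K = "\<lambda>u d. smul (ksgn (deg tgt.B u)) (lext (\<lambda>v. lext (\<lambda>v'. gen (u, v @ v')) (\<phi> ?w))
        (tgt.t d))"
    have "lext G (src.Dtwist z) = lext (\<lambda>p. smul (ksgn (deg src.B (fst p)))
       (lext (\<lambda>u. lext (\<lambda>v. lext (\<lambda>v'. gen (u, v @ v')) (\<phi> ?w)) (lext \<phi> (src.t (snd p)))) (bg
           (fst p)))) (src.\<nu> ?b)"
      by (simp add: src.Dtwist_def lext_lext lext_smul G_def tens_def phi_append lext_conc
          lext_swap[of _ _ "bg _"] lext_swap[of _ _ "src.t _"])
    \<comment> \<open>\<open>g\<close> preserves degrees, so the sign of \<open>b_i\<close> may be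
      read off from each term of its image.\<close>
    also have "\<dots> = lext (\<lambda>p. lext (\<lambda>u. lext (\<lambda>d. ?K u d) (bf (snd p))) (bg (fst p))) (src.\<nu> ?b)"
      unfolding phi_t lext_smul_fun[of "ksgn (deg tgt.B _)"]
    proof (rule lext_cong, unfold lext_smul_fun[symmetric], intro lext_cong)
    qed (auto dest!: keys_bg simp: lext_lext lext_smul_fun)
    also have "\<dots> = lext (\<lambda>u. lext (\<lambda>q. ?K (fst q) (snd q)) (tgt.\<nu> u)) (bg ?b)"
      by (rule bg_coact[symmetric])
    also have "\<dots> = lext tgt.Dtwist (G z)"
      by (simp add: lext_G tgt.Dtwist_def lext_smul_fun[symmetric] lext_swap[of _ _ "\<phi> _"])
    finally show ?thesis .
  qed
  have "lext tgt.D v = lext (\<lambda>y. lext (\<lambda>u. gen (u, snd y)) (tgt.dB (fst y))) v +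
     lext (\<lambda>y. smul (ksgn (deg tgt.B (fst y))) (lext (\<lambda>v. gen (fst y, v)) (tgt.cobar_word
         (snd y)))) v -
     lext tgt.Dtwist v" for v
    by (simp add: tgt.D_def[abs_def] lext_add_fun lext_diff_fun)
  then show ?thesis
    by (simp only: src.D_def lext_add lext_diff 1 2 3)
qed

lemma G_unt: "lext (\<lambda>u. G (u, [])) (unt src.B) = tens (unt tgt.B) (gen [])"
proof -
  have "lext (\<lambda>u. G (u, [])) (unt src.B) = lext (\<lambda>u. gen (u, [])) (lext bg (unt src.B))"
    by (simp add: G_def tens_def lext_lext)
  then show ?thesis by (simp add: bg_unt tens_def)
qed

end

section \<open>Hopf algebra maps induce pseudo Hopf algebra morphisms\<close>

lemma mul_cobar: "mul (cobar C) (tens u v) = conc u v"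
  by (simp add: cobar_def lext_tens conc_def)

lemma unt_cobar: "unt (cobar C) = gen []"
  by (simp add: cobar_def)

lemma gens_cobar: "gens (cobar C) = lists (posgens C)"
  by (simp add: cobar_def)

lemma conc_fre_cobar: "u \<in> fre (cobar C) \<Longrightarrow> v \<in> fre (cobar C) \<Longrightarrow> conc u v \<in> fre (cobar C)"
  unfolding conc_def by (intro fre_lext) (auto simp: fre_gen fre_iff gens_cobar)

lemma tensor_coalg_simps [simp]:
  "gens (tensor_coalg C D) = gens C \<times> gens D"
  "deg (tensor_coalg C D) p = deg C (fst p) + deg D (snd p)"
  by (simp_all add: tensor_coalg_def)

lemma posgens_tensor_coalg:
  "p \<in> posgens (tensor_coalg C D) \<longleftrightarrow>
    fst p \<in> gens C \<and> snd p \<in> gens D \<and> 0 < deg C (fst p) + deg D (snd p)"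
  by (auto simp: posgens_def mem_Times_iff)

lemma desusp_tensor_coalg:
  "desusp (tensor_coalg C D) (tens u v) =
    lext (\<lambda>x. lext (\<lambda>y. if 0 < deg C x + deg D y then gen [(x, y)] else 0) v) u"
  by (simp add: desusp_def lext_tens)

text \<open>The recursion starts from the counit, so its first step is one side of the counit law.
  For \<open>cobar_map\<close> this case suffices, as letters go to words of length one.\<close>

lemma (in comod_algebra) itcomul_1:
  assumes "x \<in> gens H"
  shows "itcomul H (Suc 0) x = gen [x]"
proof -
  have "conc (gen [y]) (Poly_Mapping.single [] c) = smul c (gen [y])" for y :: 'x and c :: 'r
    by (simp add: conc_def lext_single)
  then have "itcomul H (Suc 0) x = lext (\<lambda>y. gen [y])
      (lext (\<lambda>(y, z). smul (counit H (gen z)) (gen y)) (comul H (gen x)))"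
    by (simp add: case_prod_unfold linear_simps)
  also have "lext (\<lambda>(y, z). smul (counit H (gen z)) (gen y)) (comul H (gen x)) = gen x"
    using chain_coalgebra_H assms by (simp add: chain_coalgebra_def fre_gen)
  finally show ?thesis by simp
qed

context comod_algebra_map
begin

abbreviation "\<theta> \<equiv> cobar_map src.H tgt.H f"

lemma theta_eq:
  assumes "v \<in> fre (cobar src.H)"
  shows "\<theta> v = lext \<phi> v"
proof -
  have "wordmap (\<lambda>x. desusp tgt.H (f (gen x))) w = \<phi> w" if "w \<in> lists (posgens src.H)" for w
    using that unfolding \<phi>_def
    by (intro wordmap_cong) (auto simp: tgt.desusp_eq onbasis_def posgens_def)
  then show ?thesis
    using assms unfolding cobar_map_def restrict_def by (auto simp: fre_iff intro!: lext_cong)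
qed

lemma lext_phi_fre: "v \<in> fre (cobar src.H) \<Longrightarrow> lext \<phi> v \<in> fre (cobar tgt.H)"
  by (rule fre_lext) (rule piece_subset_fre[OF phi_piece])

lemma cobar_map_chain_algebra_map: "chain_algebra_map (cobar src.H) (cobar tgt.H) \<theta>"
  unfolding chain_algebra_map_def chain_map_def
proof (intro conjI ballI)
  show "graded_map 0 (cobar src.H) (cobar tgt.H) \<theta>"
    by (rule graded_mapI[of _ _ \<phi>]) (simp_all add: theta_eq phi_piece)
  show "\<theta> (unt (cobar src.H)) = unt (cobar tgt.H)"
    by (simp add: unt_cobar theta_eq fre_gen)
  fix u v :: "'x list \<Rightarrow>\<^sub>0 'r" assume u: "u \<in> fre (cobar src.H)"
  have "lext src.cobar_word u \<in> fre (cobar src.H)"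
    using u by (intro fre_lext) (auto simp: fre_iff[of u] intro!: piece_subset_fre[OF
        src.cobar_word_piece])
  then show "\<theta> (dif (cobar src.H) u) = dif (cobar tgt.H) (\<theta> u)"
    using u by (simp add: src.dif_cobar tgt.dif_cobar theta_eq lext_phi_fre lext_lext
        cobar_word_phi)
  assume v: "v \<in> fre (cobar src.H)"
  show "\<theta> (mul (cobar src.H) (tens u v)) = mul (cobar tgt.H) (tens (\<theta> u) (\<theta> v))"
    using u v by (simp add: mul_cobar theta_eq conc_fre_cobar lext_phi_conc)
qed

text \<open>The values on letters of the two maps composed in \<open>curly\<close>: the first keeps
  the right factor in the source, the second finds its left factor already in the target.\<close>

abbreviation "left_curl \<equiv> \<lambda>(x, y). if deg src.H x = 0
     then smul (counit src.H (gen x)) (desusp (tensor_coalg tgt.H src.H) (tens (coone tgt.H)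
         (gen y)))
     else lext (\<lambda>cs. lext (\<lambda>ds. smul (lsign tgt.H src.H cs ds) (gen (zip cs ds)))
                 (itcomul src.H (length cs) y)) (\<theta> (gen [x]))"

abbreviation "right_curl \<equiv> \<lambda>(y, x). if deg src.H x = 0
     then smul (counit src.H (gen x)) (desusp (tensor_coalg tgt.H tgt.H) (tens (gen y)
         (coone tgt.H)))
     else lext (\<lambda>cs. lext (\<lambda>ds. smul (rsign tgt.H tgt.H ds cs) (gen (zip ds cs)))
                 (itcomul tgt.H (length cs) y)) (\<theta> (gen [x]))"

lemma bf_deg_0: "x \<in> gens src.H \<Longrightarrow> deg src.H x = 0 \<Longrightarrow> bf x = smul (counit src.H (gen x)) tgt.one"
  using src.lext_deg_0[of x bf] by (simp add: bf_one)

lemma theta_letter: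
  assumes "x \<in> gens src.H" "deg src.H x \<noteq> 0"
  shows "\<theta> (gen [x]) = lext (\<lambda>u. gen [u]) (bf x)"
proof -
  have pos: "0 < deg src.H x" using assms src.deg_nonneg[of x] by simp
  then have "(gen [x] :: 'x list \<Rightarrow>\<^sub>0 'r) \<in> fre (cobar src.H)" using assms
      by (simp add: fre_gen posgens_def)
  then have "\<theta> (gen [x]) = lext tgt.t (bf x)" by (simp add: theta_eq)
  also have "\<dots> = lext (\<lambda>u. gen [u]) (bf x)"
    using pos by (intro lext_cong) (auto dest!: keys_bf simp: tgt.t_def)
  finally show ?thesis .
qed

text \<open>In positive degree the value of \<theta> on the letter has words of length one only:
  \<open>itcomul\<close> is then trivial and the double sum in \<open>lsign\<close> empty. In degree
  0 the separate clause agrees because \<open>bf x\<close> is the counit of \<open>x\<close> times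
  \<open>one\<close>.\<close>

lemma left_curl_eq:
  assumes "(x, y) \<in> posgens (tensor_coalg src.H src.H)"
  shows "left_curl (x, y) = lext (\<lambda>u. gen [(u, y)]) (bf x)"
proof (cases "deg src.H x = 0")
  case True
  \<comment> \<open>With \<open>x\<close> in degree 0, \<open>y\<close> has positive degree, so
    desuspension keeps every term.\<close>
  have "lext (\<lambda>u. if 0 < deg tgt.H u + deg src.H y then gen [(u, y)] else 0) tgt.one
      = lext (\<lambda>u. gen [(u, y)]) tgt.one"
    using assms True by (intro lext_cong) (auto dest!: tgt.keys_one simp: posgens_tensor_coalg)
  then show ?thesis
    using assms True by (simp add: desusp_tensor_coalg bf_deg_0 posgens_tensor_coalg lext_smul)
next
  case False
  then show ?thesis
    using assms by (simp add: theta_letter posgens_tensor_coalg lext_lext src.itcomul_1 lsign_def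
        del: itcomul.simps)
qed

lemma right_curl_eq:
  assumes "u \<in> gens tgt.H" "y \<in> gens src.H" "0 < deg tgt.H u + deg src.H y"
  shows "right_curl (u, y) = lext (\<lambda>v. gen [(u, v)]) (bf y)"
proof (cases "deg src.H y = 0")
  case True
  have "lext (\<lambda>v. if 0 < deg tgt.H u + deg tgt.H v then gen [(u, v)] else 0) tgt.one
      = lext (\<lambda>v. gen [(u, v)]) tgt.one"
    using assms True by (intro lext_cong) (auto dest!: tgt.keys_one)
  then show ?thesis
    using assms True by (simp add: desusp_tensor_coalg bf_deg_0 lext_smul)
next
  case False
  then show ?thesis
    using assms by (simp add: theta_letter lext_lext tgt.itcomul_1 rsign_def del: itcomul.simps)
qed

text \<open>Both stages send letters to combinations of single letters, so the composite applies
  \<open>f\<close> to the two tensor factors one after the other. The interleaving of longer words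
  never occurs.\<close>

lemma curly_word:
  assumes "w \<in> lists (posgens (tensor_coalg src.H src.H))"
  shows "curly src.H tgt.H \<theta> (gen w) =
    wordmap (\<lambda>p. lext (\<lambda>u. lext (\<lambda>v. gen [(u, v)]) (bf (snd p))) (bf (fst p))) w"
proof -
  have "curly src.H tgt.H \<theta> (gen w) = wordmap (\<lambda>p. lext (wordmap right_curl) (left_curl p)) w"
    unfolding curly_def curly_left_def curly_right_def comp_def lext_gen
    by (rule lext_wordmap_wordmap)
  also have "\<dots> = wordmap (\<lambda>p. lext (\<lambda>u. lext (\<lambda>v. gen [(u, v)]) (bf (snd p))) (bf (fst p))) w"
  proof (rule wordmap_cong)
    fix p assume "p \<in> set w"
    then have p: "p \<in> posgens (tensor_coalg src.H src.H)" using assms by auto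
    then have "left_curl p = lext (\<lambda>u. gen [(u, snd p)]) (bf (fst p))"
      using left_curl_eq[of "fst p" "snd p"] by simp
    then have "lext (wordmap right_curl) (left_curl p)
        = lext (\<lambda>u. right_curl (u, snd p)) (bf (fst p))"
      by (simp only: lext_lext lext_gen wordmap.simps conc_Nil)
    also have "\<dots> = lext (\<lambda>u. lext (\<lambda>v. gen [(u, v)]) (bf (snd p))) (bf (fst p))"
      by (intro lext_cong right_curl_eq) (use p in \<open>auto dest!: keys_bf simp: posgens_tensor_coalg\<close>)
    finally show "lext (wordmap right_curl) (left_curl p) =
      lext (\<lambda>u. lext (\<lambda>v. gen [(u, v)]) (bf (snd p))) (bf (fst p))" .
  qed
  finally show ?thesis .
qed

lemma pseudo_hopf_map_cobar_map: "pseudo_hopf_map src.H tgt.H \<theta>"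
  unfolding pseudo_hopf_map_def
proof (intro conjI ballI cobar_map_chain_algebra_map)
  fix v :: "('x \<times> 'x) list \<Rightarrow>\<^sub>0 'r"
  assume v: "v \<in> fre (cobar (tensor_coalg src.H src.H))"
  let ?m = "\<lambda>p. desusp src.H (hmul src.H (gen p))"
  let ?m' = "\<lambda>p. desusp tgt.H (hmul tgt.H (gen p))"
  let ?N = "\<lambda>p. lext (\<lambda>u. lext (\<lambda>v. gen [(u, v)]) (bf (snd p))) (bf (fst p)) ::
      (('z \<times> 'z) list \<Rightarrow>\<^sub>0 'r)"
  have w: "w \<in> lists (posgens (tensor_coalg src.H src.H))" if "w \<in> Poly_Mapping.keys v" for w
    using v that by (auto simp: fre_iff gens_cobar)
  have m: "hmul src.H (gen p) = src.mH (fst p) (snd p)" if "p \<in> posgens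
      (tensor_coalg src.H src.H)" for p
    using that by (simp add: bmul_def onbasis_def posgens_tensor_coalg mem_Times_iff)
  have m': "hmul tgt.H (gen p) = tgt.mH (fst p) (snd p)" if "fst p \<in> gens tgt.H" "snd p \<in> gens
      tgt.H" for p
    using that by (cases p) (auto simp: bmul_def onbasis_def)
  have m_fre: "?m p \<in> fre (cobar src.H)" if p: "p \<in> posgens (tensor_coalg src.H src.H)" for p
    unfolding src.desusp_eq m[OF p]
    by (intro fre_lext piece_subset_fre[OF src.t_piece]) (auto dest!: src.keys_mH)
  have N_fre: "?N p \<in> fre (cobar (tensor_coalg tgt.H tgt.H))" if p: "p \<in> posgens
      (tensor_coalg src.H src.H)" for p
    using p by (intro fre_lext) (auto dest!: keys_bf simp: fre_gen gens_cobar posgens_tensor_coalg)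
  \<comment> \<open>Membership has to be established because \<theta> agrees with \<phi> only on its
    source module.\<close>
  have "lext (wordmap ?m) v \<in> fre (cobar src.H)"
    by (rule fre_lext, rule wordmap_fre[OF _ gens_cobar], rule m_fre) (use w in auto)
  then have "\<theta> (cobar_map (tensor_coalg src.H src.H) src.H (hmul src.H) v)
      = lext (\<lambda>w. lext \<phi> (wordmap ?m w)) v"
    using v by (simp add: cobar_map_def[of "tensor_coalg src.H src.H"] theta_eq lext_lext)
  also have "\<dots> = lext (\<lambda>w. lext (wordmap ?m') (wordmap ?N w)) v"
  proof (rule lext_cong)
    fix x assume x: "x \<in> Poly_Mapping.keys v"
    \<comment> \<open>Both sides come from multiplicative maps on words, so equality on letters
      suffices; there it is the multiplicativity of \<open>f\<close>.\<close>
    have "lext \<phi> (?m p) = lext (wordmap ?m') (?N p)" if p: "p \<in> posgens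
        (tensor_coalg src.H src.H)" for p
    proof -
      have "lext \<phi> (?m p) = lext tgt.t (lext bf (src.mH (fst p) (snd p)))"
        by (simp add: src.desusp_eq m[OF p] lext_lext phi_t)
      also have "\<dots> = lext (\<lambda>u. lext (\<lambda>v. lext tgt.t (tgt.mH u v)) (bf (snd p))) (bf (fst p))"
        by (simp add: bf_mul lext_lext)
      also have "\<dots> = lext (wordmap ?m') (?N p)"
        unfolding lext_lext lext_gen wordmap.simps conc_Nil tgt.desusp_eq
        by (intro lext_cong) (auto dest!: keys_bf simp: m')
      finally show ?thesis .
    qed
    then show "lext \<phi> (wordmap ?m x) = lext (wordmap ?m') (wordmap ?N x)"
      unfolding \<phi>_def lext_wordmap_wordmap using w[OF x] by (intro wordmap_cong) auto
  qed
  also have "\<dots> = lext (wordmap ?m') (lext (wordmap ?N) v)"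
    by (simp only: lext_lext)
  also have "\<dots> = cobar_map (tensor_coalg tgt.H tgt.H) tgt.H (hmul tgt.H) (curly src.H tgt.H \<theta> v)"
  proof -
    have "curly src.H tgt.H \<theta> v = lext (\<lambda>w. curly src.H tgt.H \<theta> (gen w)) v"
      unfolding curly_def curly_left_def curly_right_def comp_def lext_gen lext_lext ..
    also have "\<dots> = lext (wordmap ?N) v"
      by (intro lext_cong curly_word w)
    finally have "curly src.H tgt.H \<theta> v = lext (wordmap ?N) v" .
    moreover have "lext (wordmap ?N) v \<in> fre (cobar (tensor_coalg tgt.H tgt.H))"
      by (rule fre_lext, rule wordmap_fre[OF _ gens_cobar], rule N_fre) (use w in auto)
    ultimately show ?thesis by (simp add: cobar_map_def)
  qed
  finally show "\<theta> (cobar_map (tensor_coalg src.H src.H) src.H (hmul src.H) v) =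
    cobar_map (tensor_coalg tgt.H tgt.H) tgt.H (hmul tgt.H) (curly src.H tgt.H \<theta> v)" .
qed

lemma lext_G_fre: "z \<in> fre src.M \<Longrightarrow> lext G z \<in> fre tgt.M"
  by (rule fre_lext) (rule piece_subset_fre[OF G_piece])

lemma tmap_eq:
  assumes "z \<in> fre src.M"
  shows "tmap g \<theta> z = lext G z"
  unfolding tmap_def
proof (rule lext_cong)
  fix q assume "q \<in> Poly_Mapping.keys z"
  then have "fst q \<in> gens src.B" "snd q \<in> lists (posgens src.H)"
    using assms by (auto simp: fre_iff mem_Times_iff)
  moreover from this have "\<theta> (gen (snd q)) = \<phi> (snd q)" by (simp add: theta_eq fre_gen)
  ultimately show "(\<lambda>(x, y). tens (g (gen x)) (\<theta> (gen y))) q = G q"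
    by (simp add: G_def onbasis_def case_prod_unfold)
qed

end

section \<open>The embedding on morphisms\<close>

lemma Hom_CArD:
  assumes "P \<in> Obj CAr" "P' \<in> Obj CAr" "(f, g) \<in> Hom CAr P P'"
  shows "comod_algebra_map P P' f g"
  using assms by unfold_locales (auto simp: CAr_def)

lemma twisted_map_eq:
  assumes "comod_algebra_map P P' f g" "z \<in> fre (twisted P)"
  shows "twisted_map P P' (f, g) z = lext (comod_algebra_map.G P P' f g) z"
proof -
  interpret comod_algebra_map P P' f g by fact
  show ?thesis using assms(2) by (simp add: twisted_map_def tmap_eq)
qed

lemma embed_Hom:
  assumes "comod_algebra_map P P' f g"
  shows "embed P P' (f, g) \<in> Hom CASH P P'"
proof -
  interpret comod_algebra_map P P' f g by fact
  let ?\<gamma> = "twisted_map P P' (f, g)"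
  note eq = twisted_map_eq[OF assms, simplified]
  have map: "chain_algebra_map (twisted P) (twisted P') ?\<gamma>"
    unfolding chain_algebra_map_def chain_map_def
  proof (intro conjI ballI)
    show "graded_map 0 (twisted P) (twisted P') ?\<gamma>"
      by (rule graded_mapI[of _ _ G]) (simp_all add: eq G_piece del: gtensor_simps)
    have "tens (unt src.B) (gen []) \<in> fre src.M"
      using piece_subset_fre[OF unt_piece[OF src.chain_algebra_twisted]] by simp
    then show "?\<gamma> (unt (twisted P)) = unt (twisted P')"
      using G_unt by (simp add: eq) (simp add: tens_def lext_lext)
    fix u v :: "'b \<times> 'a list \<Rightarrow>\<^sub>0 'c"
    assume "u \<in> fre (twisted P)"
    then have u: "u \<in> fre src.M" by simp
    have "lext src.D u \<in> fre src.M"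
      using dif_fre[OF chain_algebra_complex[OF src.chain_algebra_twisted], of u] u
          by (simp add: src.dif_twisted)
    then show "?\<gamma> (dif (twisted P) u) = dif (twisted P') (?\<gamma> u)"
      using u by (simp add: eq src.dif_twisted tgt.dif_twisted lext_G_fre lext_lext G_D)
    assume "v \<in> fre (twisted P)"
    then have v: "v \<in> fre src.M" by simp
    have "mul (twisted P) (tens u v) \<in> fre src.M"
      using mul_fre[OF src.chain_algebra_twisted, of u v] u v by simp
    then have "?\<gamma> (mul (twisted P) (tens u v)) = lext (\<lambda>y. lext (\<lambda>z. lext G (src.Lmul y z)) v) u"
      using u v by (simp add: eq src.twisted_mul_tens lext_lext)
    also have "\<dots> = lext (\<lambda>x. lext (tgt.Lmul x) (lext G v)) (lext G u)"
      by (simp add: G_Lmul lext_lext lext_swap[of _ _ v])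
    finally show "?\<gamma> (mul (twisted P) (tens u v)) = mul (twisted P') (tens (?\<gamma> u) (?\<gamma> v))"
      using u v by (simp add: eq tgt.twisted_mul_tens lext_G_fre)
  qed
  \<comment> \<open>The right action appends words, and \<phi> turns concatenation into
    concatenation.\<close>
  have act: "?\<gamma> (right_act z w) = right_act (?\<gamma> z) (\<theta> w)"
    if "z \<in> fre (twisted P)" "w \<in> fre (cobar src.H)" for z w
  proof -
    have z: "z \<in> fre src.M" using that by simp
    have "right_act z w \<in> fre src.M"
      unfolding src.right_act_eq using that by (intro fre_lext) (auto simp: fre_iff fre_gen)
    then have "?\<gamma> (right_act z w) = lext (\<lambda>q. lext (\<lambda>v. G (fst q, snd q @ v)) w) z"
      by (simp add: eq) (simp add: src.right_act_eq lext_lext)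
    also have "\<dots> = right_act (lext G z) (lext \<phi> w)"
      by (simp add: tgt.right_act_eq lext_lext lext_G G_def tens_def phi_append lext_conc
          lext_swap[of _ _ w])
    finally show ?thesis using z that by (simp add: eq theta_eq)
  qed
  show ?thesis
    using map act pseudo_hopf_map_cobar_map
    by (simp add: embed_def CASH_def) (simp add: cobar_map_def twisted_map_def)
qed

section \<open>Functors\<close>

context comod_algebra
begin

lemma cobar_map_id: "cobar_map H H (restrict id (fre H)) = restrict id (fre (cobar H))"
proof
  fix v
  show "cobar_map H H (restrict id (fre H)) v = restrict id (fre (cobar H)) v"
  proof (cases "v \<in> fre (cobar H)")
    case True
    have "wordmap (\<lambda>x. desusp H (restrict id (fre H) (gen x))) w
        = (gen w :: 'x list \<Rightarrow>\<^sub>0 'r)" if "w \<in> lists (posgens H)" for w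
    proof -
      have "wordmap (\<lambda>x. desusp H (restrict id (fre H) (gen x))) w
          = wordmap (\<lambda>x. gen [x] :: 'x list \<Rightarrow>\<^sub>0 'r) w"
        using that by (intro wordmap_cong) (auto simp: desusp_eq t_def posgens_def fre_gen)
      then show ?thesis by (simp add: wordmap_letters)
    qed
    then have "lext (wordmap (\<lambda>x. desusp H (restrict id (fre H) (gen x)))) v = lext gen v"
      using True by (intro lext_cong) (auto simp: fre_iff)
    then show ?thesis using True by (simp add: cobar_map_def)
  qed (simp add: cobar_map_def)
qed

lemma embed_id: "embed P P (restrict id (fre H), restrict id (fre B)) =
    (restrict id (fre (cobar H)), restrict id (fre (twisted P)))"
proof -
  have "tmap (restrict id (fre B)) (restrict id (fre (cobar H))) z
      = z" if z: "z \<in> fre M" for z :: "'y \<times> 'x list \<Rightarrow>\<^sub>0 'r"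
  proof -
    have "tmap (restrict id (fre B)) (restrict id (fre (cobar H))) z = lext gen z"
      unfolding tmap_def
    proof (rule lext_cong)
      fix q assume "q \<in> Poly_Mapping.keys z"
      then have "fst q \<in> gens B" "snd q \<in> lists (posgens H)" using z
          by (auto simp: fre_iff mem_Times_iff)
      then show "(\<lambda>(x, y). tens (restrict id (fre B) (gen x)) (restrict id (fre (cobar H))
          (gen y))) q = gen q"
        by (simp add: case_prod_unfold fre_gen)
    qed
    then show ?thesis by simp
  qed
  then show ?thesis
    by (auto simp: embed_def twisted_map_def cobar_map_id fun_eq_iff)
qed

end

locale comod_algebra_map_pair =
  fst: comod_algebra_map P P' f g + snd: comod_algebra_map P' P'' f' g'
  for P :: "('x, 'y, 'r::comm_ring_1) comod_alg" and P' :: "('x, 'y, 'r) comod_alg"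
    and P'' :: "('x, 'y, 'r) comod_alg" and f g f' g'
begin

lemma f_compose: "x \<in> gens fst.src.H \<Longrightarrow> f' (f (gen x)) = lext snd.bf (fst.bf x)"
  using snd.f_lext[OF piece_subset_fre[OF fst.bf_piece[of x]]] by (simp add: onbasis_def)

lemma g_compose: "x \<in> gens fst.src.B \<Longrightarrow> g' (g (gen x)) = lext snd.bg (fst.bg x)"
  using snd.g_lext[OF piece_subset_fre[OF fst.bg_piece[of x]]] by (simp add: onbasis_def)

text \<open>Since \<phi> is determined by its letters, the claim reduces to naturality of
  desuspension for \<open>f'\<close>, applied to the terms of \<open>bf x\<close>.\<close>

lemma cobar_map_compose:
  assumes v: "v \<in> fre (cobar fst.src.H)"
  shows "cobar_map fst.src.H snd.tgt.H (compose (fre fst.src.H) f' f) v = lext snd.\<phi> (lext fst.\<phi> v)"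
proof -
  have "wordmap (\<lambda>x. desusp snd.tgt.H (compose (fre fst.src.H) f' f (gen x))) w
      = lext snd.\<phi> (fst.\<phi> w)"
    if w: "w \<in> lists (posgens fst.src.H)" for w
  proof -
    have "lext (wordmap (\<lambda>x. lext snd.tgt.t (snd.bf x))) (lext fst.tgt.t (fst.bf x))
        = lext snd.tgt.t (lext snd.bf (fst.bf x))" for x
      using snd.phi_t by (simp add: lext_lext snd.\<phi>_def)
    then show ?thesis
      using w unfolding snd.\<phi>_def fst.\<phi>_def lext_wordmap_wordmap
      by (intro wordmap_cong) (auto simp: compose_def fre_gen posgens_def f_compose
          snd.tgt.desusp_eq)
  qed
  then show ?thesis
    using v by (simp add: cobar_map_def lext_lext) (intro lext_cong, simp add: fre_iff)
qed

lemma embed_compose: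
  "embed P P'' (compose (fre fst.src.H) f' f, compose (fre fst.src.B) g' g) =
    (compose (fre (cobar fst.src.H)) (fst (embed P' P'' (f', g'))) (fst (embed P P' (f, g))),
     compose (fre (twisted P)) (snd (embed P' P'' (f', g'))) (snd (embed P P' (f, g))))"
proof -
  let ?F = "compose (fre fst.src.H) f' f" and ?G = "compose (fre fst.src.B) g' g"
  have 1: "cobar_map fst.src.H snd.tgt.H ?F = compose (fre (cobar fst.src.H)) snd.\<theta> fst.\<theta>"
  proof
    fix v
    show "cobar_map fst.src.H snd.tgt.H ?F v = compose (fre (cobar fst.src.H)) snd.\<theta> fst.\<theta> v"
    proof (cases "v \<in> fre (cobar fst.src.H)")
      case True
      then show ?thesis
        by (simp add: cobar_map_compose compose_eq fst.theta_eq snd.theta_eq fst.lext_phi_fre)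
    qed (simp add: cobar_map_def compose_def)
  qed
  have "tmap ?G (cobar_map fst.src.H snd.tgt.H ?F) z
      = lext snd.G (lext fst.G z)" if z: "z \<in> fre fst.src.M" for z
    unfolding tmap_def lext_lext[of snd.G]
  proof (rule lext_cong)
    fix q assume "q \<in> Poly_Mapping.keys z"
    then have q: "fst q \<in> gens fst.src.B" "snd q \<in> lists (posgens fst.src.H)" using z
        by (auto simp: fre_iff mem_Times_iff)
    then have w: "(gen (snd q) :: 'x list \<Rightarrow>\<^sub>0 'r) \<in> fre (cobar fst.src.H)" by (simp add: fre_gen)
    have "lext snd.G (fst.G q) = tens (lext snd.bg (fst.bg (fst q))) (lext snd.\<phi> (fst.\<phi> (snd q)))"
      by (simp add: fst.lext_G snd.G_def tens_def lext_lext lext_swap[of _ _ "fst.\<phi> _"])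
    then show "(\<lambda>(x, y). tens (?G (gen x)) (cobar_map fst.src.H snd.tgt.H ?F (gen y))) q
        = lext snd.G (fst.G q)"
      using q by (simp add: case_prod_unfold cobar_map_compose[OF w] compose_eq fre_gen g_compose)
  qed
  then have 2: "twisted_map P P'' (?F, ?G) = compose (fre (twisted P)) (twisted_map P' P''
      (f', g')) (twisted_map P P' (f, g))"
    by (auto simp: fun_eq_iff twisted_map_def compose_def fst.tmap_eq snd.tmap_eq fst.lext_G_fre)
  show ?thesis using 1 2 by (simp add: embed_def)
qed

end

lemma embed_functor:
  "is_functor (CAr :: (('x, 'y, 'r::comm_ring_1) comod_alg, ('x, 'y, 'r) ca_mor) cat_data)
     CASH (\<lambda>P. P) embed"
  unfolding is_functor_def
proof (intro conjI ballI)
  fix P :: "('x, 'y, 'r) comod_alg" assume P: "P \<in> Obj CAr"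
  then show "P \<in> Obj CASH" by (simp add: CAr_def CASH_def)
  interpret comod_algebra P using P by unfold_locales (simp add: CAr_def)
  show "embed P P (Ident CAr P) = Ident CASH P"
    by (simp add: CAr_def CASH_def embed_id del: fre_twisted)
  fix P' :: "('x, 'y, 'r) comod_alg" and m :: "('x, 'y, 'r) ca_mor"
  assume P': "P' \<in> Obj CAr" and m: "m \<in> Hom CAr P P'"
  obtain f g where fg: "m = (f, g)" by (cases m)
  have map: "comod_algebra_map P P' f g" using Hom_CArD[OF P P'] m fg by simp
  show "embed P P' m \<in> Hom CASH P P'" unfolding fg by (rule embed_Hom[OF map])
  fix P'' :: "('x, 'y, 'r) comod_alg" and m' :: "('x, 'y, 'r) ca_mor"
  assume P'': "P'' \<in> Obj CAr" and m': "m' \<in> Hom CAr P' P''"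
  obtain f' g' where fg': "m' = (f', g')" by (cases m')
  have map': "comod_algebra_map P' P'' f' g'" using Hom_CArD[OF P' P''] m' fg' by simp
  interpret comod_algebra_map_pair P P' P'' f g f' g'
    by (intro comod_algebra_map_pair.intro map map')
  show "embed P P'' (Comp CAr P P' P'' m' m) = Comp CASH P P' P'' (embed P' P'' m') (embed P P' m)"
    unfolding fg fg' using embed_compose
    by (simp add: CAr_def CASH_def case_prod_unfold)
qed

text \<open>Composites of the components \<gamma> are again chain algebra maps. Hence every
  composable pair is respected, even though the composite of the components \<theta> need not be a
  pseudo Hopf algebra morphism.\<close>

lemma Cotor_functor:
  "is_functor (CASH :: (('x, 'y, 'r::comm_ring_1) comod_alg, ('x, 'y, 'r) cash_mor) cat_data)
     grA Cotor (\<lambda>P P' m. homology_map (twisted P) (twisted P') (snd m))"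
  unfolding is_functor_def
proof (intro conjI ballI)
  have A: "chain_algebra (twisted P)" if "P \<in> Obj CASH" for P :: "('x, 'y, 'r) comod_alg"
    using that by (intro comod_algebra.chain_algebra_twisted comod_algebra.intro)
        (simp add: CASH_def)
  have M: "chain_algebra_map (twisted P) (twisted P') (snd m)" if "m \<in> Hom CASH P P'"
    for P P' :: "('x, 'y, 'r) comod_alg" and m
    using that by (auto simp: CASH_def)
  fix P :: "('x, 'y, 'r) comod_alg" assume P: "P \<in> Obj CASH"
  show "Cotor P \<in> Obj grA"
    by (simp add: grA_def Cotor_def graded_algebra_homology[OF A[OF P]])
  show "homology_map (twisted P) (twisted P) (snd (Ident CASH P)) = Ident grA (Cotor P)"
    by (simp add: CASH_def grA_def Cotor_def fun_eq_iff homology_map_id[OF A[OF P]])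
  fix P' :: "('x, 'y, 'r) comod_alg" and m :: "('x, 'y, 'r) cash_mor"
  assume P': "P' \<in> Obj CASH" and m: "m \<in> Hom CASH P P'"
  show "homology_map (twisted P) (twisted P') (snd m) \<in> Hom grA (Cotor P) (Cotor P')"
    using graded_algebra_map_homology[OF M[OF m] A[OF P] A[OF P']]
    by (simp add: grA_def Cotor_def homology_map_extensional)
  fix P'' :: "('x, 'y, 'r) comod_alg" and m' :: "('x, 'y, 'r) cash_mor"
  assume P'': "P'' \<in> Obj CASH" and m': "m' \<in> Hom CASH P' P''"
  have eq: "snd (Comp CASH P P' P'' m' m) = compose (fre (twisted P)) (snd m') (snd m)"
    by (simp add: CASH_def case_prod_unfold)
  show "homology_map (twisted P) (twisted P'') (snd (Comp CASH P P' P'' m' m)) =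
     Comp grA (Cotor P) (Cotor P') (Cotor P'') (homology_map (twisted P') (twisted P'') (snd m'))
       (homology_map (twisted P) (twisted P') (snd m))"
    unfolding eq by (rule ext) (simp add: grA_def Cotor_def
        homology_map_compose[OF M[OF m] M[OF m'] A[OF P] A[OF P'] A[OF P'']])
qed

lemma is_functor_comp:
  assumes F: "is_functor C D F\<^sub>o F\<^sub>m" and G: "is_functor D E G\<^sub>o G\<^sub>m"
  shows "is_functor C E (\<lambda>X. G\<^sub>o (F\<^sub>o X)) (\<lambda>X Y f. G\<^sub>m (F\<^sub>o X) (F\<^sub>o Y) (F\<^sub>m X Y f))"
  using F G unfolding is_functor_def by simp

theorem proposition3p19:
  assumes "pid TYPE('r::idom)"
  shows "is_functor (CAr :: (('x, 'y, 'r) comod_alg, ('x, 'y, 'r) ca_mor) cat_data)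
           grA Cotor Cotor_map \<and>
         is_functor (CAr :: (('x, 'y, 'r) comod_alg, ('x, 'y, 'r) ca_mor) cat_data)
           CASH (\<lambda>P. P) embed \<and>
         (\<exists>F\<^sub>o F\<^sub>m. is_functor (CASH :: (('x, 'y, 'r) comod_alg, ('x, 'y, 'r) cash_mor) cat_data)
              grA F\<^sub>o F\<^sub>m \<and>
            (\<forall>P\<in>Obj CAr. F\<^sub>o P = Cotor P) \<and>
            (\<forall>P\<in>Obj CAr. \<forall>P'\<in>Obj CAr. \<forall>m\<in>Hom CAr P P'.
               F\<^sub>m P P' (embed P P' m) = Cotor_map P P' m))"
proof -
  \<comment> \<open>The second component of \<open>embed\<close> is by definition the map whose
    homology is \<open>Cotor_map\<close>, so the extension property needs no computation.\<close>
  have ext: "homology_map (twisted P) (twisted P') (snd (embed P P' m)) = Cotor_map P P' m"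
    for P P' :: "('x, 'y, 'r) comod_alg" and m
    by (simp add: embed_def Cotor_map_def)
  then have "(\<lambda>P P' m. homology_map (twisted P) (twisted P') (snd (embed P P' m))) =
      (Cotor_map :: ('x, 'y, 'r) comod_alg \<Rightarrow> _)"
    by (simp add: fun_eq_iff)
  \<comment> \<open>Functoriality of \<open>Cotor\<close> on \<open>CAr\<close> is inherited: it is
    the embedding followed by the functor on \<open>CASH\<close>.\<close>
  moreover have "is_functor (CAr :: (('x, 'y, 'r) comod_alg, ('x, 'y, 'r) ca_mor) cat_data) grA
      Cotor
      (\<lambda>P P' m. homology_map (twisted P) (twisted P') (snd (embed P P' m)))"
    by (rule is_functor_comp[OF embed_functor Cotor_functor])
  ultimately have "is_functor (CAr :: (('x, 'y, 'r) comod_alg,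
      ('x, 'y, 'r) ca_mor) cat_data) grA Cotor Cotor_map"
    by simp
  with ext show ?thesis
    by (intro conjI embed_functor exI[of _ Cotor]
        exI[of _ "\<lambda>P P' m. homology_map (twisted P) (twisted P') (snd m)"] Cotor_functor) simp_all
qed

end
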